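(* Let $\Lambda$ be the von Mangoldt function, $\psi(x)=\sum_{n\le x}\Lambda(n)$, $r(x)=\psi(x)-x$, and $\bar r(x)=\frac{1}{x}\sum_{n\le x} r(n)$, the sum over positive integers $n$. For $x>1$ let $$\eta=\eta(x)=\max\{\operatorname{Re}\rho \;:\; \rho \text{ a non-trivial zero of } \zeta(s),\ |\operatorname{Im}\rho|\le x^{1/4}\log x\}.$$ Then $$\bar r(x)\ll x^{\eta}.$$ Moreover, in general, $$\bar r(x)\ll x\exp\!\left(-2^{2/5}\, c_1 (\log x)^{3/5}(\log\log x)^{-1/5}\right).$$
   Context: $\zeta(s)$ is the Riemann zeta-function and its non-trivial zeros are its zeros $\rho$ with $0<\operatorname{Re}\rho<1$. The notation $f(x)\ll g(x)$ means $|f(x)|\le C g(x)$ for all sufficiently large $x$, with an absolute constant $C$. The constant $c_1>0$ is the constant in Walfisz's form of the prime number theorem, $r(x)\ll x(\log x)^{6/5}\exp\!\left(-c_1(\log x)^{3/5}(\log\log x)^{-1/5}\right)$; equivalently, $c_1=c_0^{3/5}(3/5)^{-1/5}$ where $c_0>0$ is a constant such that $\zeta(\sigma+it)$ has no zeros in the region $\sigma\ge 1-c_0(\log^2 t\,\log\log t)^{-1/3}$ (for $t$ large). *)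

theory Defs
  imports "HOL-Complex_Analysis.Complex_Analysis" "HOL-Number_Theory.Number_Theory"
begin

definition zeta :: "complex \<Rightarrow> complex" where
  "zeta = (SOME f. f holomorphic_on (- {1}) \<and>
      (\<forall>s. 1 < Re s \<longrightarrow> (\<lambda>n. 1 / (of_nat (Suc n)) powr s) sums f s))"

definition nontrivial_zero :: "complex \<Rightarrow> bool" where
  "nontrivial_zero \<rho> \<longleftrightarrow> zeta \<rho> = 0 \<and> 0 < Re \<rho> \<and> Re \<rho> < 1"

definition psi :: "real \<Rightarrow> real" where
  "psi x = (\<Sum>n\<in>{1..nat \<lfloor>x\<rfloor>}. mangoldt n)"

definition r :: "real \<Rightarrow> real" where
  "r x = psi x - x"

definition rbar :: "real \<Rightarrow> real" where
  "rbar x = (1 / x) * (\<Sum>n\<in>{1..nat \<lfloor>x\<rfloor>}. r (real n))"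

definition eta :: "real \<Rightarrow> real" where
  "eta x = Sup {Re \<rho> | \<rho>. nontrivial_zero \<rho> \<and> \<bar>Im \<rho>\<bar> \<le> x powr (1/4) * ln x}"

end

theory Submission
  imports Defs "HOL-Probability.Probability" "HOL-Real_Asymp.Real_Asymp"
begin

text \<open>With \<open>X = N + 1\<close>, the sum \<open>\<Sum>n\<le>N. \<psi>(n)\<close> is \<open>\<Sum>m\<le>X. \<Lambda>(m) (X - m)\<close>, whose Perron
  kernel \<open>X powr (s + 1) / (s (s + 1))\<close> decays quadratically. Truncating at height \<open>T\<close> and moving
  the contour to \<open>Re s = - 1 / 2\<close> therefore costs only \<open>X\<^sup>2 ln\<^sup>2 X / T\<^sup>2 + X ln X\<close>, and a zero
  \<open>\<rho>\<close> contributes \<open>X powr (1 + Re \<rho>) / \<bar>\<rho>\<bar>\<^sup>2\<close>, where \<open>\<Sum>\<rho>. \<bar>\<rho>\<bar> powr (- 3 / 2)\<close>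
  converges.

  For \<open>T = x powr (1 / 4) ln x\<close> the truncation costs \<open>x powr (1 / 2)\<close> after division by \<open>x\<close>.
  This is absorbed by \<open>x powr \<eta>\<close> because \<open>\<zeta>\<close> has a zero with real part at least \<open>1 / 2\<close>.

  In the second bound put \<open>L = ln x\<close> and \<open>u = ln \<bar>Im \<rho>\<bar>\<close>. After \<open>\<bar>\<rho>\<bar> powr (- 3 / 2)\<close> is split
  off, a zero contributes at most \<open>x exp (- (u / 2 + c\<^sub>0 L (u\<^sup>2 ln u) powr (- 1 / 3)))\<close>. The exponent
  is optimised over \<open>u\<close>, and \<open>T\<close> is chosen equal to the factor that is saved.\<close>

text \<open>\<open>zeta\<close> is specified only through a choice operator, so a continuation has
  to be built and shown to be unique. Riemann's theta integral is used because it also yields the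
  symmetry s -> 1 - s and growth of order 3/2, from which the existence of a zero follows. The work
  is then done with \<open>zeta_reg\<close>, which is entire: without a pole at 1 it can be studied
  on discs around every 2 + i t with one and the same local lemma. The line Re s = -1/2 lies between
  the pole -1 of the kernel and all non-trivial zeros; the pole 0 of the kernel is crossed and costs
  only a term of order X. The factor 2^(2/5) comes from the squared denominator. With L = ln x and
  ln u replaced by 3/5 ln L, balancing u against c0 L (u^2 ln u)^(-1/3) gives the constant c1 of the
  prime number theorem. Here truncation saves 2 u, so 2 u is balanced against the same term; at the
  solution u = A the saving 2 A has the constant 2^(2/5) c1.\<close>

section \<open>Bounds for a function and its derivative from its real part\<close>

text \<open>Since Re L < M, the value L z is nearer to 0 than to 2 M, so \<phi> = L / (2 M - L),
  rescaled, maps the unit disc into itself and fixes 0. The Schwarz lemma bounds \<phi>, and solving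
  for L gives the estimate.\<close>

lemma Borel_Caratheodory:
  assumes hol: "L holomorphic_on ball a q" and q: "q > 0" and L0: "L a = 0" and M: "M > 0"
    and Re: "\<And>z. z \<in> ball a q \<Longrightarrow> Re (L z) < M" and z: "z \<in> ball a q"
  shows "norm (L z) \<le> 2 * M * norm (z - a) / (q - norm (z - a))"
proof -
  define \<phi> where "\<phi> = (\<lambda>u. L (a + of_real q * u) / (2 * of_real M - L (a + of_real q * u)))"
  have inb: "a + of_real q * u \<in> ball a q" if "norm u < 1" for u
    using that q by (simp add: dist_norm norm_mult)
  have nz: "2 * of_real M - L w \<noteq> 0" if "w \<in> ball a q" for w
  proof
    assume "2 * of_real M - L w = 0"
    hence "L w = of_real (2 * M)" by simp
    with Re[OF that] M show False by simp
  qed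
  have less: "norm (L w) < norm (2 * of_real M - L w)" if "w \<in> ball a q" for w
  proof -
    have "(norm (L w))\<^sup>2 < (norm (2 * of_real M - L w))\<^sup>2"
    proof -
      have "(norm (2 * of_real M - L w))\<^sup>2 - (norm (L w))\<^sup>2 = 4 * M * (M - Re (L w))"
        unfolding cmod_power2 by (simp add: power2_eq_square algebra_simps)
      also have "\<dots> > 0" using M Re[OF that] by simp
      finally show ?thesis by simp
    qed
    thus ?thesis using power2_less_imp_less by fastforce
  qed
  have "(\<lambda>u. L (a + of_real q * u)) holomorphic_on ball 0 1"
  proof -
    have "(L \<circ> (\<lambda>u. a + of_real q * u)) holomorphic_on ball 0 1"
      by (rule holomorphic_on_compose_gen[OF _ hol]) (use inb in \<open>auto intro!: holomorphic_intros\<close>)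
    thus ?thesis by (simp add: o_def)
  qed
  hence hol\<phi>: "\<phi> holomorphic_on ball 0 1"
    unfolding \<phi>_def by (intro holomorphic_intros) (use nz inb in auto)
  define u where "u = (z - a) / of_real q"
  have u: "norm u < 1" and zu: "z = a + of_real q * u" and nu: "norm u = norm (z - a) / q"
    using z q by (auto simp: u_def norm_divide dist_norm norm_minus_commute)
  have \<phi>1: "norm (\<phi> v) < 1" if "norm v < 1" for v
    using less[OF inb[OF that]] unfolding \<phi>_def norm_divide
    by (subst divide_less_eq_1_pos) (auto intro: le_less_trans)
  have "norm (\<phi> u) \<le> norm u"
    by (rule Schwarz_Lemma(1)[OF hol\<phi> _ \<phi>1 u]) (auto simp: \<phi>_def L0)
  hence "norm (L z) / norm (2 * of_real M - L z) \<le> norm u"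
    by (simp add: \<phi>_def zu[symmetric] norm_divide)
  hence "norm (L z) \<le> norm u * norm (2 * of_real M - L z)"
    using nz[OF z] by (simp add: pos_divide_le_eq)
  also have "\<dots> \<le> norm u * (2 * M + norm (L z))"
    using norm_triangle_ineq4[of "2 * of_real M" "L z"] M by (intro mult_left_mono) auto
  finally have "norm (L z) * (1 - norm u) \<le> 2 * M * norm u" by (simp add: algebra_simps)
  hence "norm (L z) \<le> 2 * M * norm u / (1 - norm u)" using u by (simp add: pos_le_divide_eq)
  also have "\<dots> = 2 * M * norm (z - a) / (q - norm (z - a))"
    using q u by (simp add: nu field_simps)
  finally show ?thesis .
qed

text \<open>Cauchy's inequality on a circle of half the remaining width, d = (q - s) / 2, whose disc
  still keeps distance d from the boundary of the large disc.\<close>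

lemma Borel_Caratheodory_deriv:
  assumes hol: "L holomorphic_on ball a q" and L0: "L a = 0" and M: "M > 0"
    and Re: "\<And>z. z \<in> ball a q \<Longrightarrow> Re (L z) < M" and z: "z \<in> cball a s" and s: "0 \<le> s" "s < q"
  shows "norm (deriv L z) \<le> 8 * M * q / (q - s)\<^sup>2"
proof -
  define d where "d = (q - s) / 2"
  have d: "d > 0" and sd: "s + d = q - d" using s by (auto simp: d_def field_simps)
  have sub: "cball z d \<subseteq> cball a (q - d)"
    using z sd by (subst cball_subset_cball_iff) (auto simp: dist_commute)
  have sub': "cball a (q - d) \<subseteq> ball a q" using d by (auto simp: )
  have bound: "norm (L w) \<le> 2 * M * q / d" if "w \<in> cball z d" for w
  proof -
    have w: "w \<in> cball a (q - d)" using sub that by auto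
    have nw: "norm (w - a) \<le> q - d" using w by (simp add: dist_norm norm_minus_commute)
    have "norm (L w) \<le> 2 * M * norm (w - a) / (q - norm (w - a))"
      by (rule Borel_Caratheodory[OF hol _ L0 M Re]) (use w sub' s in auto)
    also have "\<dots> \<le> 2 * M * q / d"
      using nw M d s by (intro frac_le mult_left_mono mult_nonneg_nonneg) auto
    finally show ?thesis .
  qed
  have hol2: "L holomorphic_on cball z d"
    using hol sub sub' by (meson holomorphic_on_subset subset_trans)
  have "norm ((deriv ^^ 1) L z) \<le> fact 1 * (2 * M * q / d) / d ^ 1"
    by (rule Cauchy_inequality[OF holomorphic_on_subset[OF hol2] holomorphic_on_imp_continuous_on[OF hol2] d bound])
       (use d in \<open>auto simp: dist_norm\<close>)
  also have "\<dots> = 8 * M * q / (q - s)\<^sup>2"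
    using s by (simp add: d_def field_simps power2_eq_square)
  finally show ?thesis by simp
qed

section \<open>Removing zeros from entire functions\<close>

text \<open>\<open>zorder\<close> is an integer because it also measures poles. For an entire
  function that is not identically zero the cast to \<open>nat\<close> loses nothing, and it allows
  use as an exponent. The value is 0 at points that are not zeros.\<close>

definition zmult :: "(complex \<Rightarrow> complex) \<Rightarrow> complex \<Rightarrow> nat" where
  "zmult f \<rho> = nat (zorder f \<rho>)"

text \<open>The point \<open>w\<close> excludes the zero function. The quotient is glued from the
  local factor \<open>zor_poly\<close> near \<rho> and the plain quotient away from \<rho>; both are
  holomorphic on open sets that together cover the plane.\<close>

lemma entire_divide_zero:
  assumes hol: "f holomorphic_on UNIV" and nz: "f w \<noteq> 0"
  obtains g where "g holomorphic_on UNIV" "\<And>z. f z = g z * (z - \<rho>) ^ zmult f \<rho>" "g \<rho> \<noteq> 0"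
proof -
  define n where "n = zmult f \<rho>"
  define zp where "zp = zor_poly f \<rho>"
  from zorder_exist_zero[OF hol open_UNIV connected_UNIV, of \<rho>] nz
  obtain q where q: "q > 0" "zp holomorphic_on cball \<rho> q"
     "\<And>w. w \<in> cball \<rho> q \<Longrightarrow> f w = zp w * (w - \<rho>) ^ n \<and> zp w \<noteq> 0"
    unfolding n_def zp_def zmult_def by blast
  define g where "g = (\<lambda>z. if z = \<rho> then zp z else f z / (z - \<rho>) ^ n)"
  have eq: "g z = zp z" if "z \<in> ball \<rho> q" for z
    using q(3)[of z] that by (auto simp: g_def)
  have "g holomorphic_on ball \<rho> q"
    using holomorphic_on_subset[OF q(2) ball_subset_cball] eq by (metis holomorphic_cong)
  moreover have "g holomorphic_on (- {\<rho>})"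
  proof -
    have "(\<lambda>z. f z / (z - \<rho>) ^ n) holomorphic_on (- {\<rho>})"
      by (intro holomorphic_intros holomorphic_on_subset[OF hol]) auto
    thus ?thesis by (rule holomorphic_transform) (auto simp: g_def)
  qed
  ultimately have "g holomorphic_on (ball \<rho> q \<union> - {\<rho>})"
    by (intro holomorphic_on_Un) auto
  moreover have "ball \<rho> q \<union> - {\<rho>} = UNIV" using q(1) by auto
  ultimately have "g holomorphic_on UNIV" by simp
  moreover have "f z = g z * (z - \<rho>) ^ n" for z
    using q(1) q(3)[of \<rho>] by (auto simp: g_def)
  moreover have "g \<rho> \<noteq> 0" using q(1) q(3)[of \<rho>] by (auto simp: g_def)
  ultimately show ?thesis using that n_def by blast
qed

lemma entire_eventually_nonzero:
  assumes hol: "f holomorphic_on UNIV" and nz: "f w \<noteq> 0"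
  shows "eventually (\<lambda>z. f z \<noteq> 0) (at (\<rho>::complex))"
proof -
  obtain g where g: "g holomorphic_on UNIV" "\<And>z. f z = g z * (z - \<rho>) ^ zmult f \<rho>" "g \<rho> \<noteq> 0"
    using entire_divide_zero[OF hol nz] by metis
  have "isCont g \<rho>"
    using g(1) by (simp add: holomorphic_on_imp_differentiable_at field_differentiable_imp_continuous_at)
  hence "eventually (\<lambda>z. g z \<noteq> 0) (at \<rho>)"
    using g(3) by (simp add: isCont_def tendsto_imp_eventually_ne)
  moreover have "eventually (\<lambda>z. z \<noteq> \<rho>) (at \<rho>)" by (simp add: eventually_at_filter)
  ultimately show ?thesis by eventually_elim (simp add: g(2))
qed

text \<open>Zeros are split off one at a time. The order of \<open>f\<close> at a new point equals
  that of the current quotient \<open>g\<close>, because orders add and the product already removed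
  does not vanish there.\<close>

lemma entire_factorization:
  assumes hol: "f holomorphic_on UNIV" and nz: "f w \<noteq> 0" and fin: "finite A"
  obtains g where "g holomorphic_on UNIV"
    "\<And>z. f z = g z * (\<Prod>\<rho>\<in>A. (z - \<rho>) ^ zmult f \<rho>)" "\<And>\<rho>. \<rho> \<in> A \<Longrightarrow> g \<rho> \<noteq> 0"
proof -
  from fin have "\<exists>g. g holomorphic_on UNIV \<and> (\<forall>z. f z = g z * (\<Prod>\<rho>\<in>A. (z - \<rho>) ^ zmult f \<rho>)) \<and> (\<forall>\<rho>\<in>A. g \<rho> \<noteq> 0)"
  proof (induction A)
    case empty
    show ?case using hol by (intro exI[of _ f]) auto
  next
    case (insert \<rho> A)
    then obtain g where g: "g holomorphic_on UNIV" "\<And>z. f z = g z * (\<Prod>\<rho>\<in>A. (z - \<rho>) ^ zmult f \<rho>)"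
      "\<And>\<rho>. \<rho> \<in> A \<Longrightarrow> g \<rho> \<noteq> 0" by blast
    define P where "P = (\<lambda>z. \<Prod>\<rho>\<in>A. (z - \<rho>) ^ zmult f \<rho>)"
    have P: "P holomorphic_on UNIV" unfolding P_def by (intro holomorphic_intros)
    have P0: "P \<rho> \<noteq> 0" unfolding P_def using insert.hyps by auto
    have gw: "g w \<noteq> 0" using g(2)[of w] nz by auto
    have "eventually (\<lambda>z. f z \<noteq> 0) (at \<rho>)" by (rule entire_eventually_nonzero[OF hol nz])
    hence "zorder (\<lambda>z. g z * P z) \<rho> = zorder g \<rho> + zorder P \<rho>"
      by (intro zorder_times_analytic)
         (use g(1) P in \<open>auto simp: P_def g(2) analytic_on_holomorphic intro!: exI[of _ UNIV]\<close>)
    moreover have "zorder P \<rho> = 0"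
      using P P0 by (intro zorder_eq_0I) (auto simp: analytic_on_holomorphic)
    moreover have "f = (\<lambda>z. g z * P z)" using g(2) by (auto simp: P_def)
    ultimately have eq: "zmult f \<rho> = zmult g \<rho>" by (simp add: zmult_def)
    obtain g' where g': "g' holomorphic_on UNIV" "\<And>z. g z = g' z * (z - \<rho>) ^ zmult g \<rho>" "g' \<rho> \<noteq> 0"
      using entire_divide_zero[OF g(1) gw] by metis
    show ?case
    proof (intro exI conjI allI ballI)
      show "g' holomorphic_on UNIV" by fact
      show "f z = g' z * (\<Prod>\<rho>\<in>insert \<rho> A. (z - \<rho>) ^ zmult f \<rho>)" for z
        using insert.hyps g(2)[of z] g'(2)[of z] eq by (simp add: mult.assoc)
      show "g' x \<noteq> 0" if "x \<in> insert \<rho> A" for x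
        using that g'(2)[of x] g'(3) g(3)[of x] by auto
    qed
  qed
  thus ?thesis using that by blast
qed

lemma has_field_derivative_prod_power:
  fixes u :: "'a \<Rightarrow> complex \<Rightarrow> complex"
  assumes "finite A" "\<And>a. a \<in> A \<Longrightarrow> (u a has_field_derivative u' a) (at z)" "\<And>a. a \<in> A \<Longrightarrow> u a z \<noteq> 0"
  shows "((\<lambda>z. \<Prod>a\<in>A. u a z ^ m a) has_field_derivative
           (\<Prod>a\<in>A. u a z ^ m a) * (\<Sum>a\<in>A. of_nat (m a) * u' a / u a z)) (at z)"
  using assms
proof (induction A)
  case (insert a A)
  have "(u a has_field_derivative u' a) (at z)" "u a z \<noteq> 0" using insert by auto
  hence "((\<lambda>z. u a z ^ m a) has_field_derivative u a z ^ m a * (of_nat (m a) * u' a / u a z)) (at z)"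
    using DERIV_power[of "u a" "u' a" z UNIV "m a"] by (cases "m a") (auto simp: mult_ac)
  from DERIV_mult[OF this insert.IH] insert show ?case
    by (auto simp: algebra_simps)
qed auto

lemma has_field_derivative_mult_log_deriv:
  fixes g P :: "complex \<Rightarrow> complex"
  assumes "(g has_field_derivative g') (at z)" "(P has_field_derivative P z * S) (at z)" "g z \<noteq> 0"
  shows "((\<lambda>z. g z * P z) has_field_derivative (g z * P z) * (g' / g z + S)) (at z)"
  using DERIV_mult[OF assms(1,2)] assms(3) by (simp add: distrib_left mult_ac add.commute)

lemma finite_zeros_entire:
  assumes hol: "f holomorphic_on UNIV" and nz: "f w \<noteq> 0" and K: "compact K"
  shows "finite {z \<in> K. f z = 0}"
proof (rule ccontr)
  assume "infinite {z \<in> K. f z = 0}"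
  then obtain z where z: "z islimpt {z \<in> K. f z = 0}"
    using K by (metis (no_types, lifting) Heine_Borel_imp_Bolzano_Weierstrass mem_Collect_eq subsetI)
  hence "frequently (\<lambda>z. z \<in> {z \<in> K. f z = 0}) (at z)" by (simp add: islimpt_conv_frequently_at)
  hence "frequently (\<lambda>z. f z = 0) (at z)" by (rule frequently_elim1) auto
  with entire_eventually_nonzero[OF hol nz, of z] show False
    by (simp add: frequently_def)
qed

lemma prod_power_le_power_sum:
  fixes x :: "'a \<Rightarrow> real"
  assumes "\<And>a. a \<in> A \<Longrightarrow> 0 \<le> x a \<and> x a \<le> y"
  shows "(\<Prod>a\<in>A. x a ^ m a) \<le> y ^ (\<Sum>a\<in>A. m a)"
  unfolding power_sum by (rule prod_mono) (use assms in \<open>auto intro: power_mono\<close>)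

text \<open>Blaschke factors remove the zeros in the disc without increasing the maximum of
  \<open>\<bar>h\<bar>\<close> on its boundary.\<close>

lemma log_deriv_local:
  assumes hol: "h holomorphic_on UNIV" and a: "h a \<noteq> 0" and rs: "0 \<le> r2" "r2 < r1" "r1 < R"
    and bound: "\<And>z. z \<in> cball a R \<Longrightarrow> norm (h z) \<le> B * norm (h a)"
  defines "Z \<equiv> {z \<in> cball a r1. h z = 0}"
  shows "real (\<Sum>\<rho>\<in>Z. zmult h \<rho>) * ln (R / r1) \<le> ln B" (is ?th1)
    and "\<And>z. z \<in> cball a r2 \<Longrightarrow> h z \<noteq> 0 \<Longrightarrow>
       norm (deriv h z / h z - (\<Sum>\<rho>\<in>Z. of_nat (zmult h \<rho>) / (z - \<rho>)))
         \<le> (8 * r1 / (r1 - r2)\<^sup>2 + r1 / ((R\<^sup>2 - r1\<^sup>2) * ln (R / r1))) * (ln B + 1)"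
proof -
  have r1: "r1 > 0" and R: "R > 0" using rs by auto
  have finZ: "finite Z" unfolding Z_def by (rule finite_zeros_entire[OF hol a]) auto
  obtain g where g: "g holomorphic_on UNIV"
    "\<And>z. h z = g z * (\<Prod>\<rho>\<in>Z. (z - \<rho>) ^ zmult h \<rho>)" "\<And>\<rho>. \<rho> \<in> Z \<Longrightarrow> g \<rho> \<noteq> 0"
    using entire_factorization[OF hol a finZ] by metis
  define n where "n = (\<Sum>\<rho>\<in>Z. zmult h \<rho>)"
  \<comment> \<open>On the circle of radius R the modulus of this factor equals that of z - \<rho>;
    at the centre it is R, and it has no zero in the disc of radius r1. Exchanging the factors z -
    \<rho> of h for it yields G.\<close>
  define bl where "bl = (\<lambda>\<rho> z. (of_real (R\<^sup>2) - cnj (\<rho> - a) * (z - a)) / of_real R)"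
  define G where "G = (\<lambda>z. g z * (\<Prod>\<rho>\<in>Z. bl \<rho> z ^ zmult h \<rho>))"
  have Zr: "norm (\<rho> - a) \<le> r1" if "\<rho> \<in> Z" for \<rho>
    using that by (auto simp: Z_def dist_norm norm_minus_commute)
  have blprod: "norm (cnj (\<rho> - a) * (z - a)) \<le> r1\<^sup>2" if "\<rho> \<in> Z" "z \<in> cball a r1" for \<rho> z
    unfolding norm_mult power2_eq_square
    by (intro mult_mono) (use Zr[OF that(1)] that(2) r1 in \<open>auto simp: dist_norm norm_minus_commute simp del: complex_cnj_diff\<close>)
  have R2: "r1\<^sup>2 < R\<^sup>2" using rs r1 by (intro power_strict_mono) auto
  have blden: "norm (of_real (R\<^sup>2) - cnj (\<rho> - a) * (z - a)) \<ge> R\<^sup>2 - r1\<^sup>2"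
    if "\<rho> \<in> Z" "z \<in> cball a r1" for \<rho> z
    using norm_triangle_ineq2[of "of_real (R\<^sup>2)" "cnj (\<rho> - a) * (z - a)"] blprod[OF that]
      by (simp add: norm_power del: complex_cnj_diff)
  have bl0: "bl \<rho> z \<noteq> 0" if "\<rho> \<in> Z" "z \<in> cball a r1" for \<rho> z
    using blden[OF that] R2 R by (auto simp: bl_def)
  have blsph: "norm (bl \<rho> z) = norm (z - \<rho>)" if "norm (z - a) = R" for \<rho> z
  proof -
    have "of_real (R\<^sup>2) = (z - a) * cnj (z - a)"
      using that complex_norm_square[of "z - a"] by simp
    hence "of_real (R\<^sup>2) - cnj (\<rho> - a) * (z - a) = (z - a) * cnj (z - \<rho>)"
      by (simp add: algebra_simps)
    thus ?thesis using that R by (simp add: bl_def norm_divide norm_mult del: complex_cnj_diff)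
  qed
  have holG: "G holomorphic_on UNIV" unfolding G_def bl_def
    by (intro holomorphic_intros g(1)) (use R in auto)
  have normG: "norm (G z) \<le> B * norm (h a)" if "z \<in> cball a R" for z
  proof (rule maximum_modulus_frontier[of G "cball a R"])
    show "norm (G w) \<le> B * norm (h a)" if "w \<in> frontier (cball a R)" for w
    proof -
      have w: "norm (w - a) = R" using that R by (simp add: frontier_cball dist_norm norm_minus_commute)
      have "norm (G w) = norm (h w)"
        unfolding G_def g(2)[of w] by (simp add: norm_mult norm_power prod_norm[symmetric] blsph[OF w])
      also have "\<dots> \<le> B * norm (h a)"
        by (rule bound) (use w in \<open>simp add: dist_norm norm_minus_commute\<close>)
      finally show ?thesis .
    qed
  qed (use that holG in \<open>auto intro: holomorphic_on_imp_continuous_on holomorphic_on_subset\<close>)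
  have bla: "bl \<rho> a = of_real R" for \<rho> using R by (simp add: bl_def power2_eq_square)
  have Ga: "norm (G a) = norm (g a) * R ^ n"
    using R by (simp add: G_def bla norm_mult norm_power prod_norm[symmetric] n_def power_sum)
  have "norm (h a) = norm (g a) * (\<Prod>\<rho>\<in>Z. norm (a - \<rho>) ^ zmult h \<rho>)"
    by (subst g(2)) (simp add: norm_mult norm_power prod_norm[symmetric])
  also have "\<dots> \<le> norm (g a) * r1 ^ n" unfolding n_def
    by (intro mult_left_mono prod_power_le_power_sum) (use Zr in \<open>auto simp: norm_minus_commute\<close>)
  finally have ha: "norm (h a) \<le> norm (g a) * r1 ^ n" .
  \<comment> \<open>At the centre every zero gains at least a factor R / r1 when h is replaced by G.
    Comparison with the maximum of G then bounds the number of zeros, as in Jensen's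
    formula.\<close>
  have "(R / r1) ^ n * norm (h a) \<le> norm (G a)"
    using mult_left_mono[OF ha, of "(R / r1) ^ n"] R r1 by (simp add: Ga power_divide field_simps)
  also have "\<dots> \<le> B * norm (h a)" by (rule normG) (use R in auto)
  finally have RnB: "(R / r1) ^ n \<le> B" using a by simp
  have Rr: "R / r1 > 1" using rs r1 by simp
  have B1: "B \<ge> 1" using RnB one_le_power[of "R / r1" n] Rr by linarith
  have "ln ((R / r1) ^ n) \<le> ln B" using RnB Rr B1 by (subst ln_le_cancel_iff) auto
  hence n: "real n * ln (R / r1) \<le> ln B" using Rr by (simp add: ln_realpow)
  thus ?th1 by (simp add: n_def)
  have hG: "norm (h a) \<le> norm (G a)"
  proof -
    have "norm (g a) * r1 ^ n \<le> norm (g a) * R ^ n"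
      by (intro mult_left_mono power_mono) (use rs r1 in auto)
    with ha Ga show ?thesis by simp
  qed
  have g0: "g z \<noteq> 0" if "z \<in> cball a r1" for z
    using that g(2)[of z] g(3)[of z] by (auto simp: Z_def)
  have G0: "G z \<noteq> 0" if "z \<in> cball a r1" for z
    using g0[OF that] bl0[OF _ that] finZ by (auto simp: G_def)
  obtain l where l: "l holomorphic_on ball a r1" "\<And>z. z \<in> ball a r1 \<Longrightarrow> exp (l z) = G z"
    using holomorphic_logarithm_exists[of "ball a r1" G a] G0 r1 holomorphic_on_subset[OF holG]
    by (metis (no_types, opaque_lifting) ball_subset_cball centre_in_ball convex_ball open_ball subset_UNIV subsetD)
  define L where "L = (\<lambda>z. l z - l a)"
  have L: "L holomorphic_on ball a r1" unfolding L_def by (intro holomorphic_intros l)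
  \<comment> \<open>The actual bound is ln B, which may be 0; adding 1 supplies the strict
    inequality and the positivity that Borel-Caratheodory asks for.\<close>
  have ReL: "Re (L z) < ln B + 1" if "z \<in> ball a r1" for z
  proof -
    have "exp (Re (l z)) = norm (G z)" "exp (Re (l a)) = norm (G a)"
      using l(2)[OF that] l(2)[of a] r1 by (metis norm_exp_eq_Re centre_in_ball)+
    hence "exp (Re (L z)) = norm (G z) / norm (G a)" by (simp add: L_def exp_diff)
    also have "\<dots> \<le> B * norm (h a) / norm (G a)"
      by (intro divide_right_mono normG) (use that rs in auto)
    also have "\<dots> \<le> B" using hG a B1 by (simp add: divide_le_eq mult_left_mono)
    finally have "Re (L z) \<le> ln B" using B1 by (subst ln_ge_iff) auto
    thus ?thesis by simp
  qed
  have alg: "8 * x * p / y + x / l * (p / v) = (8 * p / y + p / (v * l)) * x" for x p y v l :: real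
    by (simp add: divide_inverse algebra_simps)
  fix z assume z: "z \<in> cball a r2" and hz: "h z \<noteq> 0"
  have z1: "z \<in> ball a r1" and z1': "z \<in> cball a r1" using z rs by auto
  have dL: "norm (deriv L z) \<le> 8 * (ln B + 1) * r1 / (r1 - r2)\<^sup>2"
    by (rule Borel_Caratheodory_deriv[OF L _ _ ReL z]) (use rs B1 in \<open>auto simp: L_def add_nonneg_pos\<close>)
  have zZ: "z - \<rho> \<noteq> 0" if "\<rho> \<in> Z" for \<rho> using that hz by (auto simp: Z_def)
  have dg: "(g has_field_derivative deriv g z) (at z)"
    using g(1) by (intro holomorphic_derivI[of _ UNIV]) auto
  define S1 where "S1 = (\<Sum>\<rho>\<in>Z. of_nat (zmult h \<rho>) / (z - \<rho>))"
  define S2 where "S2 = (\<Sum>\<rho>\<in>Z. of_nat (zmult h \<rho>) * (- cnj (\<rho> - a) / of_real R) / bl \<rho> z)"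
  have "((\<lambda>z. \<Prod>\<rho>\<in>Z. (z - \<rho>) ^ zmult h \<rho>) has_field_derivative
      (\<Prod>\<rho>\<in>Z. (z - \<rho>) ^ zmult h \<rho>) * (\<Sum>\<rho>\<in>Z. of_nat (zmult h \<rho>) * 1 / (z - \<rho>))) (at z)"
    by (rule has_field_derivative_prod_power) (use finZ zZ in \<open>auto intro!: derivative_eq_intros\<close>)
  from has_field_derivative_mult_log_deriv[OF dg this g0[OF z1']]
  have "((\<lambda>z. g z * (\<Prod>\<rho>\<in>Z. (z - \<rho>) ^ zmult h \<rho>)) has_field_derivative
      (g z * (\<Prod>\<rho>\<in>Z. (z - \<rho>) ^ zmult h \<rho>)) * (deriv g z / g z + S1)) (at z)"
    by (simp only: S1_def mult_1_right)
  moreover have "(\<lambda>z. g z * (\<Prod>\<rho>\<in>Z. (z - \<rho>) ^ zmult h \<rho>)) = h" using g(2) by (intro ext) metis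
  ultimately have "(h has_field_derivative h z * (deriv g z / g z + S1)) (at z)" by metis
  hence dh: "deriv h z / h z = deriv g z / g z + S1" using hz by (simp add: DERIV_imp_deriv)
  have "((\<lambda>z. \<Prod>\<rho>\<in>Z. bl \<rho> z ^ zmult h \<rho>) has_field_derivative
      (\<Prod>\<rho>\<in>Z. bl \<rho> z ^ zmult h \<rho>) * S2) (at z)" unfolding S2_def
    by (rule has_field_derivative_prod_power)
       (use finZ bl0 z1' R in \<open>auto intro!: derivative_eq_intros simp: bl_def[abs_def]\<close>)
  from has_field_derivative_mult_log_deriv[OF dg this g0[OF z1']]
  have dG: "(G has_field_derivative G z * (deriv g z / g z + S2)) (at z)"
    by (simp only: G_def)
  have "(l has_field_derivative deriv l z) (at z)"
    using l(1) z1 by (intro holomorphic_derivI) auto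
  hence "((\<lambda>z. exp (l z)) has_field_derivative G z * deriv l z) (at z)"
    using l(2)[OF z1] by (auto intro!: derivative_eq_intros)
  hence "(G has_field_derivative G z * deriv l z) (at z)"
    by (rule has_field_derivative_transform_within_open[OF _ open_ball z1]) (use l(2) in auto)
  hence "G z * deriv l z = G z * (deriv g z / g z + S2)" using dG DERIV_unique by blast
  hence "deriv l z = deriv g z / g z + S2" using G0[OF z1'] by simp
  moreover have "deriv L z = deriv l z"
    using l(1) z1 unfolding L_def
    by (subst deriv_diff) (auto simp: holomorphic_on_imp_differentiable_at)
  \<comment> \<open>\<open>L\<close> is a logarithm of G up to a constant. Passing from h to G
    exchanges the poles inside the disc, collected in \<open>S1\<close>, for those of the Blaschke
    factors outside it, collected in \<open>S2\<close>; both terms on the right are therefore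
    bounded.\<close>
  ultimately have "deriv h z / h z - S1 = deriv L z - S2" using dh by simp
  hence "norm (deriv h z / h z - S1) \<le> norm (deriv L z) + norm S2"
    by (simp add: norm_triangle_ineq4)
  also have "norm S2 \<le> (\<Sum>\<rho>\<in>Z. real (zmult h \<rho>) * (r1 / (R\<^sup>2 - r1\<^sup>2)))"
    unfolding S2_def
  proof (rule sum_norm_le)
    fix \<rho> assume \<rho>: "\<rho> \<in> Z"
    have "norm (cnj (\<rho> - a)) / norm (of_real (R\<^sup>2) - cnj (\<rho> - a) * (z - a)) \<le> r1 / (R\<^sup>2 - r1\<^sup>2)"
      by (rule frac_le) (use Zr[OF \<rho>] r1 R2 blden[OF \<rho> z1'] in \<open>simp_all del: complex_cnj_diff\<close>)
    hence "real (zmult h \<rho>) * (norm (cnj (\<rho> - a)) / norm (of_real (R\<^sup>2) - cnj (\<rho> - a) * (z - a)))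
       \<le> real (zmult h \<rho>) * (r1 / (R\<^sup>2 - r1\<^sup>2))" by (intro mult_left_mono) auto
    thus "norm (of_nat (zmult h \<rho>) * (- cnj (\<rho> - a) / of_real R) / bl \<rho> z) \<le> real (zmult h \<rho>) * (r1 / (R\<^sup>2 - r1\<^sup>2))"
      unfolding bl_def norm_mult norm_divide norm_minus_cancel norm_of_nat using R by simp
  qed
  also have "\<dots> = real n * (r1 / (R\<^sup>2 - r1\<^sup>2))" by (simp only: n_def of_nat_sum sum_distrib_right)
  also have "\<dots> \<le> (ln B + 1) / ln (R / r1) * (r1 / (R\<^sup>2 - r1\<^sup>2))"
    using n Rr r1 R2 by (intro mult_right_mono) (auto simp: pos_le_divide_eq ln_gt_zero)
  finally have "norm (deriv h z / h z - S1) \<le> 8 * (ln B + 1) * r1 / (r1 - r2)\<^sup>2 + (ln B + 1) / ln (R / r1) * (r1 / (R\<^sup>2 - r1\<^sup>2))"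
    using dL by linarith
  thus "norm (deriv h z / h z - (\<Sum>\<rho>\<in>Z. of_nat (zmult h \<rho>) / (z - \<rho>)))
         \<le> (8 * r1 / (r1 - r2)\<^sup>2 + r1 / ((R\<^sup>2 - r1\<^sup>2) * ln (R / r1))) * (ln B + 1)"
    unfolding S1_def alg .
qed

section \<open>The theta function\<close>

text \<open>The Fourier transform of a Gaussian, read off from the characteristic function of the
  standard normal distribution; the substitution x = c y with c = sqrt (2 \<pi> t) adjusts the
  width.\<close>

lemma has_bochner_integral_gaussian_iexp:
  assumes t: "t > 0"
  shows "has_bochner_integral lborel (\<lambda>y. complex_of_real (exp (- (pi * t * y\<^sup>2))) * iexp (b * y))
           (of_real (exp (- (b\<^sup>2 / (4 * pi * t))) / sqrt t))"
proof -
  define c where "c = sqrt (2 * pi * t)"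
  have c: "c > 0" "c\<^sup>2 = 2 * pi * t" using t by (auto simp: c_def)
  define s where "s = b / c"
  have int: "integrable lborel (\<lambda>x. std_normal_density x *\<^sub>R iexp (s * x))"
    by (rule Bochner_Integration.integrable_bound[of lborel std_normal_density])
       (auto simp: integrable_normal_density)
  have "(LINT x|lborel. std_normal_density x *\<^sub>R iexp (s * x)) = char std_normal_distribution s"
    unfolding char_def by (subst integral_density) auto
  also have "\<dots> = of_real (exp (- (s\<^sup>2) / 2))" by (simp add: char_std_normal_distribution)
  finally have "has_bochner_integral lborel (\<lambda>x. std_normal_density x *\<^sub>R iexp (s * x)) (of_real (exp (- (s\<^sup>2) / 2)))"
    using int by (simp add: has_bochner_integral_iff)
  hence "has_bochner_integral lborel (\<lambda>y. std_normal_density (0 + c * y) *\<^sub>R iexp (s * (0 + c * y)))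
           (of_real (exp (- (s\<^sup>2) / 2)) /\<^sub>R \<bar>c\<bar>)"
    by (subst (asm) lborel_has_bochner_integral_real_affine_iff[of c _ _ 0]) (use c in auto)
  hence "has_bochner_integral lborel (\<lambda>y. sqrt (2 * pi) *\<^sub>R (std_normal_density (0 + c * y) *\<^sub>R iexp (s * (0 + c * y))))
           (sqrt (2 * pi) *\<^sub>R (of_real (exp (- (s\<^sup>2) / 2)) /\<^sub>R \<bar>c\<bar>))"
    by (intro has_bochner_integral_scaleR_right)
  also have "(\<lambda>y. sqrt (2 * pi) *\<^sub>R (std_normal_density (0 + c * y) *\<^sub>R iexp (s * (0 + c * y))))
     = (\<lambda>y. complex_of_real (exp (- (pi * t * y\<^sup>2))) * iexp (b * y))"
  proof
    fix y
    have 1: "- (c * y)\<^sup>2 / 2 = - (pi * t * y\<^sup>2)" using c(2) by (simp add: power_mult_distrib)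
    have 2: "s * (c * y) = b * y" using c by (simp add: s_def)
    show "sqrt (2 * pi) *\<^sub>R (std_normal_density (0 + c * y) *\<^sub>R iexp (s * (0 + c * y)))
       = complex_of_real (exp (- (pi * t * y\<^sup>2))) * iexp (b * y)"
      unfolding add_0 std_normal_density_def 1 2 by (simp add: scaleR_conv_of_real)
  qed
  also have "sqrt (2 * pi) *\<^sub>R (of_real (exp (- (s\<^sup>2) / 2)) /\<^sub>R \<bar>c\<bar>)
     = complex_of_real (exp (- (b\<^sup>2 / (4 * pi * t))) / sqrt t)"
  proof -
    have 1: "- (s\<^sup>2) / 2 = - (b\<^sup>2 / (4 * pi * t))" using c by (simp add: s_def power_divide)
    have 2: "sqrt (2 * pi) / \<bar>c\<bar> = 1 / sqrt t" using t by (simp add: c_def real_sqrt_mult)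
    have "sqrt (2 * pi) *\<^sub>R (complex_of_real (exp (- (s\<^sup>2) / 2)) /\<^sub>R \<bar>c\<bar>)
       = of_real (sqrt (2 * pi) / \<bar>c\<bar> * exp (- (s\<^sup>2) / 2))"
      by (simp only: scaleR_conv_of_real of_real_mult divide_inverse mult.assoc)
    thus ?thesis unfolding 1 2 by simp
  qed
  finally show ?thesis .
qed

lemma exp_neg_2pi_eq_1_iff: "exp (- (2 * of_real pi * z)) = 1 \<longleftrightarrow> (\<exists>n::int. z = \<i> * of_int n)"
proof -
  have *: "- (2 * pi * y) = 2 * k * pi \<longleftrightarrow> y = - k" for y k :: real
  proof -
    have "- (2 * pi * y) = 2 * k * pi \<longleftrightarrow> (2 * pi) * (y + k) = 0" by (auto simp: algebra_simps)
    thus ?thesis by (auto simp: eq_neg_iff_add_eq_0)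
  qed
  have "exp (- (2 * of_real pi * z)) = 1 \<longleftrightarrow> (\<exists>n::int. Re z = 0 \<and> - (2 * pi * Im z) = 2 * of_int n * pi)"
    by (simp add: exp_eq_1)
  also have "\<dots> \<longleftrightarrow> (\<exists>n::int. Re z = 0 \<and> Im z = - of_int n)" unfolding * ..
  also have "\<dots> \<longleftrightarrow> (\<exists>n::int. z = \<i> * of_int n)"
    by (auto simp: complex_eq_iff) (metis minus_minus of_int_minus)+
  finally show ?thesis .
qed

lemma sum_symmetric_int_interval:
  fixes f :: "int \<Rightarrow> real"
  assumes "\<And>n. f (- n) = f n"
  shows "(\<Sum>n\<in>{- int N..int N}. f n) = f 0 + 2 * (\<Sum>n<N. f (int (Suc n)))"
proof (induction N)
  case (Suc N)
  have "{- int (Suc N)..int (Suc N)} = insert (int (Suc N)) (insert (- int (Suc N)) {- int N..int N})"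
    by auto
  hence "(\<Sum>n\<in>{- int (Suc N)..int (Suc N)}. f n) = f (int (Suc N)) + (f (- int (Suc N)) + (\<Sum>n\<in>{- int N..int N}. f n))"
    by simp
  with Suc assms[of "int (Suc N)"] show ?case by simp
qed simp

lemma path_image_rectpath_segments:
  "path_image (rectpath a b) = closed_segment a (Complex (Re b) (Im a)) \<union> closed_segment (Complex (Re b) (Im a)) b
     \<union> closed_segment b (Complex (Re a) (Im b)) \<union> closed_segment (Complex (Re a) (Im b)) a"
  by (simp add: rectpath_def Let_def path_image_join Un_assoc)

lemma contour_integral_rectpath:
  assumes "continuous_on (path_image (rectpath a b)) f"
  shows "contour_integral (rectpath a b) f =
     contour_integral (linepath a (Complex (Re b) (Im a))) f +
     contour_integral (linepath (Complex (Re b) (Im a)) b) f +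
     contour_integral (linepath b (Complex (Re a) (Im b))) f +
     contour_integral (linepath (Complex (Re a) (Im b)) a) f"
proof -
  have *: "f contour_integrable_on linepath u v"
    if "closed_segment u v \<subseteq> path_image (rectpath a b)" for u v
    by (rule contour_integrable_continuous_linepath) (use assms that continuous_on_subset in blast)
  have i: "f contour_integrable_on linepath a (Complex (Re b) (Im a))"
    "f contour_integrable_on linepath (Complex (Re b) (Im a)) b"
    "f contour_integrable_on linepath b (Complex (Re a) (Im b))"
    "f contour_integrable_on linepath (Complex (Re a) (Im b)) a"
    by (rule *, subst path_image_rectpath_segments, blast)+
  thus ?thesis by (simp add: rectpath_def Let_def)
qed

lemma theta_summable: "t > 0 \<Longrightarrow> summable (\<lambda>n. exp (- (pi * t * (real (Suc n))\<^sup>2)))"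
proof -
  assume t: "t > 0"
  show "summable (\<lambda>n. exp (- (pi * t * (real (Suc n))\<^sup>2)))"
  proof (rule summable_comparison_test')
  have "exp (- (pi * t)) < 1" using t by simp
  thus "summable (\<lambda>n. exp (- (pi * t)) ^ n)" by (intro summable_geometric) auto
  show "norm (exp (- (pi * t * (real (Suc n))\<^sup>2))) \<le> exp (- (pi * t)) ^ n" for n
  proof -
    have "real n \<le> (real (Suc n))\<^sup>2" by (simp add: power2_eq_square algebra_simps)
    hence "pi * t * real n \<le> pi * t * (real (Suc n))\<^sup>2" using t by (intro mult_left_mono) auto
    thus ?thesis by (simp add: exp_of_nat_mult[symmetric] mult_ac)
  qed
  qed
qed

text \<open>The integrand \<open>f\<close> below is \<open>exp (\<pi> t z\<^sup>2) coth (\<pi> z)\<close>. Its residues are the terms of the theta series at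
  \<open>t\<close>; expanding \<open>coth\<close> geometrically on \<open>Re z = 1\<close> gives Gaussian integrals, the terms of
  the series at \<open>1 / t\<close>.\<close>

context
  fixes t :: real
  assumes t: "t > 0"
begin

private definition f :: "complex \<Rightarrow> complex" where
  "f z = exp (of_real (pi * t) * z\<^sup>2) * (1 + exp (- (2 * of_real pi * z))) / (1 - exp (- (2 * of_real pi * z)))"

text \<open>Oddness makes opposite sides of a rectangle centred at 0 contribute equally, so that
  only the bottom and the right side need to be treated.\<close>

private lemma f_minus: "f (- z) = - f z"
proof -
  define w where "w = exp (- (2 * of_real pi * z))"
  have w: "w \<noteq> 0" and iw: "exp (2 * of_real pi * z) = 1 / w"
    by (simp_all add: w_def exp_minus field_simps)
  have "(1 + 1 / w) / (1 - 1 / w) = - ((1 + w) / (1 - w))"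
    using w by (cases "w = 1") (simp_all add: divide_simps, simp_all add: algebra_simps)
  hence "exp (of_real (pi * t) * z\<^sup>2) * ((1 + 1 / w) / (1 - 1 / w)) = - (exp (of_real (pi * t) * z\<^sup>2) * ((1 + w) / (1 - w)))"
    by (simp only: mult_minus_right)
  thus ?thesis by (simp add: f_def iw flip: w_def)
qed

private lemma residue_f: "residue f (\<i> * of_int n) = of_real (exp (- (pi * t * (of_int n)\<^sup>2)) / pi)"
proof (rule residue_simple'[of "ball (\<i> * of_int n) 1"])
  show "f holomorphic_on ball (\<i> * of_int n) 1 - {\<i> * of_int n}"
  proof -
    have "1 - exp (- (2 * of_real pi * z)) \<noteq> 0" if z: "z \<in> ball (\<i> * of_int n) 1 - {\<i> * of_int n}" for z
    proof
      assume "1 - exp (- (2 * of_real pi * z)) = 0"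
      then obtain m :: int where m: "z = \<i> * of_int m" using exp_neg_2pi_eq_1_iff[of z] by auto
      have "dist (\<i> * of_int n) z = \<bar>of_int (n - m)\<bar>"
        unfolding m dist_norm right_diff_distrib[symmetric] norm_mult of_int_diff[symmetric]
          by (simp del: of_int_diff)
      hence "\<bar>real_of_int (n - m)\<bar> < 1" using z by auto
      hence "n = m" by linarith
      thus False using z m by auto
    qed
    thus ?thesis unfolding f_def by (auto intro!: holomorphic_intros)
  qed
  define z0 where "z0 = \<i> * of_int n"
  have e1: "exp (- (2 * of_real pi * z0)) = 1" unfolding exp_neg_2pi_eq_1_iff z0_def by blast
  have "((\<lambda>z. 1 - exp (- (2 * of_real pi * z))) has_field_derivative 2 * of_real pi) (at z0)"
    by (auto intro!: derivative_eq_intros simp: e1)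
  hence "((\<lambda>z. (1 - exp (- (2 * of_real pi * z)) - 0) / (z - z0)) \<longlongrightarrow> 2 * of_real pi) (at z0)"
    unfolding has_field_derivative_iff by (simp add: e1)
  hence "((\<lambda>z. exp (of_real (pi * t) * z\<^sup>2) * (1 + exp (- (2 * of_real pi * z))) / ((1 - exp (- (2 * of_real pi * z)) - 0) / (z - z0)))
     \<longlongrightarrow> exp (of_real (pi * t) * z0\<^sup>2) * (1 + exp (- (2 * of_real pi * z0))) / (2 * of_real pi)) (at z0)"
    by (intro tendsto_intros) auto
  also have "(\<lambda>z. exp (of_real (pi * t) * z\<^sup>2) * (1 + exp (- (2 * of_real pi * z))) / ((1 - exp (- (2 * of_real pi * z)) - 0) / (z - z0)))
     = (\<lambda>z. f z * (z - z0))" by (simp add: f_def fun_eq_iff)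
  also have "exp (of_real (pi * t) * z0\<^sup>2) * (1 + exp (- (2 * of_real pi * z0))) / (2 * of_real pi)
     = of_real (exp (- (pi * t * (of_int n)\<^sup>2)) / pi)"
  proof -
    have "of_real (pi * t) * z0\<^sup>2 = of_real (- (pi * t * (of_int n)\<^sup>2))"
      by (simp add: z0_def power_mult_distrib)
    hence "exp (of_real (pi * t) * z0\<^sup>2) = of_real (exp (- (pi * t * (of_int n)\<^sup>2)))"
      by (simp only: exp_of_real)
    thus ?thesis by (simp add: e1)
  qed
  finally show "((\<lambda>z. f z * (z - \<i> * of_int n)) \<longlongrightarrow> of_real (exp (- (pi * t * (of_int n)\<^sup>2)) / pi)) (at (\<i> * of_int n))"
    by (simp add: z0_def)
qed auto

text \<open>The residue theorem for the rectangle with corners -1 - i M and 1 + i M, which encloses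
  the poles i n with |n| <= N. The half-integer M keeps its horizontal sides midway between poles;
  by symmetry one of them is the whole error, and exp (\<pi> t z^2) makes it tiny.\<close>

private lemma integral_f:
  defines "M \<equiv> \<lambda>N::nat. real N + 1/2"
  shows "norm (of_real (1 + 2 * (\<Sum>n<N. exp (- (pi * t * (real (Suc n))\<^sup>2)))) - integral {- M N..M N} (\<lambda>y. f (Complex 1 y)))
           \<le> 2 * exp (pi * t * (1 - (M N)\<^sup>2))"
proof -
  define a where "a = Complex (-1) (- M N)"
  define b where "b = Complex 1 (M N)"
  define pts where "pts = (\<lambda>n::int. \<i> * of_int n) ` {- int N..int N}"
  have M: "M N > 0" by (simp add: M_def)
  have inj: "inj_on (\<lambda>n::int. \<i> * of_int n :: complex) A" for A by (auto simp: inj_on_def)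
  define S where "S = {z. \<bar>Im z\<bar> < real N + 1}"
  have S: "open S" "convex S"
  proof -
    have eq: "S = {z. Im z < real N + 1} \<inter> {z. Im z > - (real N + 1)}" by (auto simp: S_def)
    show "open S" unfolding eq by (intro open_Int open_halfspace_Im_lt open_halfspace_Im_gt)
    show "convex S" unfolding eq by (intro convex_Int convex_halfspace_Im_lt convex_halfspace_Im_gt)
  qed
  have pole: "\<exists>n\<in>{- int N..int N}. z = \<i> * of_int n"
    if "1 - exp (- (2 * of_real pi * z)) = 0" "z \<in> S" for z
  proof -
    from that(1) have "exp (- (2 * of_real pi * z)) = 1" by simp
    then obtain n :: int where n: "z = \<i> * of_int n" unfolding exp_neg_2pi_eq_1_iff by blast
    have "\<bar>real_of_int n\<bar> < real N + 1" using that(2) by (simp add: S_def n)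
    hence "n \<in> {- int N..int N}" by auto
    thus ?thesis using n by blast
  qed
  have holf: "f holomorphic_on S - pts" unfolding f_def
    by (intro holomorphic_intros) (use pole in \<open>auto simp: pts_def\<close>)
  have box: "z \<in> box a b" if "z \<in> pts" for z
  proof -
    obtain n where n: "z = \<i> * of_int n" "n \<in> {- int N..int N}"
      using \<open>z \<in> pts\<close> unfolding pts_def by blast
    hence "\<bar>real_of_int n\<bar> \<le> real N" by auto
    thus ?thesis by (auto simp: in_box_complex_iff n(1) a_def b_def M_def)
  qed
  have ab: "Re a \<le> Re b" "Im a \<le> Im b" using M by (auto simp: a_def b_def)
  have path: "path_image (rectpath a b) \<subseteq> S - pts"
    using box ab by (subst path_image_rectpath_cbox_minus_box) (auto simp: in_cbox_complex_iff S_def a_def b_def M_def)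
  have "contour_integral (rectpath a b) f
      = 2 * pi * \<i> * (\<Sum>p\<in>pts. winding_number (rectpath a b) p * residue f p)"
  proof (rule Residue_theorem[OF S(1) convex_connected[OF S(2)] _ holf _ _ path])
    show "\<forall>z. z \<notin> S \<longrightarrow> winding_number (rectpath a b) z = 0"
      using ab by (auto intro!: winding_number_rectpath_outside simp: in_cbox_complex_iff S_def a_def b_def M_def)
  qed (auto simp: pts_def)
  also have "(\<Sum>p\<in>pts. winding_number (rectpath a b) p * residue f p) = (\<Sum>p\<in>pts. residue f p)"
    using box by (intro sum.cong) (auto simp: winding_number_rectpath)
  also have "\<dots> = (\<Sum>n\<in>{- int N..int N}. of_real (exp (- (pi * t * (of_int n)\<^sup>2)) / pi))"
    unfolding pts_def by (subst sum.reindex[OF inj]) (simp add: residue_f)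
  also have "\<dots> = of_real ((\<Sum>n\<in>{- int N..int N}. exp (- (pi * t * (of_int n)\<^sup>2))) / pi)"
    by (simp add: sum_divide_distrib)
  also have "(\<Sum>n\<in>{- int N..int N}. exp (- (pi * t * (of_int n)\<^sup>2))) = 1 + 2 * (\<Sum>n<N. exp (- (pi * t * (real (Suc n))\<^sup>2)))"
    by (subst sum_symmetric_int_interval) auto
  finally have main: "contour_integral (rectpath a b) f
     = 2 * \<i> * of_real (1 + 2 * (\<Sum>n<N. exp (- (pi * t * (real (Suc n))\<^sup>2))))"
    by simp
  define B C where "B = contour_integral (linepath a (Complex 1 (- M N))) f"
    and "C = contour_integral (linepath (Complex 1 (- M N)) b) f"
  have neg: "contour_integral (linepath (- u) (- v)) f = contour_integral (linepath u v) f" for u v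
  proof -
    have "f (linepath (- u) (- v) x) * (- v - - u) = f (linepath u v x) * (v - u)" for x
      using f_minus[of "linepath u v x"] by (simp add: linepath_def algebra_simps)
    thus ?thesis by (simp only: contour_integral_integral vector_derivative_linepath_at)
  qed
  have contf: "continuous_on (path_image (rectpath a b)) f"
    using holomorphic_on_imp_continuous_on[OF holf] path continuous_on_subset by blast
  have cseg: "f contour_integrable_on linepath u v"
    if "closed_segment u v \<subseteq> path_image (rectpath a b)" for u v
    by (rule contour_integrable_continuous_linepath) (use contf that continuous_on_subset in blast)
  have negs: "- a = b" "- b = a" "- Complex 1 (- M N) = Complex (-1) (M N)"
    by (simp_all add: a_def b_def complex_eq_iff)
  have cor: "Complex (Re b) (Im a) = Complex 1 (- M N)" "Complex (Re a) (Im b) = Complex (-1) (M N)"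
    by (simp_all add: a_def b_def)
  have pim: "closed_segment a (Complex 1 (- M N)) \<subseteq> path_image (rectpath a b)"
    unfolding path_image_rectpath_segments cor by blast
  have "contour_integral (rectpath a b) f = B + C + contour_integral (linepath b (Complex (-1) (M N))) f
      + contour_integral (linepath (Complex (-1) (M N)) a) f"
    unfolding B_def C_def contour_integral_rectpath[OF contf] cor ..
  also have "contour_integral (linepath b (Complex (-1) (M N))) f = B"
    using neg[of a "Complex 1 (- M N)"] unfolding negs B_def .
  also have "contour_integral (linepath (Complex (-1) (M N)) a) f = C"
    using neg[of "Complex 1 (- M N)" b] unfolding negs C_def .
  finally have BC: "contour_integral (rectpath a b) f = 2 * (B + C)" by simp
  have C: "C = \<i> * integral {- M N..M N} (\<lambda>y. f (Complex 1 y))"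
    unfolding C_def by (rule contour_integral_linepath_same_Re) (use M in \<open>auto simp: b_def\<close>)
  have B: "norm B \<le> exp (pi * t * (1 - (M N)\<^sup>2)) * norm (Complex 1 (- M N) - a)"
  proof (rule has_contour_integral_bound_linepath)
    show "(f has_contour_integral B) (linepath a (Complex 1 (- M N)))"
      unfolding B_def by (rule has_contour_integral_integral, rule cseg, rule pim)
    fix z assume "z \<in> closed_segment a (Complex 1 (- M N))"
    hence z: "Im z = - M N" "\<bar>Re z\<bar> \<le> 1"
      by (auto simp: a_def closed_segment_same_Im closed_segment_eq_real_ivl)
    define e where "e = exp (- (2 * pi * Re z))"
    have "2 * of_real pi * z = of_real (2 * pi * Re z) + of_real (2 * pi * Im z) * \<i>"
      by (simp add: complex_eq_iff)
    hence "exp (- (2 * of_real pi * z)) = of_real e * exp (- (of_real (2 * pi * Im z) * \<i>))"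
      unfolding e_def by (simp only: minus_add_distrib exp_add) (simp add: exp_of_real[symmetric] exp_minus)
    \<comment> \<open>At a half-integer height exp (-2 \<pi> z) is a negative real number -e, so the
      quotient in \<open>f\<close> becomes (1 - e) / (1 + e), of modulus at most 1.\<close>
    also have "- (of_real (2 * pi * Im z) * \<i>) = \<i> * of_real pi + \<i> * (of_int (int N) * (of_real pi * 2))"
      by (simp add: z(1) M_def algebra_simps)
    also have "exp \<dots> = -1" by (simp only: exp_plus_2pin) simp
    finally have w: "exp (- (2 * of_real pi * z)) = - of_real e" by simp
    have e0: "e > 0" by (simp add: e_def)
    have "f z = exp (of_real (pi * t) * z\<^sup>2) * of_real ((1 - e) / (1 + e))"
      by (simp add: f_def w)
    hence "norm (f z) = exp (Re (of_real (pi * t) * z\<^sup>2)) * \<bar>(1 - e) / (1 + e)\<bar>"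
      by (simp only: norm_mult norm_of_real norm_exp_eq_Re)
    also have "\<dots> \<le> exp (pi * t * (1 - (M N)\<^sup>2)) * 1"
    proof (intro mult_mono)
      have "(Re z)\<^sup>2 \<le> 1" using z(2) by (simp add: abs_square_le_1)
      hence "Re (of_real (pi * t) * z\<^sup>2) \<le> pi * t * (1 - (M N)\<^sup>2)"
        using t z(1) by (simp add: power2_eq_square mult_left_mono)
      thus "exp (Re (of_real (pi * t) * z\<^sup>2)) \<le> exp (pi * t * (1 - (M N)\<^sup>2))" by simp
      show "\<bar>(1 - e) / (1 + e)\<bar> \<le> 1" using e0 by (simp add: abs_le_iff divide_simps)
    qed auto
    finally show "norm (f z) \<le> exp (pi * t * (1 - (M N)\<^sup>2))" by simp
  qed auto
  have "Complex 1 (- M N) - a = 2" by (simp add: a_def complex_eq_iff)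
  with B have B: "norm B \<le> 2 * exp (pi * t * (1 - (M N)\<^sup>2))" by simp
  have "\<i> * (of_real (1 + 2 * (\<Sum>n<N. exp (- (pi * t * (real (Suc n))\<^sup>2)))) - integral {- M N..M N} (\<lambda>y. f (Complex 1 y))) = B"
  proof -
    define X where "X = complex_of_real (1 + 2 * (\<Sum>n<N. exp (- (pi * t * (real (Suc n))\<^sup>2))))"
    have "2 * (\<i> * X) = 2 * (B + C)" using main BC unfolding X_def[symmetric] by (simp add: mult.assoc)
    hence "\<i> * X = B + C" by (metis mult_cancel_left zero_neq_numeral)
    thus ?thesis unfolding X_def[symmetric] by (simp only: right_diff_distrib C add_diff_cancel_right')
  qed
  hence "norm (of_real (1 + 2 * (\<Sum>n<N. exp (- (pi * t * (real (Suc n))\<^sup>2)))) - integral {- M N..M N} (\<lambda>y. f (Complex 1 y))) = norm B"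
    by (metis norm_mult norm_ii mult_1)
  thus ?thesis using B by simp
qed

private definition w :: "real \<Rightarrow> complex" where "w y = exp (- (2 * of_real pi * Complex 1 y))"

private lemma norm_w: "norm (w y) = exp (- (2 * pi))"
  by (simp add: w_def norm_exp_eq_Re)

private lemma term_eq: "exp (of_real (pi * t) * (Complex 1 y)\<^sup>2) * w y ^ k =
   of_real (exp (pi * t - 2 * pi * real k)) * (of_real (exp (- (pi * t * y\<^sup>2))) * iexp (2 * pi * (t - real k) * y))"
proof -
  have "exp (of_real (pi * t) * (Complex 1 y)\<^sup>2) * w y ^ k = exp (of_real (pi * t) * (Complex 1 y)\<^sup>2 + of_nat k * (- (2 * of_real pi * Complex 1 y)))"
    by (simp only: w_def exp_add exp_of_nat_mult)
  also have "of_real (pi * t) * (Complex 1 y)\<^sup>2 + of_nat k * (- (2 * of_real pi * Complex 1 y))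
     = of_real (pi * t - 2 * pi * real k) + (of_real (- (pi * t * y\<^sup>2)) + \<i> * of_real (2 * pi * (t - real k) * y))"
    by (simp add: complex_eq_iff power2_eq_square algebra_simps)
  finally show ?thesis by (simp only: exp_add exp_of_real)
qed

private lemma has_integral_term:
  "has_bochner_integral lborel (\<lambda>y. exp (of_real (pi * t) * (Complex 1 y)\<^sup>2) * w y ^ k)
     (of_real (exp (- (pi * (real k)\<^sup>2 / t)) / sqrt t))"
proof -
  have "has_bochner_integral lborel (\<lambda>y. of_real (exp (pi * t - 2 * pi * real k)) *
     (of_real (exp (- (pi * t * y\<^sup>2))) * iexp (2 * pi * (t - real k) * y)))
     (of_real (exp (pi * t - 2 * pi * real k)) * of_real (exp (- ((2 * pi * (t - real k))\<^sup>2 / (4 * pi * t))) / sqrt t))"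
    by (intro has_bochner_integral_mult_right has_bochner_integral_gaussian_iexp t)
  also have "complex_of_real (exp (pi * t - 2 * pi * real k)) * of_real (exp (- ((2 * pi * (t - real k))\<^sup>2 / (4 * pi * t))) / sqrt t)
    = of_real (exp (pi * t - 2 * pi * real k + - ((2 * pi * (t - real k))\<^sup>2 / (4 * pi * t))) / sqrt t)"
    by (simp only: exp_add of_real_mult of_real_divide times_divide_eq_right)
  \<comment> \<open>The square (t - k)^2 is expanded: its parts t^2 and -2 t k cancel the first two
    terms, and the exponent of the theta series at 1 / t remains.\<close>
  also have "pi * t - 2 * pi * real k + - ((2 * pi * (t - real k))\<^sup>2 / (4 * pi * t)) = - (pi * (real k)\<^sup>2 / t)"
    using t by (simp add: field_simps power2_eq_square)
  finally show ?thesis unfolding term_eq .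
qed

private lemma f_series: "(\<lambda>k. (if k = 0 then 1 else 2) * (exp (of_real (pi * t) * (Complex 1 y)\<^sup>2) * w y ^ k)) sums f (Complex 1 y)"
proof -
  have n1: "norm (w y) < 1" by (simp add: norm_w)
  hence w1: "w y \<noteq> 1" by auto
  define G where "G = exp (of_real (pi * t) * (Complex 1 y)\<^sup>2)"
  have "(\<lambda>k. 2 * w y ^ k) sums (2 * (1 / (1 - w y)))" by (intro sums_mult geometric_sums n1)
  hence "(\<lambda>k. 2 * w y ^ k - (if k = 0 then 1 else 0)) sums (2 * (1 / (1 - w y)) - 1)"
    by (intro sums_diff sums_single[of 0 "\<lambda>_. 1"])
  hence "(\<lambda>k. G * (2 * w y ^ k - (if k = 0 then 1 else 0))) sums (G * (2 * (1 / (1 - w y)) - 1))"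
    by (rule sums_mult)
  also have "2 * (1 / (1 - w y)) - 1 = (1 + w y) / (1 - w y)" using w1 by (simp add: field_simps)
  also have "G * \<dots> = f (Complex 1 y)" by (simp add: f_def G_def w_def)
  also have "(\<lambda>k. G * (2 * w y ^ k - (if k = 0 then 1 else 0))) = (\<lambda>k. (if k = 0 then 1 else 2) * (G * w y ^ k))"
    by auto
  finally show ?thesis unfolding G_def .
qed

text \<open>A majorant that is integrable in y and geometric in k; it justifies integrating the
  expansion term by term.\<close>

private lemma norm_term: "norm ((if k = (0::nat) then 1 else 2) * (exp (of_real (pi * t) * (Complex 1 y)\<^sup>2) * w y ^ k))
     \<le> (2 * exp (pi * t)) * exp (- (2 * pi)) ^ k * exp (- (pi * t * y\<^sup>2))"
proof -
  have "norm (exp (of_real (pi * t) * (Complex 1 y)\<^sup>2)) = exp (pi * t) * exp (- (pi * t * y\<^sup>2))"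
    by (simp add: norm_exp_eq_Re power2_eq_square algebra_simps flip: exp_add)
  hence "norm ((if k = 0 then 1 else 2) * (exp (of_real (pi * t) * (Complex 1 y)\<^sup>2) * w y ^ k))
     = (if k = 0 then 1 else 2) * (exp (pi * t) * exp (- (pi * t * y\<^sup>2)) * exp (- (2 * pi)) ^ k)"
    by (simp add: norm_mult norm_power norm_w)
  also have "\<dots> \<le> 2 * (exp (pi * t) * exp (- (pi * t * y\<^sup>2)) * exp (- (2 * pi)) ^ k)"
    by (intro mult_right_mono) auto
  finally show ?thesis by (simp only: mult_ac)
qed

private lemma gauss_integrable: "integrable lborel (\<lambda>y. exp (- (pi * t * y\<^sup>2)))"
proof -
  have "integrable lborel (\<lambda>y. complex_of_real (exp (- (pi * t * y\<^sup>2))))"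
    using has_bochner_integral_gaussian_iexp[OF t, of 0] by (simp add: has_bochner_integral_iff)
  from integrable_norm[OF this] show ?thesis by simp
qed

private lemma f_integral: "integrable lborel (\<lambda>y. f (Complex 1 y))"
   "(\<lambda>k. (if k = 0 then 1 else 2) * of_real (exp (- (pi * (real k)\<^sup>2 / t)) / sqrt t)) sums (LINT y|lborel. f (Complex 1 y))"
proof -
  define F where "F = (\<lambda>(k::nat) y. (if k = 0 then 1 else 2) * (exp (of_real (pi * t) * (Complex 1 y)\<^sup>2) * w y ^ k))"
  have F: "has_bochner_integral lborel (F k) ((if k = 0 then 1 else 2) * of_real (exp (- (pi * (real k)\<^sup>2 / t)) / sqrt t))" for k
    unfolding F_def by (intro has_bochner_integral_mult_right has_integral_term)
  have q: "summable (\<lambda>k. exp (- (2 * pi)) ^ k)" by (rule summable_geometric) auto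
  have int: "integrable lborel (F k)" for k using F by (auto simp: has_bochner_integral_iff)
  have 1: "AE y in lborel. summable (\<lambda>k. norm (F k y))"
  proof (rule AE_I2)
    fix y
    show "summable (\<lambda>k. norm (F k y))"
    proof (rule summable_comparison_test'[OF summable_mult2[OF summable_mult[OF q]]])
      show "norm (norm (F k y)) \<le> 2 * exp (pi * t) * exp (- (2 * pi)) ^ k * exp (- (pi * t * y\<^sup>2))" for k
        unfolding F_def real_norm_def abs_norm_cancel by (rule norm_term)
    qed
  qed
  have 2: "summable (\<lambda>k. LINT y|lborel. norm (F k y))"
  proof (rule summable_comparison_test'[OF summable_mult[OF q]])
    fix k
    have "norm (LINT y|lborel. norm (F k y)) = (LINT y|lborel. norm (F k y))" by simp
    also have "\<dots> \<le> (LINT y|lborel. (2 * exp (pi * t)) * exp (- (2 * pi)) ^ k * exp (- (pi * t * y\<^sup>2)))"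
      by (rule integral_mono) (use int gauss_integrable norm_term in \<open>auto simp: F_def\<close>)
    also have "\<dots> = (2 * exp (pi * t) * (LINT y|lborel. exp (- (pi * t * y\<^sup>2)))) * exp (- (2 * pi)) ^ k"
      by simp
    finally show "norm (LINT y|lborel. norm (F k y)) \<le> (2 * exp (pi * t) * (LINT y|lborel. exp (- (pi * t * y\<^sup>2)))) * exp (- (2 * pi)) ^ k" .
  qed
  have eq: "(\<lambda>y. \<Sum>k. F k y) = (\<lambda>y. f (Complex 1 y))"
    using f_series by (auto simp: F_def sums_iff)
  show "integrable lborel (\<lambda>y. f (Complex 1 y))"
    using integrable_suminf[OF int 1 2] unfolding eq .
  show "(\<lambda>k. (if k = 0 then 1 else 2) * of_real (exp (- (pi * (real k)\<^sup>2 / t)) / sqrt t)) sums (LINT y|lborel. f (Complex 1 y))"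
    using sums_integral[OF int 1 2] F unfolding eq by (simp add: has_bochner_integral_iff)
qed

text \<open>The partial theta sums at t and the truncated integrals over Re z = 1 have the same
  limit, and the full integral is known as a series at 1 / t.\<close>

theorem theta_inversion:
  "1 + 2 * (\<Sum>n. exp (- (pi * t * (real (Suc n))\<^sup>2)))
     = (1 + 2 * (\<Sum>n. exp (- (pi * (1 / t) * (real (Suc n))\<^sup>2)))) / sqrt t"
proof -
  define M where "M = (\<lambda>N::nat. real N + 1/2)"
  define T where "T = (\<lambda>N. \<Sum>n<N. exp (- (pi * t * (real (Suc n))\<^sup>2)))"
  define J where "J = (LINT y|lborel. f (Complex 1 y))"
  have set: "integral {- M N..M N} (\<lambda>y. f (Complex 1 y)) = (LINT y|lborel. indicator {- M N..M N} y *\<^sub>R f (Complex 1 y))" for N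
    using set_borel_integral_eq_integral(2)[of "{- M N..M N}" "\<lambda>y. f (Complex 1 y)"] f_integral(1)
    by (simp add: set_integrable_def set_lebesgue_integral_def integrable_mult_indicator)
  have "(\<lambda>N. LINT y|lborel. indicator {- M N..M N} y *\<^sub>R f (Complex 1 y)) \<longlonglongrightarrow> J" unfolding J_def
  proof (rule integral_dominated_convergence[where w = "\<lambda>y. norm (f (Complex 1 y))"])
    show "AE y in lborel. (\<lambda>N. indicator {- M N..M N} y *\<^sub>R f (Complex 1 y)) \<longlonglongrightarrow> f (Complex 1 y)"
    proof (rule AE_I2)
      fix y :: real
      have "eventually (\<lambda>N. y \<in> {- M N..M N}) sequentially"
        using eventually_ge_at_top[of "nat \<lceil>\<bar>y\<bar>\<rceil>"] by eventually_elim (auto simp: M_def)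
      hence "eventually (\<lambda>N. indicator {- M N..M N} y *\<^sub>R f (Complex 1 y) = f (Complex 1 y)) sequentially"
        by eventually_elim auto
      thus "(\<lambda>N. indicator {- M N..M N} y *\<^sub>R f (Complex 1 y)) \<longlonglongrightarrow> f (Complex 1 y)"
        by (rule tendsto_eventually)
    qed
  qed (use f_integral(1) in \<open>auto simp: indicator_def\<close>)
  hence lim1: "(\<lambda>N. integral {- M N..M N} (\<lambda>y. f (Complex 1 y))) \<longlonglongrightarrow> J" unfolding set .
  have "(\<lambda>N. of_real (1 + 2 * T N) - integral {- M N..M N} (\<lambda>y. f (Complex 1 y))) \<longlonglongrightarrow> 0"
  proof (rule Lim_null_comparison)
    show "\<forall>\<^sub>F N in sequentially. norm (of_real (1 + 2 * T N) - integral {- M N..M N} (\<lambda>y. f (Complex 1 y))) \<le> 2 * exp (pi * t * (1 - (M N)\<^sup>2))"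
      unfolding T_def M_def by (intro always_eventually allI integral_f)
    show "(\<lambda>N. 2 * exp (pi * t * (1 - (M N)\<^sup>2))) \<longlonglongrightarrow> 0"
    proof -
      have "filterlim (\<lambda>N. pi * t * (1 - (M N)\<^sup>2)) at_bot sequentially"
        unfolding M_def using t by real_asymp
      hence "(\<lambda>N. exp (pi * t * (1 - (M N)\<^sup>2))) \<longlonglongrightarrow> 0" by (rule filterlim_compose[OF exp_at_bot])
      thus ?thesis by (rule tendsto_mult_right_zero)
    qed
  qed
  from tendsto_add[OF this lim1] have "(\<lambda>N. complex_of_real (1 + 2 * T N)) \<longlonglongrightarrow> J" by simp
  moreover have "(\<lambda>N. 1 + 2 * T N) \<longlonglongrightarrow> 1 + 2 * (\<Sum>n. exp (- (pi * t * (real (Suc n))\<^sup>2)))"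
    unfolding T_def by (intro tendsto_intros summable_LIMSEQ theta_summable t)
  hence "(\<lambda>N. complex_of_real (1 + 2 * T N)) \<longlonglongrightarrow> of_real (1 + 2 * (\<Sum>n. exp (- (pi * t * (real (Suc n))\<^sup>2))))"
    by (rule tendsto_of_real)
  ultimately have J: "J = of_real (1 + 2 * (\<Sum>n. exp (- (pi * t * (real (Suc n))\<^sup>2))))"
    using LIMSEQ_unique by blast
  define g where "g = (\<lambda>k::nat. (if k = 0 then 1 else 2) * (exp (- (pi * (real k)\<^sup>2 / t)) / sqrt t))"
  have "(\<lambda>k. complex_of_real (g k)) sums J" using f_integral(2) unfolding J_def g_def
    by (simp add: if_distrib[of complex_of_real] of_real_mult cong: if_cong)
  hence "g sums (1 + 2 * (\<Sum>n. exp (- (pi * t * (real (Suc n))\<^sup>2))))"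
    unfolding J by (simp only: sums_of_real_iff)
  hence "(\<lambda>n. g (Suc n)) sums (1 + 2 * (\<Sum>n. exp (- (pi * t * (real (Suc n))\<^sup>2))) - g 0)"
    by (subst sums_Suc_iff) simp
  hence "(\<Sum>n. g (Suc n)) = 1 + 2 * (\<Sum>n. exp (- (pi * t * (real (Suc n))\<^sup>2))) - 1 / sqrt t"
    by (simp add: sums_iff g_def)
  moreover have "(\<Sum>n. g (Suc n)) = (\<Sum>n. 2 / sqrt t * exp (- (pi * (1 / t) * (real (Suc n))\<^sup>2)))"
    by (simp add: g_def)
  moreover have "\<dots> = 2 / sqrt t * (\<Sum>n. exp (- (pi * (1 / t) * (real (Suc n))\<^sup>2)))"
    by (rule suminf_mult, rule theta_summable) (use t in auto)
  ultimately show ?thesis using t by (simp add: field_simps)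
qed

end

section \<open>The functional equation of the zeta function\<close>

text \<open>Half of Riemann's theta series, without its constant term, at x = exp v. The logarithmic
  variable turns x -> 1 / x into v -> -v and powers of x into exponentials.\<close>

definition theta_tail :: "real \<Rightarrow> real" where
  "theta_tail v = (\<Sum>n. exp (- (pi * exp v * (real (Suc n))\<^sup>2)))"

lemma theta_tail_minus: "theta_tail (- v) = exp (v / 2) * theta_tail v + (exp (v / 2) - 1) / 2"
proof -
  have "exp (- v) = (exp (- v / 2))\<^sup>2" by (simp add: power2_eq_square flip: exp_add)
  hence "sqrt (exp (- v)) = sqrt ((exp (- v / 2))\<^sup>2)" by (rule arg_cong)
  also have "\<dots> = exp (- v / 2)" by simp
  finally have "sqrt (exp (- v)) = exp (- v / 2)" .
  moreover have inv: "1 / exp (- x) = exp x" for x :: real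
    by (metis exp_minus inverse_eq_divide minus_minus)
  ultimately have s: "1 / sqrt (exp (- v)) = exp (v / 2)" by (metis minus_divide_left)
  from theta_inversion[of "exp (- v)"] inv[of v]
  have "1 + 2 * theta_tail (- v) = (1 + 2 * theta_tail v) * (1 / sqrt (exp (- v)))"
    by (simp add: theta_tail_def)
  hence "2 * theta_tail (- v) = (1 + 2 * theta_tail v) * exp (v / 2) - 1" unfolding s by linarith
  also have "\<dots> = 2 * (exp (v / 2) * theta_tail v + (exp (v / 2) - 1) / 2)" by (simp add: field_simps)
  finally show ?thesis by (rule mult_left_cancel[THEN iffD1, rotated]) simp
qed

lemma theta_tail_nonneg: "theta_tail v \<ge> 0"
  unfolding theta_tail_def by (intro suminf_nonneg theta_summable) auto

lemma theta_tail_le: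
  assumes v: "v \<ge> 0"
  shows "theta_tail v \<le> 2 * exp (- exp v)"
proof -
  define q where "q = exp (- (pi * exp v))"
  have pe: "exp v \<le> pi * exp v" "1 \<le> exp v" using v pi_ge_two by auto
  have q: "q \<le> exp (- exp v)" "q > 0" using pe by (auto simp: q_def)
  have "exp (1::real) \<ge> 2" using exp_ge_add_one_self[of 1] by simp
  hence "exp (-1::real) \<le> 1 / 2" by (simp add: exp_minus field_simps)
  moreover have "exp (- exp v) \<le> exp (-1)" using pe by simp
  ultimately have q2: "q \<le> 1 / 2" using q by linarith
  have g: "(\<lambda>n. q * q ^ n) sums (q * (1 / (1 - q)))"
    by (intro sums_mult geometric_sums) (use q q2 in auto)
  have "theta_tail v \<le> (\<Sum>n. q * q ^ n)" unfolding theta_tail_def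
  proof (rule suminf_le)
    fix n
    have "real (Suc n) * 1 \<le> real (Suc n) * real (Suc n)" by (intro mult_left_mono) auto
    hence "real (Suc n) \<le> (real (Suc n))\<^sup>2" by (simp only: power2_eq_square mult_1_right)
    hence "pi * exp v * real (Suc n) \<le> pi * exp v * (real (Suc n))\<^sup>2" by (intro mult_left_mono) auto
    moreover have "q * q ^ n = exp (- (pi * exp v * real (Suc n)))"
    proof -
      have "q * q ^ n = exp (- (pi * exp v)) ^ Suc n" by (simp add: q_def)
      also have "\<dots> = exp (real (Suc n) * - (pi * exp v))" by (rule exp_of_nat_mult[symmetric])
      finally show ?thesis by (simp only: mult_minus_right mult_ac)
    qed
    ultimately show "exp (- (pi * exp v * (real (Suc n))\<^sup>2)) \<le> q * q ^ n" by simp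
  qed (use theta_summable g in \<open>auto simp: sums_iff\<close>)
  also have "\<dots> = q * (1 / (1 - q))" using g by (simp add: sums_iff)
  also have "\<dots> \<le> q * 2" using q q2 by (intro mult_left_mono) (auto simp: field_simps)
  finally show ?thesis using q by simp
qed

text \<open>With a = b + 1 the exponent a v - exp v is at most a ln a, and ln a <= 2 sqrt a turns
  this into 2 a^(3/2). The extra unit in a pays for the factor exp (-v). Any growth exponent below 2
  would serve in \<open>Xi_has_zero\<close>.\<close>

lemma theta_tail_exp_le:
  assumes v: "v \<ge> 0" and b: "b \<ge> 0"
  shows "theta_tail v * exp (b * v) \<le> 2 * exp (2 * (b + 1) powr (3/2)) * exp (- v)"
proof -
  define a where "a = b + 1"
  have a: "a > 0" using b by (simp add: a_def)
  have "1 + (v - ln a) \<le> exp (v - ln a)" by (rule exp_ge_add_one_self)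
  also have "\<dots> = exp v / a" using a by (simp add: exp_diff)
  finally have "a * (1 + (v - ln a)) \<le> exp v" using a by (simp add: field_simps)
  hence "a * v - exp v \<le> a * ln a" using a by (simp add: algebra_simps)
  also have "a * ln a \<le> a * (2 * sqrt a)"
  proof (intro mult_left_mono)
    have "ln (sqrt a) \<le> sqrt a - 1" by (rule ln_le_minus_one) (use a in simp)
    thus "ln a \<le> 2 * sqrt a" using a by (simp add: ln_sqrt)
  qed (use a in auto)
  also have "a * (2 * sqrt a) = 2 * a powr (3/2)"
  proof -
    have "a powr (3/2) = a powr (1 + 1/2)" by simp
    also have "\<dots> = a * sqrt a" using a by (simp only: powr_add) (simp add: powr_half_sqrt)
    finally show ?thesis by simp
  qed
  finally have e: "- exp v + b * v \<le> 2 * (b + 1) powr (3/2) - v" by (simp add: a_def algebra_simps)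
  have "theta_tail v * exp (b * v) \<le> 2 * exp (- exp v) * exp (b * v)"
    by (intro mult_right_mono theta_tail_le v) auto
  also have "\<dots> = 2 * exp (- exp v + b * v)" by (simp only: exp_add mult.assoc)
  also have "\<dots> \<le> 2 * exp (2 * (b + 1) powr (3/2) - v)" using e by simp
  also have "\<dots> = 2 * exp (2 * (b + 1) powr (3/2)) * exp (- v)"
    by (simp only: exp_diff exp_minus divide_inverse mult.assoc)
  finally show ?thesis .
qed

lemma theta_tail_continuous: "continuous_on {0..} theta_tail"
proof -
  have "uniform_limit {0..} (\<lambda>N v. \<Sum>n<N. exp (- (pi * exp v * (real (Suc n))\<^sup>2))) (\<lambda>v. \<Sum>n. exp (- (pi * exp v * (real (Suc n))\<^sup>2))) sequentially"
  proof (rule Weierstrass_m_test)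
    show "summable (\<lambda>n. exp (- (pi * 1 * (real (Suc n))\<^sup>2)))" by (rule theta_summable) simp
    fix n and v :: real assume "v \<in> {0..}"
    hence "1 \<le> exp v" by simp
    hence "pi * 1 * (real (Suc n))\<^sup>2 \<le> pi * exp v * (real (Suc n))\<^sup>2"
      by (intro mult_left_mono mult_right_mono) auto
    thus "norm (exp (- (pi * exp v * (real (Suc n))\<^sup>2))) \<le> exp (- (pi * 1 * (real (Suc n))\<^sup>2))" by simp
  qed
  hence "continuous_on {0..} (\<lambda>v. \<Sum>n. exp (- (pi * exp v * (real (Suc n))\<^sup>2)))"
    by (rule uniform_limit_theorem[rotated]) (auto intro!: always_eventually continuous_intros)
  thus ?thesis by (simp add: theta_tail_def[abs_def])
qed

lemma theta_tail_measurable [measurable]: "theta_tail \<in> borel_measurable borel"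
  unfolding theta_tail_def[abs_def] by measurable

lemma has_bochner_integral_exp_minus:
  assumes a: "a > 0"
  shows "has_bochner_integral lborel (\<lambda>v. indicator {c..} v * exp (- (a * v))) (exp (- (a * c)) / a :: real)"
proof (rule has_bochner_integral_nn_integral)
  have "((\<lambda>v. exp (- a * v)) has_integral exp (- a * c) / a) {c..}"
    by (rule has_integral_exp_minus_to_infinity[OF a])
  hence "((\<lambda>v. if v \<in> {c..} then exp (- a * v) else 0) has_integral exp (- a * c) / a) UNIV"
    by (simp only: has_integral_restrict_UNIV)
  also have "(\<lambda>v. if v \<in> {c..} then exp (- a * v) else 0) = (\<lambda>v. indicator {c..} v * exp (- (a * v)))"
    by (auto simp: indicator_def)
  finally show "(\<integral>\<^sup>+ v. ennreal (indicator {c..} v * exp (- (a * v))) \<partial>lborel) = ennreal (exp (- (a * c)) / a)"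
    by (intro nn_integral_has_integral_lborel) auto
qed (use a in auto)

lemma theta_tail_exp_integrable: "integrable lborel (\<lambda>v. indicator {0..} v * (theta_tail v * exp (b * v)))"
proof (rule Bochner_Integration.integrable_bound)
  show "integrable lborel (\<lambda>v. 2 * exp (2 * (\<bar>b\<bar> + 1) powr (3/2)) * (indicator {0..} v * exp (- (1 * v))))"
    using has_bochner_integral_exp_minus[of 1 0]
      by (intro integrable_mult_right) (auto simp: has_bochner_integral_iff)
  show "AE v in lborel. norm (indicator {0..} v * (theta_tail v * exp (b * v))) \<le>
      norm (2 * exp (2 * (\<bar>b\<bar> + 1) powr (3/2)) * (indicator {0..} v * exp (- (1 * v))))"
  proof (rule AE_I2)
    fix v :: real
    show "norm (indicator {0..} v * (theta_tail v * exp (b * v))) \<le>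
      norm (2 * exp (2 * (\<bar>b\<bar> + 1) powr (3/2)) * (indicator {0..} v * exp (- (1 * v))))"
    proof (cases "v \<ge> 0")
      case True
      have "theta_tail v * exp (b * v) \<le> theta_tail v * exp (\<bar>b\<bar> * v)"
        using True theta_tail_nonneg by (intro mult_left_mono) (auto intro: mult_right_mono)
      also have "\<dots> \<le> 2 * exp (2 * (\<bar>b\<bar> + 1) powr (3/2)) * exp (- v)"
        by (rule theta_tail_exp_le) (use True in auto)
      finally show ?thesis using True theta_tail_nonneg[of v] by (simp add: abs_mult)
    qed auto
  qed
qed measurable

section \<open>Riemann's integral for the completed zeta function\<close>

text \<open>The Mellin integral over x < 1 is folded onto x > 1 by \<open>theta_tail_minus\<close>.
  This produces the second exponential and makes the symmetry s -> 1 - s visible.\<close>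

definition xi_integrand :: "complex \<Rightarrow> real \<Rightarrow> complex" where
  "xi_integrand s v = of_real (theta_tail v) * (exp (s * of_real v / 2) + exp ((1 - s) * of_real v / 2))"

definition xi_integral :: "complex \<Rightarrow> complex" where
  "xi_integral s = (LINT v|lborel. indicator {0..} v *\<^sub>R xi_integrand s v)"

definition Xi :: "complex \<Rightarrow> complex" where
  "Xi s = 1 + s * (s - 1) * xi_integral s"

lemma Xi_sym: "Xi (1 - s) = Xi s"
proof -
  have "xi_integral (1 - s) = xi_integral s"
    by (simp add: xi_integral_def xi_integrand_def add.commute)
  thus ?thesis by (simp add: Xi_def algebra_simps)
qed

lemma xi_integrand_bound:
  assumes v: "v \<ge> 0" and s: "norm s \<le> R"
  shows "norm (xi_integrand s v) \<le> 4 * exp (2 * (R + 2) powr (3/2)) * exp (- v)"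
proof -
  have R: "R \<ge> 0" using s norm_ge_zero order_trans by blast
  have e: "norm (exp (z * of_real v / 2)) \<le> exp ((R + 1) * v)" if "norm z \<le> R + 1" for z :: complex
  proof -
    have "Re z \<le> R + 1" using complex_Re_le_cmod[of z] that by simp
    hence "Re z * v / 2 \<le> (R + 1) * v / 2" using v by (intro divide_right_mono mult_right_mono) auto
    also have "\<dots> \<le> (R + 1) * v" using R v by (auto simp: field_simps)
    finally show ?thesis by (simp add: norm_exp_eq_Re)
  qed
  have "norm (exp (s * of_real v / 2) + exp ((1 - s) * of_real v / 2)) \<le> exp ((R + 1) * v) + exp ((R + 1) * v)"
  proof (rule order_trans[OF norm_triangle_ineq add_mono])
    show "norm (exp (s * of_real v / 2)) \<le> exp ((R + 1) * v)" using s by (intro e) auto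
    show "norm (exp ((1 - s) * of_real v / 2)) \<le> exp ((R + 1) * v)"
      using s norm_triangle_ineq4[of 1 s] by (intro e) auto
  qed
  hence "norm (xi_integrand s v) \<le> theta_tail v * (2 * exp ((R + 1) * v))"
    unfolding xi_integrand_def norm_mult using theta_tail_nonneg[of v]
    by (intro mult_mono) auto
  also have "\<dots> = 2 * (theta_tail v * exp ((R + 1) * v))" by simp
  also have "\<dots> \<le> 2 * (2 * exp (2 * (R + 1 + 1) powr (3/2)) * exp (- v))"
    by (intro mult_left_mono theta_tail_exp_le) (use v R in auto)
  finally show ?thesis by (simp add: add.assoc)
qed

lemma xi_integrand_measurable [measurable]: "xi_integrand s \<in> borel_measurable borel"
  unfolding xi_integrand_def[abs_def] by measurable

text \<open>The set \<open>A\<close> is arbitrary so that one estimate covers both the whole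
  integral and its tails, for which exp (-c) tends to 0.\<close>

lemma xi_integral_bound:
  assumes A: "A \<in> sets borel" "A \<subseteq> {c..}" "c \<ge> 0" and s: "norm s \<le> R"
  shows "integrable lborel (\<lambda>v. indicator A v *\<^sub>R xi_integrand s v)"
    and "norm (LINT v|lborel. indicator A v *\<^sub>R xi_integrand s v) \<le> 4 * exp (2 * (R + 2) powr (3/2)) * exp (- c)"
proof -
  define K where "K = 4 * exp (2 * (R + 2) powr (3/2))"
  have K: "K > 0" by (simp add: K_def)
  have i: "has_bochner_integral lborel (\<lambda>v. K * (indicator {c..} v * exp (- (1 * v)))) (K * (exp (- (1 * c)) / 1))"
    by (intro has_bochner_integral_mult_right has_bochner_integral_exp_minus) auto
  have b: "norm (indicator A v *\<^sub>R xi_integrand s v) \<le> K * (indicator {c..} v * exp (- (1 * v)))" for v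
  proof (cases "v \<in> A")
    case True
    hence "v \<ge> c" "v \<ge> 0" using A by auto
    thus ?thesis using xi_integrand_bound[OF _ s, of v] True by (simp add: K_def)
  next
    case False
    thus ?thesis using K by simp
  qed
  show int: "integrable lborel (\<lambda>v. indicator A v *\<^sub>R xi_integrand s v)"
  proof (rule Bochner_Integration.integrable_bound)
    show "integrable lborel (\<lambda>v. K * (indicator {c..} v * exp (- (1 * v))))"
      using i by (simp add: has_bochner_integral_iff)
    show "AE v in lborel. norm (indicator A v *\<^sub>R xi_integrand s v) \<le> norm (K * (indicator {c..} v * exp (- (1 * v))))"
      using b by (intro AE_I2) (smt (verit) real_norm_def norm_ge_zero)
  qed (use A(1) in measurable)
  have "norm (LINT v|lborel. indicator A v *\<^sub>R xi_integrand s v) \<le> (LINT v|lborel. K * (indicator {c..} v * exp (- (1 * v))))"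
    by (rule Bochner_Integration.integral_norm_bound_integral) (use int i b in \<open>auto simp: has_bochner_integral_iff\<close>)
  also have "\<dots> = K * exp (- c)" using i by (simp add: has_bochner_integral_iff)
  finally show "norm (LINT v|lborel. indicator A v *\<^sub>R xi_integrand s v) \<le> 4 * exp (2 * (R + 2) powr (3/2)) * exp (- c)"
    by (simp add: K_def)
qed

text \<open>Integrals over bounded intervals are entire by differentiation under the integral sign;
  the tail estimate makes their convergence uniform on discs.\<close>

lemma xi_integral_holomorphic: "xi_integral holomorphic_on UNIV"
proof (rule holomorphic_uniform_sequence)
  define En where "En = (\<lambda>n::nat. \<lambda>s. integral (cbox 0 (real n)) (xi_integrand s))"
  have cont: "continuous_on (cbox 0 (real n)) theta_tail" for n
    by (rule continuous_on_subset[OF theta_tail_continuous]) auto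
  have contc: "continuous_on (cbox 0 (real n)) (xi_integrand s)" for n s
    unfolding xi_integrand_def[abs_def] by (intro continuous_intros cont) auto
  show "En n holomorphic_on UNIV" for n unfolding En_def
  proof (rule leibniz_rule_holomorphic)
    show "((\<lambda>s. xi_integrand s v) has_field_derivative
       of_real (theta_tail v) * (exp (s * of_real v / 2) * (of_real v / 2) - exp ((1 - s) * of_real v / 2) * (of_real v / 2))) (at s within UNIV)"
      for s v unfolding xi_integrand_def by (auto intro!: derivative_eq_intros)
    show "xi_integrand s integrable_on cbox 0 (real n)" for s
      using contc integrable_continuous by blast
    have "continuous_on (UNIV \<times> cbox 0 (real n)) (\<lambda>p. theta_tail (snd p))"
      by (rule continuous_on_compose2[OF cont]) (auto intro: continuous_intros)
    thus "continuous_on (UNIV \<times> cbox 0 (real n)) (\<lambda>(s :: complex, v).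
       of_real (theta_tail v) * (exp (s * of_real v / 2) * (of_real v / 2) - exp ((1 - s) * of_real v / 2) * (of_real v / 2)))"
      unfolding case_prod_unfold by (intro continuous_intros) auto
  qed auto
  fix x :: complex
  have "uniform_limit (cball x 1) En xi_integral sequentially"
    unfolding uniform_limit_iff
  proof (intro allI impI)
    fix e :: real assume e: "e > 0"
    define K where "K = 4 * exp (2 * (norm x + 1 + 2) powr (3/2))"
    have "(\<lambda>n. K * exp (- real n)) \<longlonglongrightarrow> 0" by real_asymp
    hence "eventually (\<lambda>n. K * exp (- real n) < e) sequentially" using e by (rule order_tendstoD)
    thus "\<forall>\<^sub>F n in sequentially. \<forall>s\<in>cball x 1. dist (En n s) (xi_integral s) < e"
    proof (eventually_elim, intro ballI)
      fix n s assume n: "K * exp (- real n) < e" and s: "s \<in> cball x 1"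
      have ns: "norm s \<le> norm x + 1"
        using s norm_triangle_ineq2[of s x] by (simp add: dist_norm norm_minus_commute)
      have i1: "integrable lborel (\<lambda>v. indicator {0..real n} v *\<^sub>R xi_integrand s v)"
        by (rule xi_integral_bound[OF _ _ _ ns, of _ 0]) auto
      have i2: "integrable lborel (\<lambda>v. indicator {real n<..} v *\<^sub>R xi_integrand s v)"
        by (rule xi_integral_bound[OF _ _ _ ns, of _ "real n"]) auto
      have "En n s = (LINT v|lborel. indicator {0..real n} v *\<^sub>R xi_integrand s v)"
        using set_borel_integral_eq_integral(2)[of "{0..real n}" "xi_integrand s"] i1
        by (simp add: set_integrable_def set_lebesgue_integral_def En_def)
      moreover have "xi_integral s = (LINT v|lborel. indicator {0..real n} v *\<^sub>R xi_integrand s v + indicator {real n<..} v *\<^sub>R xi_integrand s v)"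
        unfolding xi_integral_def by (intro Bochner_Integration.integral_cong) (auto simp: indicator_def)
      ultimately have "xi_integral s = En n s + (LINT v|lborel. indicator {real n<..} v *\<^sub>R xi_integrand s v)"
        using i1 i2 by simp
      moreover have "norm (LINT v|lborel. indicator {real n<..} v *\<^sub>R xi_integrand s v) \<le> K * exp (- real n)"
        unfolding K_def by (rule xi_integral_bound[OF _ _ _ ns, of _ "real n"]) auto
      ultimately show "dist (En n s) (xi_integral s) < e" using n by (simp add: dist_norm)
    qed
  qed
  thus "\<exists>d>0. cball x d \<subseteq> UNIV \<and> uniform_limit (cball x d) En xi_integral sequentially"
    by (intro exI[of _ 1]) auto
qed auto

lemma norm_xi_integral_le: "norm (xi_integral s) \<le> 4 * exp (2 * (norm s + 2) powr (3/2))"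
  using xi_integral_bound(2)[of "{0..}" 0 s "norm s"] by (simp add: xi_integral_def)

lemma Xi_holomorphic: "Xi holomorphic_on UNIV"
  unfolding Xi_def[abs_def] by (intro holomorphic_intros xi_integral_holomorphic)

text \<open>Euler's integral under t = exp v, followed by the shift v -> v + ln c. This is the form
  in which the single terms of \<open>theta_tail\<close> have to be integrated.\<close>

lemma has_bochner_integral_Gamma_exp:
  assumes a: "a > 0" and c: "c > 0"
  shows "has_bochner_integral lborel (\<lambda>v. exp (a * v - c * exp v)) (Gamma a * c powr (- a) :: real)"
proof -
  define f where "f = (\<lambda>t::real. t powr (a - 1) / exp t)"
  have 0: "(f has_integral Gamma a) {0..}" unfolding f_def by (rule Gamma_integral_real[OF a])
  have n1: "negligible {x \<in> {0..} - {0<..}. f x \<noteq> 0}" by (rule negligible_subset[of "{0}"]) auto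
  have n2: "negligible {x \<in> {0<..} - {0..}. f x \<noteq> 0}" by (rule negligible_subset[of "{}"]) auto
  have f0: "(f has_integral Gamma a) {0<..}"
    by (rule iffD1[OF has_integral_spike_set_eq[OF n1 n2] 0])
  have "f absolutely_integrable_on {0<..}"
    by (rule nonnegative_absolutely_integrable_1) (use f0 in \<open>auto simp: f_def\<close>)
  moreover have range_exp: "(range exp :: real set) = {0<..}"
    by (auto simp: image_iff) (metis exp_ln)
  ultimately have "f absolutely_integrable_on range exp \<and> integral (range exp) f = Gamma a"
    using f0 unfolding range_exp by (auto simp: integral_unique)
  hence "(\<lambda>v. \<bar>exp v\<bar> * f (exp v)) absolutely_integrable_on UNIV \<and> integral UNIV (\<lambda>v. \<bar>exp v\<bar> * f (exp v)) = Gamma a"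
    by (subst has_absolute_integral_change_of_variables_1'[of UNIV exp exp])
       (auto intro!: derivative_eq_intros simp: inj_on_def)
  moreover have eq: "(\<lambda>v. \<bar>exp v\<bar> * f (exp v)) = (\<lambda>v. exp (a * v - exp v))"
    by (auto simp: f_def powr_def exp_diff algebra_simps)
  ultimately have "((\<lambda>v. exp (a * v - exp v)) has_integral Gamma a) UNIV"
    unfolding eq has_integral_iff by (metis set_lebesgue_integral_eq_integral(1))
  hence "(\<integral>\<^sup>+ v. ennreal (exp (a * v - exp v)) \<partial>lborel) = ennreal (Gamma a)"
    by (intro nn_integral_has_integral_lborel) auto
  hence "has_bochner_integral lborel (\<lambda>v. exp (a * v - exp v)) (Gamma a)"
    using a by (intro has_bochner_integral_nn_integral) (auto simp: Gamma_real_pos less_imp_le)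
  hence "has_bochner_integral lborel (\<lambda>v. exp (a * (ln c + 1 * v) - exp (ln c + 1 * v))) (Gamma a /\<^sub>R \<bar>1\<bar>)"
    by (subst (asm) lborel_has_bochner_integral_real_affine_iff[of 1 _ _ "ln c"]) auto
  hence "has_bochner_integral lborel (\<lambda>v. c powr (- a) * exp (a * (ln c + 1 * v) - exp (ln c + 1 * v))) (c powr (- a) * (Gamma a /\<^sub>R \<bar>1\<bar>))"
    by (intro has_bochner_integral_mult_right)
  also have "(\<lambda>v. c powr (- a) * exp (a * (ln c + 1 * v) - exp (ln c + 1 * v))) = (\<lambda>v. exp (a * v - c * exp v))"
  proof
    fix v
    have "c powr (- a) = exp (- (a * ln c))" "exp (ln c + 1 * v) = c * exp v"
      using c by (simp_all add: powr_def exp_add)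
    hence "c powr (- a) * exp (a * (ln c + 1 * v) - exp (ln c + 1 * v)) = exp (- (a * ln c) + (a * (ln c + 1 * v) - c * exp v))"
      by (simp only: exp_add)
    thus "c powr (- a) * exp (a * (ln c + 1 * v) - exp (ln c + 1 * v)) = exp (a * v - c * exp v)"
      by (simp add: algebra_simps)
  qed
  finally show ?thesis by (simp add: mult.commute)
qed

lemma summable_Suc_powr: "s > 1 \<Longrightarrow> summable (\<lambda>n. real (Suc n) powr (- s))"
  using summable_real_powr_iff[of "- s"] by (subst summable_Suc_iff) auto

text \<open>Over the whole line the theta series integrates term by term to the Gamma factor times
  the zeta series. On v < 0 the inversion formula yields the second exponential of
  \<open>xi_integrand\<close> and two elementary integrals, the source of 1 / (s - 1) and 1 / s.
  Real s is enough for the identity theorem.\<close>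

lemma xi_integral_real:
  assumes s: "s > (1::real)"
  shows "xi_integral (of_real s) = of_real (pi powr (- s / 2) * Gamma (s / 2) * (\<Sum>n. real (Suc n) powr (- s)) - 1 / (s - 1) + 1 / s)"
proof -
  define a where "a = s / 2"
  have a: "a > 1 / 2" using s by (simp add: a_def)
  define F where "F = (\<lambda>n v. exp (a * v - pi * (real (Suc n))\<^sup>2 * exp v))"
  define G where "G = pi powr (- a) * Gamma a"
  have F: "has_bochner_integral lborel (F n) (G * real (Suc n) powr (- s))" for n
  proof -
    have "(pi * (real (Suc n))\<^sup>2) powr (- a) = pi powr (- a) * real (Suc n) powr (- s)"
      by (simp only: powr_mult a_def) (simp add: powr_powr flip: powr_numeral)
    thus ?thesis using has_bochner_integral_Gamma_exp[of a "pi * (real (Suc n))\<^sup>2"] a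
      by (simp add: F_def G_def mult_ac)
  qed
  have int: "integrable lborel (F n)" for n using F by (auto simp: has_bochner_integral_iff)
  have Fsum: "(\<lambda>n. F n v) sums (theta_tail v * exp (a * v))" for v
  proof -
    have "(\<lambda>n. exp (- (pi * exp v * (real (Suc n))\<^sup>2))) sums theta_tail v"
      unfolding theta_tail_def by (rule summable_sums, rule theta_summable) auto
    hence "(\<lambda>n. exp (- (pi * exp v * (real (Suc n))\<^sup>2)) * exp (a * v)) sums (theta_tail v * exp (a * v))"
      by (rule sums_mult2)
    thus ?thesis by (simp add: F_def exp_diff exp_minus divide_inverse mult_ac)
  qed
  have eq: "(\<lambda>v. \<Sum>n. F n v) = (\<lambda>v. theta_tail v * exp (a * v))" using Fsum by (auto simp: sums_iff)
  have Fn: "norm (F n v) = F n v" for n v by (simp add: F_def)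
  have 1: "AE v in lborel. summable (\<lambda>n. norm (F n v))"
    unfolding Fn by (intro AE_I2 sums_summable[OF Fsum])
  have LF: "(LINT v|lborel. norm (F n v)) = G * real (Suc n) powr (- s)" for n
    using F[of n] by (simp only: Fn has_bochner_integral_iff)
  have 2: "summable (\<lambda>n. LINT v|lborel. norm (F n v))"
    unfolding LF using s by (intro summable_mult summable_Suc_powr)
  define g where "g = (\<lambda>v. theta_tail v * exp (a * v))"
  have gint: "integrable lborel g" using integrable_suminf[OF int 1 2] by (simp add: eq g_def)
  have "(LINT v|lborel. g v) = (\<Sum>n. G * real (Suc n) powr (- s))"
    using integral_suminf[OF int 1 2] F by (simp add: eq g_def has_bochner_integral_iff)
  also have "\<dots> = G * (\<Sum>n. real (Suc n) powr (- s))"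
    using s by (intro suminf_mult summable_Suc_powr)
  finally have J: "(LINT v|lborel. g v) = G * (\<Sum>n. real (Suc n) powr (- s))" .
  define P where "P = (\<lambda>v. indicator {0..} v * (theta_tail v * exp (a * v)))"
  define Q where "Q = (\<lambda>v. indicator {0..} v * (theta_tail v * exp ((1/2 - a) * v)))"
  have PQ: "integrable lborel P" "integrable lborel Q"
    unfolding P_def Q_def by (rule theta_tail_exp_integrable)+
  define N where "N = (\<lambda>v::real. indicator {..<0} v * g v)"
  have Nint: "integrable lborel N" unfolding N_def
    using integrable_mult_indicator[OF _ gint, of "{..<0}"] by simp
  have "(LINT v|lborel. g v) = (LINT v|lborel. P v + N v)"
    by (intro Bochner_Integration.integral_cong) (auto simp: P_def N_def g_def indicator_def)
  also have "\<dots> = (LINT v|lborel. P v) + (LINT v|lborel. N v)" using PQ Nint by simp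
  also have "(LINT v|lborel. N v) = (LINT v|lborel. N (- v))"
    by (subst lborel_integral_real_affine[of "-1" _ 0]) auto
  also have "\<dots> = (LINT v|lborel. Q v + (1/2) * (indicator {0..} v * exp (- ((a - 1/2) * v)) - indicator {0..} v * exp (- (a * v))))"
  proof (rule integral_cong_AE)
    \<comment> \<open>At v = 0 the indicators of the two half-lines disagree; the point has measure
      zero.\<close>
    have "AE v in lborel. v \<noteq> (0::real)" by (rule AE_lborel_singleton)
    thus "AE v in lborel. N (- v) = Q v + (1/2) * (indicator {0..} v * exp (- ((a - 1/2) * v)) - indicator {0..} v * exp (- (a * v)))"
    proof eventually_elim
      case (elim v)
      have e: "exp (v / 2) * exp (- (a * v)) = exp ((1/2 - a) * v)" "- ((a - 1/2) * v) = (1/2 - a) * v"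
        by (simp_all add: algebra_simps flip: exp_add)
      show ?case
      proof (cases "v > 0")
        case True
        have "N (- v) = (exp (v / 2) * theta_tail v + (exp (v / 2) - 1) / 2) * exp (- (a * v))"
          using True by (simp add: N_def g_def theta_tail_minus)
        also have "\<dots> = theta_tail v * (exp (v / 2) * exp (- (a * v))) + (1/2) * (exp (v / 2) * exp (- (a * v)) - exp (- (a * v)))"
          by (simp add: field_simps)
        finally show ?thesis unfolding e using True by (simp add: Q_def)
      qed (use elim in \<open>simp add: N_def Q_def\<close>)
    qed
  qed (simp_all add: N_def g_def Q_def)
  also have "\<dots> = (LINT v|lborel. Q v) + (1/2) * (1 / (a - 1/2) - 1 / a)"
    using has_bochner_integral_exp_minus[of "a - 1/2" 0] has_bochner_integral_exp_minus[of a 0] PQ a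
    by (simp add: has_bochner_integral_iff)
  also have "(1/2) * (1 / (a - 1/2) - 1 / a) = 1 / (s - 1) - 1 / s"
    using s by (simp add: a_def field_simps)
  finally have main: "(LINT v|lborel. P v) + (LINT v|lborel. Q v) = G * (\<Sum>n. real (Suc n) powr (- s)) - 1 / (s - 1) + 1 / s"
    using J by simp
  have "indicator {0..} v *\<^sub>R xi_integrand (of_real s) v = of_real (P v + Q v)" for v
  proof -
    have 1: "exp (complex_of_real s * of_real v / 2) = of_real (exp (a * v))"
      by (simp add: a_def exp_of_real[symmetric])
    have "(1 - complex_of_real s) * of_real v / 2 = of_real ((1/2 - a) * v)"
      by (simp add: a_def field_simps)
    hence 2: "exp ((1 - complex_of_real s) * of_real v / 2) = of_real (exp ((1/2 - a) * v))"
      by (simp only: exp_of_real)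
    show ?thesis unfolding xi_integrand_def 1 2 P_def Q_def by (auto simp: indicator_def algebra_simps)
  qed
  hence "xi_integral (of_real s) = of_real (LINT v|lborel. P v + Q v)"
    by (simp only: xi_integral_def integral_complex_of_real)
  also have "(LINT v|lborel. P v + Q v) = G * (\<Sum>n. real (Suc n) powr (- s)) - 1 / (s - 1) + 1 / s"
    using PQ main by simp
  finally show ?thesis by (simp only: G_def a_def minus_divide_left)
qed

section \<open>Dirichlet series and the continuation of zeta\<close>

lemma norm_of_nat_Suc_powr: "norm (of_nat (Suc n) powr (s::complex)) = real (Suc n) powr Re s"
  by (subst norm_powr_real_powr) auto

text \<open>Absolute convergence at one abscissa dominates the terms on any closed disc to its
  right, and uniform convergence on discs gives holomorphy and termwise differentiation. The
  coefficient \<open>a n\<close> belongs to the integer n + 1.\<close>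

lemma dirichlet_series:
  fixes a :: "nat \<Rightarrow> complex"
  assumes summ: "\<And>\<sigma>. \<sigma> > 1 \<Longrightarrow> summable (\<lambda>n. norm (a n) * real (Suc n) powr (- \<sigma>))"
  defines "F \<equiv> \<lambda>s. \<Sum>n. a n * of_nat (Suc n) powr (- s)"
  shows "Re s > 1 \<Longrightarrow> (\<lambda>n. a n * of_nat (Suc n) powr (- s)) sums F s"
    and "F holomorphic_on {s. 1 < Re s}"
    and "Re s > 1 \<Longrightarrow> (\<lambda>n. - of_real (ln (real (Suc n))) * a n * of_nat (Suc n) powr (- s)) sums deriv F s"
proof -
  let ?S = "{s. 1 < Re s}"
  have S: "open ?S" by (rule open_halfspace_Re_gt)
  have nt: "norm (a n * of_nat (Suc n) powr (- s)) = norm (a n) * real (Suc n) powr (- Re s)" for n s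
    by (simp only: norm_mult norm_of_nat_Suc_powr uminus_complex.sel)
  show "(\<lambda>n. a n * of_nat (Suc n) powr (- s)) sums F s" if "Re s > 1" for s
    unfolding F_def
    by (rule summable_sums, rule summable_norm_cancel) (use summ[OF that] in \<open>simp only: nt\<close>)
  have ul: "\<exists>d>0. cball x d \<subseteq> ?S \<and> uniform_limit (cball x d) (\<lambda>N s. \<Sum>n<N. a n * of_nat (Suc n) powr (- s)) F sequentially"
    if x: "x \<in> ?S" for x
  proof -
    define d where "d = (Re x - 1) / 2"
    have d: "d > 0" using x by (simp add: d_def)
    have Re: "Re s \<ge> Re x - d" if "s \<in> cball x d" for s
    proof -
      have "\<bar>Re (x - s)\<bar> \<le> d" using that abs_Re_le_cmod[of "x - s"] by (simp add: dist_norm)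
      thus ?thesis by simp
    qed
    have 1: "Re x - d > 1" using x by (simp add: d_def field_simps)
    have "uniform_limit (cball x d) (\<lambda>N s. \<Sum>n<N. a n * of_nat (Suc n) powr (- s)) F sequentially"
      unfolding F_def
    proof (rule Weierstrass_m_test[OF _ summ[OF 1]])
      fix n s assume s: "s \<in> cball x d"
      have "real (Suc n) powr (- Re s) \<le> real (Suc n) powr (- (Re x - d))"
        using Re[OF s] by (intro powr_mono) auto
      thus "norm (a n * of_nat (Suc n) powr (- s)) \<le> norm (a n) * real (Suc n) powr (- (Re x - d))"
        unfolding nt by (rule mult_left_mono) auto
    qed
    moreover have "cball x d \<subseteq> ?S" using Re 1 by force
    ultimately show ?thesis using d by blast
  qed
  have hd: "((\<lambda>s. \<Sum>n<N. a n * of_nat (Suc n) powr (- s)) has_field_derivative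
      (\<Sum>n<N. - of_real (ln (real (Suc n))) * a n * of_nat (Suc n) powr (- s))) (at s)" for N s
  proof (rule DERIV_sum)
    fix n
    define w where "w = complex_of_nat (Suc n)"
    have L: "Ln w = complex_of_real (ln (real (Suc n)))"
      unfolding w_def by (metis Ln_of_real of_nat_0_less_iff of_real_of_nat_eq zero_less_Suc)
    have w0: "w \<noteq> 0" unfolding w_def of_nat_eq_0_iff by simp
    have "((\<lambda>s. w powr (- s)) has_field_derivative Ln w * w powr (- s) * - 1) (at s)"
      by (rule DERIV_chain2[OF has_field_derivative_powr_right[OF w0] DERIV_minus[OF DERIV_ident]])
    hence "((\<lambda>s. of_nat (Suc n) powr (- s)) has_field_derivative - of_real (ln (real (Suc n))) * of_nat (Suc n) powr (- s)) (at s)"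
      unfolding L by (simp only: w_def mult_minus_right mult_minus_left mult_1_right)
    from DERIV_cmult[OF this, of "a n"]
    show "((\<lambda>s. a n * of_nat (Suc n) powr (- s)) has_field_derivative
      - of_real (ln (real (Suc n))) * a n * of_nat (Suc n) powr (- s)) (at s)"
      by (simp only: mult_ac mult_minus_left mult_minus_right)
  qed
  show hol: "F holomorphic_on ?S"
    by (rule holomorphic_uniform_sequence[OF S _ ul]) (use hd in \<open>auto simp: holomorphic_on_open S\<close>)
  obtain g' where g': "\<And>x. x \<in> ?S \<Longrightarrow> (F has_field_derivative g' x) (at x) \<and>
     (\<lambda>N. \<Sum>n<N. - of_real (ln (real (Suc n))) * a n * of_nat (Suc n) powr (- x)) \<longlonglongrightarrow> g' x"
    using has_complex_derivative_uniform_sequence[OF S hd ul] by metis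
  show "(\<lambda>n. - of_real (ln (real (Suc n))) * a n * of_nat (Suc n) powr (- s)) sums deriv F s"
    if "Re s > 1"
    using g'[of s] that by (auto simp: sums_def DERIV_imp_deriv)
qed

text \<open>\<open>Xi s = s (s - 1) \<pi> powr (- s / 2) \<Gamma>(s / 2) \<zeta>(s)\<close> is Riemann's integral with \<open>v = ln x\<close>, so that \<open>zeta_reg\<close>
  is the entire function \<open>(s - 1) \<zeta>(s)\<close>.\<close>

definition zeta_reg :: "complex \<Rightarrow> complex" where
  "zeta_reg s = of_real pi powr (s / 2) * rGamma (s / 2 + 1) * Xi s / 2"

lemma zeta_reg_holomorphic: "zeta_reg holomorphic_on UNIV"
  unfolding zeta_reg_def[abs_def] by (intro holomorphic_intros Xi_holomorphic) auto

text \<open>The factor 1 is the coefficient sequence, written out so that this is literally an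
  instance of \<open>dirichlet_series\<close>.\<close>

definition zeta_sum :: "complex \<Rightarrow> complex" where
  "zeta_sum s = (\<Sum>n. 1 * of_nat (Suc n) powr (- s))"

lemma zeta_sum_summable: "\<sigma> > 1 \<Longrightarrow> summable (\<lambda>n. norm (1::complex) * real (Suc n) powr (- \<sigma>))"
  using summable_Suc_powr by simp

lemma zeta_sum_holomorphic: "zeta_sum holomorphic_on {s. 1 < Re s}"
  unfolding zeta_sum_def[abs_def] by (rule dirichlet_series(2)[OF zeta_sum_summable])

lemma zeta_reg_real:
  assumes s: "s > (1::real)"
  shows "zeta_reg (of_real s) = (of_real s - 1) * zeta_sum (of_real s)"
proof -
  define a where "a = s / 2"
  have a: "a > 0" using s by (simp add: a_def)
  define Z where "Z = (\<Sum>n. real (Suc n) powr (- s))"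
  have "1 * of_nat (Suc n) powr (- complex_of_real s) = complex_of_real (real (Suc n) powr (- s))" for n
    using powr_of_real[of "real (Suc n)" "- s"] by simp
  hence Z: "zeta_sum (of_real s) = of_real Z"
    unfolding zeta_sum_def Z_def by (simp only: suminf_of_real[OF summable_Suc_powr[OF s]])
  have "Xi (of_real s) = of_real (1 + s * (s - 1) * (pi powr (- a) * Gamma a * Z - 1 / (s - 1) + 1 / s))"
    unfolding Xi_def xi_integral_real[OF s] by (simp add: a_def Z_def)
  also have "1 + s * (s - 1) * (pi powr (- a) * Gamma a * Z - 1 / (s - 1) + 1 / s) = s * (s - 1) * pi powr (- a) * Gamma a * Z"
    using s by (simp add: field_simps)
  finally have Xi: "Xi (of_real s) = of_real (s * (s - 1) * pi powr (- a) * Gamma a * Z)" .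
  have p: "complex_of_real pi powr (of_real s / 2) = of_real (pi powr a)"
    using powr_of_real[of pi a] by (simp add: a_def)
  have g: "rGamma (complex_of_real s / 2 + 1) = of_real (1 / (a * Gamma a))"
  proof -
    have "rGamma (complex_of_real s / 2 + 1) = of_real (rGamma (a + 1))"
      using rGamma_complex_of_real[of "a + 1"] by (simp add: a_def)
    also have "rGamma (a + 1) = 1 / (a * Gamma a)"
      using Gamma_plus1[of a] a by (simp add: rGamma_inverse_Gamma inverse_eq_divide nonpos_Ints_def)
    finally show ?thesis .
  qed
  have "zeta_reg (of_real s) = of_real (pi powr a * (1 / (a * Gamma a)) * (s * (s - 1) * pi powr (- a) * Gamma a * Z) / 2)"
    unfolding zeta_reg_def p g Xi by simp
  also have "pi powr a * (1 / (a * Gamma a)) * (s * (s - 1) * pi powr (- a) * Gamma a * Z) / 2 = (s - 1) * Z"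
  proof -
    have "p * (1 / (a * G)) * (2 * a * (2 * a - 1) * (1 / p) * G * Z) / 2 = (2 * a - 1) * Z"
      if "p > 0" "G > 0" for p G :: real
      using that a by (simp add: field_simps)
    from this[of "pi powr a" "Gamma a"] show ?thesis
      using Gamma_real_pos[OF a] by (simp add: a_def powr_minus_divide)
  qed
  finally show ?thesis unfolding Z by simp
qed

text \<open>Both sides are holomorphic on Re s > 1 and agree on the real numbers above 1, which
  accumulate at 2.\<close>

lemma zeta_reg_eq_sum:
  assumes s: "Re s > 1"
  shows "zeta_reg s = (s - 1) * zeta_sum s"
proof -
  let ?S = "{s. 1 < Re s}"
  have "zeta_reg s - (s - 1) * zeta_sum s = 0"
  proof (rule analytic_continuation[of "\<lambda>s. zeta_reg s - (s - 1) * zeta_sum s" ?S "of_real ` {1<..}" 2])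
    show "(\<lambda>s. zeta_reg s - (s - 1) * zeta_sum s) holomorphic_on ?S"
      by (intro holomorphic_intros holomorphic_on_subset[OF zeta_reg_holomorphic] zeta_sum_holomorphic) auto
    show "open ?S" by (rule open_halfspace_Re_gt)
    show "connected ?S" by (intro convex_connected convex_halfspace_Re_gt)
    show "2 islimpt complex_of_real ` {1<..}"
      unfolding islimpt_sequential
    proof (intro exI[of _ "\<lambda>n. complex_of_real (2 + 1 / real (Suc n))"] conjI allI)
      have "(\<lambda>n. 2 + 1 / real (Suc n)) \<longlonglongrightarrow> 2" by real_asymp
      from tendsto_of_real[OF this, where 'a = complex]
      show "(\<lambda>n. complex_of_real (2 + 1 / real (Suc n))) \<longlonglongrightarrow> 2" by simp
      show "complex_of_real (2 + 1 / real (Suc n)) \<in> complex_of_real ` {1<..} - {2}" for n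
      proof -
        have "2 + 1 / real (Suc n) \<noteq> 2" "2 + 1 / real (Suc n) > 1" by (simp_all add: add_pos_pos)
        moreover have "complex_of_real x \<noteq> 2" if "x \<noteq> 2" for x
          using that of_real_eq_iff[of x 2, where 'a = complex] by simp
        ultimately show ?thesis by blast
      qed
    qed
  qed (use s zeta_reg_real in auto)
  thus ?thesis by simp
qed

text \<open>This settles the choice in the definition of \<open>zeta\<close>: the quotient has the
  defining property, and any two functions with it agree on Re s > 1, hence on the connected
  punctured plane.\<close>

lemma zeta_eq:
  assumes s: "s \<noteq> 1"
  shows "zeta s = zeta_reg s / (s - 1)"
proof -
  have eq: "(\<lambda>n. 1 / (of_nat (Suc n)) powr s) = (\<lambda>n. 1 * of_nat (Suc n) powr (- s))" for s :: complex
    by (simp add: powr_minus_divide del: of_nat_Suc)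
  have hol: "(\<lambda>s. zeta_reg s / (s - 1)) holomorphic_on - {1}"
    by (intro holomorphic_intros holomorphic_on_subset[OF zeta_reg_holomorphic]) auto
  have sums: "(\<lambda>n. 1 / (of_nat (Suc n)) powr s) sums (zeta_reg s / (s - 1))" if "1 < Re s" for s
    using dirichlet_series(1)[OF zeta_sum_summable that] that
    by (auto simp add: zeta_reg_eq_sum eq zeta_sum_def simp del: of_nat_Suc)
  have "\<exists>f. f holomorphic_on - {1} \<and> (\<forall>s. 1 < Re s \<longrightarrow> (\<lambda>n. 1 / (of_nat (Suc n)) powr s) sums f s)"
    using hol sums by blast
  from someI_ex[OF this]
  have z: "zeta holomorphic_on - {1} \<and> (\<forall>s. 1 < Re s \<longrightarrow> (\<lambda>n. 1 / (of_nat (Suc n)) powr s) sums zeta s)"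
    unfolding zeta_def[symmetric] .
  show ?thesis
  proof (rule analytic_continuation_open[of "{s. 1 < Re s}" "- {1}" zeta "\<lambda>s. zeta_reg s / (s - 1)"])
    show "open {s. 1 < Re s}" by (rule open_halfspace_Re_gt)
    show "connected (- {1::complex})" by (rule connected_punctured_universe) simp
    show "{s. 1 < Re s} \<noteq> {}" by (auto intro!: exI[of _ 2])
    show "zeta z = zeta_reg z / (z - 1)" if "z \<in> {s. 1 < Re s}" for z
      using z sums[of z] that sums_unique2 by blast
  qed (use s hol z in auto)
qed

text \<open>At s = 1 the factor s (s - 1) vanishes, so \<open>Xi\<close> is 1 there and only a value
  of the reciprocal Gamma function is left. The lemma also serves throughout as the witness that
  \<open>zeta_reg\<close> is not identically zero.\<close>

lemma zeta_reg_1: "zeta_reg 1 \<noteq> 0"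
proof -
  have "rGamma (complex_of_real (3 / 2)) \<noteq> 0"
    by (subst rGamma_complex_of_real) (simp add: rGamma_eq_zero_iff nonpos_Ints_def)
  thus ?thesis by (simp add: zeta_reg_def Xi_def)
qed

section \<open>Growth to the left of the critical strip\<close>

text \<open>Trapezoidal rule for \<open>(s - 1) \<integral> z powr - s\<close> over \<open>{n..n + 1}\<close>; the error terms
  continue \<open>(s - 1) \<zeta>(s)\<close> to \<open>Re s > -1\<close> with polynomial bounds.\<close>

definition trapez :: "nat \<Rightarrow> complex \<Rightarrow> complex" where
  "trapez n s = (s - 1) * (of_nat (Suc n) powr (- s) + of_nat (Suc (Suc n)) powr (- s)) / 2
      - (of_nat (Suc n) powr (1 - s) - of_nat (Suc (Suc n)) powr (1 - s))"

text \<open>With the right endpoint replaced by a variable z, the error becomes a function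
  \<open>U\<close> for which U and U' vanish at N. The second derivative carries the small factor z
  powr (- s - 2), and the mean value inequality, applied twice on a segment of length 1, transfers
  its bound to U.\<close>

lemma trapez_bound:
  assumes s: "Re s \<ge> -1"
  shows "norm (trapez n s) \<le> norm ((s - 1) * s * (s + 1)) * real (Suc n) powr (- Re s - 2)"
proof -
  define N where "N = complex_of_nat (Suc n)"
  define S where "S = closed_segment N (N + 1)"
  define M where "M = norm ((s - 1) * s * (s + 1)) * real (Suc n) powr (- Re s - 2)"
  define U where "U = (\<lambda>z. (s - 1) * (N powr (- s) + z powr (- s)) * (z - N) / 2 - (N powr (1 - s) - z powr (1 - s)))"
  define U' where "U' = (\<lambda>z. (s - 1) / 2 * (N powr (- s) - z powr (- s) - s * (z - N) * z powr (- s - 1)))"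
  define U'' where "U'' = (\<lambda>z. (s - 1) * s * (s + 1) / 2 * (z - N) * z powr (- s - 2))"
  have S: "\<exists>x. z = of_real x \<and> real (Suc n) \<le> x \<and> x \<le> real (Suc n) + 1" if zS: "z \<in> S" for z
  proof -
    obtain u where u: "z = (1 - u) *\<^sub>R N + u *\<^sub>R (N + 1)" "0 \<le> u" "u \<le> 1"
      using zS unfolding S_def in_segment by blast
    have "z = of_real (real (Suc n) + u)"
      using u(1) by (simp add: N_def scaleR_conv_of_real algebra_simps)
    thus ?thesis using u by (intro exI[of _ "real (Suc n) + u"]) auto
  qed
  have nr: "z \<notin> \<real>\<^sub>\<le>\<^sub>0" "z \<noteq> 0" if "z \<in> S" for z using S[OF that] by auto
  have d: "((\<lambda>z. z powr w) has_field_derivative w * z powr (w - 1)) (at z within S)" if "z \<in> S" for z w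
    using has_field_derivative_powr[OF nr(1)[OF that]] has_field_derivative_at_within by blast
  have pw: "z * z powr (w - 1) = z powr w" if "z \<in> S" for z w :: complex
    using nr(2)[OF that] by (simp add: powr_diff)
  have M0: "M \<ge> 0" by (simp add: M_def)
  have M'': "norm (U'' z) \<le> M" if zS: "z \<in> S" for z
  proof -
    obtain x where x: "z = of_real x" "real (Suc n) \<le> x" "x \<le> real (Suc n) + 1" using S[OF zS] by blast
    have "z - N = of_real (x - real (Suc n))" by (simp add: x(1) N_def)
    hence zN: "norm (z - N) \<le> 1" using x by (simp only: norm_of_real)
    have "norm (z powr (- s - 2)) = x powr (- Re s - 2)"
      unfolding x(1) using x(2) by (subst norm_powr_real_powr) auto
    also have "\<dots> \<le> real (Suc n) powr (- Re s - 2)" using x s by (intro powr_mono2') auto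
    finally have zp: "norm (z powr (- s - 2)) \<le> real (Suc n) powr (- Re s - 2)" .
    have "norm (U'' z) = norm ((s - 1) * s * (s + 1)) / 2 * norm (z - N) * norm (z powr (- s - 2))"
      by (simp add: U''_def norm_mult norm_divide)
    also have "\<dots> \<le> norm ((s - 1) * s * (s + 1)) * 1 * real (Suc n) powr (- Re s - 2)"
      using zN zp by (intro mult_mono) auto
    finally show ?thesis by (simp add: M_def)
  qed
  have dU': "(U' has_field_derivative U'' z) (at z within S)" if z: "z \<in> S" for z
  proof -
    have e: "- s - 1 - 1 = - s - 2" by simp
    have "(U' has_field_derivative (s - 1) / 2 * (0 - (- s) * z powr (- s - 1)
        - (s * (z - N) * ((- s - 1) * z powr (- s - 2)) + s * z powr (- s - 1)))) (at z within S)"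
      unfolding U'_def
      by (rule derivative_eq_intros d[OF z] refl | simp add: e)+
    thus ?thesis unfolding U''_def by (rule back_subst[of "\<lambda>x. (U' has_field_derivative x) (at z within S)"]) (simp add: field_simps)
  qed
  have dU: "(U has_field_derivative U' z) (at z within S)" if z: "z \<in> S" for z
  proof -
    have e: "1 - s - 1 = - s" by simp
    have "(U has_field_derivative (s - 1) * ((- s) * z powr (- s - 1)) * (z - N) / 2 + (s - 1) * (N powr (- s) + z powr (- s)) / 2
        + (1 - s) * z powr (- s)) (at z within S)"
      unfolding U_def
      by (rule derivative_eq_intros d[OF z] refl | simp add: e)+
    thus ?thesis unfolding U'_def by (rule back_subst[of "\<lambda>x. (U has_field_derivative x) (at z within S)"]) (simp add: field_simps)
  qed
  have cS: "convex S" and NS: "N \<in> S" "N + 1 \<in> S" by (auto simp: S_def)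
  have NzS: "norm (z - N) \<le> 1" if zS: "z \<in> S" for z
  proof -
    obtain x where x: "z = of_real x" "real (Suc n) \<le> x" "x \<le> real (Suc n) + 1" using S[OF zS] by blast
    have "z - N = of_real (x - real (Suc n))" by (simp add: x(1) N_def)
    thus ?thesis using x by (simp only: norm_of_real)
  qed
  have U'b: "norm (U' z) \<le> M" if z: "z \<in> S" for z
  proof -
    have "norm (U' z - U' N) \<le> M * norm (z - N)"
      by (rule field_differentiable_bound[OF cS dU' M'' z NS(1)])
    also have "\<dots> \<le> M * 1" using NzS[OF z] M0 by (intro mult_left_mono)
    also have "U' N = 0" by (simp add: U'_def)
    finally show ?thesis by simp
  qed
  have "norm (U (N + 1) - U N) \<le> M * norm (N + 1 - N)"
    by (rule field_differentiable_bound[OF cS dU U'b NS(2) NS(1)])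
  moreover have "U N = 0" by (simp add: U_def)
  moreover have "U (N + 1) = trapez n s"
    by (simp add: U_def trapez_def N_def add.commute)
  ultimately show ?thesis by (simp add: M_def)
qed

lemma trapez_partial_sum:
  "(\<Sum>n<N. trapez n s) = (s - 1) * ((\<Sum>n<N. of_nat (Suc n) powr (- s)) - 1 / 2 + of_nat (Suc N) powr (- s) / 2) - 1 + of_nat (Suc N) powr (1 - s)"
proof (induction N)
  case (Suc N)
  show ?case unfolding sum.lessThan_Suc[of _ N] Suc.IH
    by (simp add: trapez_def field_simps del: of_nat_Suc)
qed simp

lemma trapez_sums: "Re s > 1 \<Longrightarrow> (\<lambda>n. trapez n s) sums ((s - 1) * (zeta_sum s - 1 / 2) - 1)"
proof -
  assume s: "Re s > 1"
  have 1: "(\<lambda>N. \<Sum>n<N. of_nat (Suc n) powr (- s)) \<longlonglongrightarrow> zeta_sum s"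
    using dirichlet_series(1)[OF zeta_sum_summable s]
      by (simp add: sums_def zeta_sum_def del: of_nat_Suc)
  have lim: "(\<lambda>N. of_nat (Suc N) powr w) \<longlonglongrightarrow> 0" if "Re w < 0" for w :: complex
  proof (rule tendsto_norm_zero_cancel)
    have "(\<lambda>N. real (Suc N) powr Re w) \<longlonglongrightarrow> 0"
      by (rule tendsto_neg_powr[OF that]) (rule filterlim_compose[OF filterlim_real_sequentially filterlim_Suc])
    thus "(\<lambda>N. norm (of_nat (Suc N) powr w)) \<longlonglongrightarrow> 0" unfolding norm_of_nat_Suc_powr .
  qed
  have "(\<lambda>N. (s - 1) * ((\<Sum>n<N. of_nat (Suc n) powr (- s)) - 1 / 2 + of_nat (Suc N) powr (- s) / 2) - 1 + of_nat (Suc N) powr (1 - s))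
     \<longlonglongrightarrow> (s - 1) * (zeta_sum s - 1 / 2 + 0 / 2) - 1 + 0"
    by (intro tendsto_intros 1 lim) (use s in auto)
  thus "(\<lambda>n. trapez n s) sums ((s - 1) * (zeta_sum s - 1 / 2) - 1)"
    unfolding sums_def trapez_partial_sum by simp
qed

text \<open>The error terms are of order n^(- Re s - 2), so their sum is holomorphic on Re s > -1
  and continues the identity from Re s > 1.\<close>

lemma zeta_reg_eq_trapez:
  assumes s: "Re s > -1"
  shows "zeta_reg s = 1 + (s - 1) / 2 + (\<Sum>n. trapez n s)"
proof -
  let ?S = "{s. -1 < Re s}"
  have S: "open ?S" by (rule open_halfspace_Re_gt)
  have hol: "(\<lambda>s. \<Sum>n. trapez n s) holomorphic_on ?S"
  proof (rule holomorphic_uniform_sequence[OF S, where f = "\<lambda>N s. \<Sum>n<N. trapez n s"])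
    show "(\<lambda>s. \<Sum>n<N. trapez n s) holomorphic_on ?S" for N
      unfolding trapez_def by (intro holomorphic_intros) (auto simp del: of_nat_Suc)
    fix x assume x: "x \<in> ?S"
    define d where "d = (Re x + 1) / 2"
    have d: "d > 0" using x by (simp add: d_def)
    have Re: "Re s \<ge> Re x - d" if "s \<in> cball x d" for s
    proof -
      have "\<bar>Re (x - s)\<bar> \<le> d" using that abs_Re_le_cmod[of "x - s"] by (simp add: dist_norm)
      thus ?thesis by simp
    qed
    have 1: "Re x - d > -1" using x by (simp add: d_def field_simps)
    define K where "K = (norm x + d + 1) ^ 3"
    have "uniform_limit (cball x d) (\<lambda>N s. \<Sum>n<N. trapez n s) (\<lambda>s. \<Sum>n. trapez n s) sequentially"
    proof (rule Weierstrass_m_test)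
      show "summable (\<lambda>n. K * real (Suc n) powr (- (Re x - d + 2)))"
        using 1 by (intro summable_mult summable_Suc_powr) auto
      fix n s assume s: "s \<in> cball x d"
      have ns: "norm s \<le> norm x + d"
        using s norm_triangle_ineq2[of s x] by (simp add: dist_norm norm_minus_commute)
      have "norm (trapez n s) \<le> norm ((s - 1) * s * (s + 1)) * real (Suc n) powr (- Re s - 2)"
        by (rule trapez_bound) (use Re[OF s] 1 in auto)
      also have "\<dots> \<le> K * real (Suc n) powr (- (Re x - d + 2))"
      proof (intro mult_mono powr_mono)
        have "norm ((s - 1) * s * (s + 1)) \<le> (norm x + d + 1) * (norm x + d + 1) * (norm x + d + 1)"
          unfolding norm_mult using ns norm_triangle_ineq4[of s 1] norm_triangle_ineq[of s 1] d
          by (intro mult_mono) auto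
        thus "norm ((s - 1) * s * (s + 1)) \<le> K" by (simp add: K_def power3_eq_cube)
      qed (use Re[OF s] d in \<open>auto simp: K_def\<close>)
      finally show "norm (trapez n s) \<le> K * real (Suc n) powr (- (Re x - d + 2))" .
    qed
    moreover have "cball x d \<subseteq> ?S" using Re 1 by force
    ultimately show "\<exists>d>0. cball x d \<subseteq> ?S \<and> uniform_limit (cball x d) (\<lambda>N s. \<Sum>n<N. trapez n s) (\<lambda>s. \<Sum>n. trapez n s) sequentially"
      using d by blast
  qed
  show ?thesis
  proof (rule analytic_continuation_open[of "{s. 1 < Re s}" ?S zeta_reg "\<lambda>s. 1 + (s - 1) / 2 + (\<Sum>n. trapez n s)"])
    show "open {s. 1 < Re s}" by (rule open_halfspace_Re_gt)
    show "connected ?S" by (intro convex_connected convex_halfspace_Re_gt)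
    show "{s. 1 < Re s} \<noteq> {}" by (auto intro!: exI[of _ 2])
    show "zeta_reg z = 1 + (z - 1) / 2 + (\<Sum>n. trapez n z)" if "z \<in> {s. 1 < Re s}" for z
      using trapez_sums[of z] that by (auto simp: sums_iff zeta_reg_eq_sum field_simps)
    show "(\<lambda>s. 1 + (s - 1) / 2 + (\<Sum>n. trapez n s)) holomorphic_on ?S"
      by (intro holomorphic_intros hol) auto
  qed (use s S in \<open>auto intro: holomorphic_on_subset[OF zeta_reg_holomorphic]\<close>)
qed

text \<open>The cube stems from the factors (s - 1) s (s + 1) in \<open>trapez_bound\<close>. The
  abscissa -9/10 is the leftmost point of the discs of radius 29/10 around 2 + i t used for counting
  zeros, and it leaves the convergent exponent -11/10 in the sum over n.\<close>

lemma zeta_reg_growth: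
  obtains C where "C > 0" "\<And>s. Re s \<ge> -9/10 \<Longrightarrow> norm (zeta_reg s) \<le> C * (norm s + 1) ^ 3"
proof
  define K where "K = (\<Sum>n. real (Suc n) powr (- 11/10))"
  have sK: "summable (\<lambda>n. real (Suc n) powr (- 11/10))" using summable_Suc_powr[of "11/10"] by simp
  have K: "K \<ge> 0" unfolding K_def by (intro suminf_nonneg sK) auto
  show "K + 2 > 0" using K by simp
  fix s :: complex assume s: "Re s \<ge> -9/10"
  have b: "norm (trapez n s) \<le> (norm s + 1) ^ 3 * real (Suc n) powr (- 11/10)" for n
  proof -
    have "norm (trapez n s) \<le> norm ((s - 1) * s * (s + 1)) * real (Suc n) powr (- Re s - 2)"
      by (rule trapez_bound) (use s in auto)
    also have "\<dots> \<le> (norm s + 1) ^ 3 * real (Suc n) powr (- 11/10)"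
    proof (intro mult_mono powr_mono)
      have "norm ((s - 1) * s * (s + 1)) \<le> (norm s + 1) * (norm s + 1) * (norm s + 1)"
        unfolding norm_mult using norm_triangle_ineq4[of s 1] norm_triangle_ineq[of s 1]
        by (intro mult_mono) auto
      thus "norm ((s - 1) * s * (s + 1)) \<le> (norm s + 1) ^ 3" by (simp add: power3_eq_cube)
    qed (use s in auto)
    finally show ?thesis .
  qed
  have "norm (\<Sum>n. trapez n s) \<le> (\<Sum>n. (norm s + 1) ^ 3 * real (Suc n) powr (- 11/10))"
    by (intro norm_suminf_le b summable_mult sK)
  also have "\<dots> = (norm s + 1) ^ 3 * K" unfolding K_def by (intro suminf_mult sK)
  finally have S: "norm (\<Sum>n. trapez n s) \<le> (norm s + 1) ^ 3 * K" .
  have eq: "zeta_reg s = (s + 1) / 2 + (\<Sum>n. trapez n s)"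
    by (subst zeta_reg_eq_trapez) (use s in \<open>auto simp: field_simps\<close>)
  have b1: "norm ((s + 1) / 2) \<le> norm s + 1"
    by (simp add: norm_divide) (smt (verit) norm_ge_zero norm_one norm_triangle_ineq)
  have b2: "norm s + 1 \<le> (norm s + 1) ^ 3" using self_le_power[of "norm s + 1" 3] by simp
  have "norm (zeta_reg s) \<le> (norm s + 1) ^ 3 + (norm s + 1) ^ 3 * K"
    unfolding eq by (rule order_trans[OF norm_triangle_ineq add_mono[OF order_trans[OF b1 b2] S]])
  hence "norm (zeta_reg s) \<le> (norm s + 1) ^ 3 * (1 + K)" by (simp only: ring_distribs mult_1_right)
  also have "\<dots> \<le> (norm s + 1) ^ 3 * (K + 2)" by (intro mult_left_mono) auto
  finally show "norm (zeta_reg s) \<le> (K + 2) * (norm s + 1) ^ 3" by (simp add: mult.commute)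
qed

section \<open>Zeros of the zeta function\<close>

lemma summable_ln_Suc_powr:
  assumes s: "s > (1::real)"
  shows "summable (\<lambda>n. ln (real (Suc n)) * real (Suc n) powr (- s))"
proof (rule summable_comparison_test')
  define e where "e = (s - 1) / 2"
  have e: "e > 0" using s by (simp add: e_def)
  show "summable (\<lambda>n. (1 / e) * real (Suc n) powr (- (s - e)))"
    using s by (intro summable_mult summable_Suc_powr) (simp add: e_def field_simps)
  fix n
  have "ln (real (Suc n)) * real (Suc n) powr (- s) \<le> (real (Suc n) powr e / e) * real (Suc n) powr (- s)"
    using ln_powr_bound[of "real (Suc n)" e] e by (intro mult_right_mono) auto
  also have "\<dots> = (1 / e) * (real (Suc n) powr e * real (Suc n) powr (- s))" by simp
  also have "real (Suc n) powr e * real (Suc n) powr (- s) = real (Suc n) powr (- (s - e))"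
    unfolding powr_add[symmetric] by simp
  finally show "norm (ln (real (Suc n)) * real (Suc n) powr (- s)) \<le> (1 / e) * real (Suc n) powr (- (s - e))"
    by simp
qed

lemma mangoldt_summable:
  assumes s: "s > (1::real)"
  shows "summable (\<lambda>n. norm (mangoldt (Suc n) :: complex) * real (Suc n) powr (- s))"
proof (rule summable_comparison_test'[OF summable_ln_Suc_powr[OF s]])
  fix n
  have "mangoldt (Suc n) * real (Suc n) powr (- s) \<le> ln (real (Suc n)) * real (Suc n) powr (- s)"
    using mangoldt_le[of "Suc n"] by (intro mult_right_mono) auto
  thus "norm (norm (mangoldt (Suc n) :: complex) * real (Suc n) powr (- s)) \<le> ln (real (Suc n)) * real (Suc n) powr (- s)"
    using mangoldt_nonneg[of "Suc n"] by (simp add: norm_mangoldt abs_mult del: of_nat_Suc)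
qed

text \<open>This is -zeta'/zeta on Re s > 1, given as a Dirichlet series so that it is available
  before zeta is known to be nonzero there.\<close>

definition mangoldt_series :: "complex \<Rightarrow> complex" where
  "mangoldt_series s = (\<Sum>n. mangoldt (Suc n) * of_nat (Suc n) powr (- s))"

lemma mangoldt_series_sums:
  "Re s > 1 \<Longrightarrow> (\<lambda>n. mangoldt (Suc n) * of_nat (Suc n) powr (- s)) sums mangoldt_series s"
  unfolding mangoldt_series_def by (rule dirichlet_series(1)[OF mangoldt_summable])

lemma mangoldt_series_holomorphic: "mangoldt_series holomorphic_on {s. 1 < Re s}"
  unfolding mangoldt_series_def[abs_def] by (rule dirichlet_series(2)[OF mangoldt_summable])

text \<open>Summing \<open>\<Lambda>(d) (d k) powr - s\<close> over all pairs \<open>(d, k)\<close>, once as a product and once along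
  the fibres of \<open>n = d k\<close>, where \<open>\<Sum>d dvd n. \<Lambda>(d) = ln n\<close>.\<close>

lemma zeta_sum_times_mangoldt:
  assumes s: "Re s > 1"
  shows "zeta_sum s * mangoldt_series s = - deriv zeta_sum s"
proof -
  define A where "A = (\<lambda>d. mangoldt d * of_nat d powr (- s) :: complex)"
  define B where "B = (\<lambda>k. of_nat k powr (- s) :: complex)"
  define P where "P = {n::nat. n > 0}"
  have bij: "bij_betw Suc UNIV P" unfolding P_def
    by (rule bij_betwI[of _ _ _ "\<lambda>n. n - 1"]) auto
  have nA: "norm (A (Suc n)) = norm (mangoldt (Suc n) :: complex) * real (Suc n) powr (- Re s)" for n
    unfolding A_def norm_mult norm_of_nat_Suc_powr by simp
  have nB: "norm (B (Suc n)) = norm (1::complex) * real (Suc n) powr (- Re s)" for n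
    unfolding B_def norm_of_nat_Suc_powr by simp
  have sA: "summable (\<lambda>n. norm (A (Suc n)))" unfolding nA by (rule mangoldt_summable[OF s])
  have sB: "summable (\<lambda>n. norm (B (Suc n)))" unfolding nB by (rule zeta_sum_summable[OF s])
  have hA: "(A has_sum mangoldt_series s) P"
    using norm_summable_imp_has_sum[OF sA, of "mangoldt_series s"] mangoldt_series_sums[OF s]
    by (subst has_sum_reindex_bij_betw[OF bij, symmetric]) (auto simp: A_def)
  have hB: "(B has_sum zeta_sum s) P"
    using norm_summable_imp_has_sum[OF sB, of "zeta_sum s"] dirichlet_series(1)[OF zeta_sum_summable s]
    by (subst has_sum_reindex_bij_betw[OF bij, symmetric]) (auto simp: B_def zeta_sum_def simp del: of_nat_Suc)
  have aA: "(\<lambda>x. norm (A x)) summable_on P"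
    using norm_summable_imp_summable_on[of "\<lambda>n. norm (A (Suc n))"] sA
    by (subst summable_on_reindex_bij_betw[OF bij, symmetric]) auto
  have aB: "(\<lambda>x. norm (B x)) summable_on P"
    using norm_summable_imp_summable_on[of "\<lambda>n. norm (B (Suc n))"] sB
    by (subst summable_on_reindex_bij_betw[OF bij, symmetric]) auto
  \<comment> \<open>Absolute summability over all pairs is what permits summing along the fibres of
    the product d k instead.\<close>
  have abs: "(\<lambda>x. norm ((\<lambda>(d, k). A d * B k) x)) summable_on P \<times> P"
    unfolding Infinite_Sum.abs_summable_on_Sigma_iff
  proof (intro conjI ballI)
    fix d
    show "(\<lambda>k. norm (case (d, k) of (d, k) \<Rightarrow> A d * B k)) summable_on P"
      using aB by (simp add: norm_mult summable_on_cmult_right)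
    have "(\<lambda>d. infsum (\<lambda>k. norm (A d * B k)) P) = (\<lambda>d. norm (A d) * infsum (\<lambda>k. norm (B k)) P)"
      by (simp add: norm_mult infsum_cmult_right')
    thus "(\<lambda>d. norm (infsum (\<lambda>k. norm (case (d, k) of (d, k) \<Rightarrow> A d * B k)) P)) summable_on P"
      using summable_on_cmult_left[OF aA, of "infsum (\<lambda>k. norm (B k)) P"]
      by (simp add: infsum_nonneg abs_mult)
  qed
  have "((\<lambda>(d, k). A d * B k) has_sum (mangoldt_series s * zeta_sum s)) (P \<times> P)"
  proof (rule has_sum_SigmaI)
    show "((\<lambda>k. case (d, k) of (d, k) \<Rightarrow> A d * B k) has_sum A d * zeta_sum s) P" for d
      using has_sum_cmult_right[OF hB] by simp
    show "((\<lambda>d. A d * zeta_sum s) has_sum mangoldt_series s * zeta_sum s) P"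
      by (rule has_sum_cmult_left[OF hA])
    show "(\<lambda>(d, k). A d * B k) summable_on P \<times> P" using abs by (rule abs_summable_summable)
  qed
  also have "?this \<longleftrightarrow> ((\<lambda>x. (\<lambda>(n, d). A d * B (n div d)) ((\<lambda>(d, k). (d * k, d)) x)) has_sum (mangoldt_series s * zeta_sum s)) (P \<times> P)"
    by (intro has_sum_cong) (auto simp: P_def)
  also have "\<dots> \<longleftrightarrow> ((\<lambda>(n, d). A d * B (n div d)) has_sum (mangoldt_series s * zeta_sum s)) (Sigma P (\<lambda>n. {d. d dvd n}))"
  proof (rule has_sum_reindex_bij_betw)
    show "bij_betw (\<lambda>(d, k). (d * k, d)) (P \<times> P) (Sigma P (\<lambda>n. {d. d dvd n}))"
      by (rule bij_betwI[of _ _ _ "\<lambda>(n, d). (d, n div d)"])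
         (auto simp: P_def dvd_pos_nat dvd_div_eq_0_iff intro!: Nat.gr0I)
  qed
  finally have hS: "((\<lambda>(n, d). A d * B (n div d)) has_sum (mangoldt_series s * zeta_sum s)) (Sigma P (\<lambda>n. {d. d dvd n}))" .
  have "((\<lambda>n. of_real (ln (real n)) * B n) has_sum (mangoldt_series s * zeta_sum s)) P"
  proof (rule has_sum_SigmaD[OF hS])
    fix n assume n: "n \<in> P"
    have "(\<Sum>d | d dvd n. A d * B (n div d)) = (\<Sum>d | d dvd n. mangoldt d * B n)"
    proof (rule sum.cong[OF refl])
      fix d assume "d \<in> {d. d dvd n}"
      hence "n = d * (n div d)" by simp
      hence "B n = of_nat d powr (- s) * B (n div d)"
        unfolding B_def by (metis of_nat_mult powr_times_real Reals_of_nat of_nat_0_le_iff complex_Re_of_nat)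
      thus "A d * B (n div d) = mangoldt d * B n" by (simp add: A_def)
    qed
    also have "\<dots> = of_real (ln (real n)) * B n"
      using n mangoldt_sum[of n, where ?'a = complex] by (simp add: sum_distrib_right[symmetric] P_def)
    finally show "((\<lambda>d. case (n, d) of (n, d) \<Rightarrow> A d * B (n div d)) has_sum of_real (ln (real n)) * B n) {d. d dvd n}"
      using n by (intro has_sum_finiteI) (auto simp: P_def)
  qed
  hence "((\<lambda>n. of_real (ln (real (Suc n))) * B (Suc n)) has_sum (mangoldt_series s * zeta_sum s)) UNIV"
    by (subst has_sum_reindex_bij_betw[OF bij])
  hence "(\<lambda>n. - (of_real (ln (real (Suc n))) * B (Suc n))) sums - (mangoldt_series s * zeta_sum s)"
    by (intro sums_minus has_sum_imp_sums)
  moreover have "(\<lambda>n. - (of_real (ln (real (Suc n))) * B (Suc n))) sums deriv zeta_sum s"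
    using dirichlet_series(3)[OF zeta_sum_summable s]
    by (simp add: B_def zeta_sum_def[abs_def] del: of_nat_Suc)
  ultimately show ?thesis using sums_unique2 by (metis minus_minus mult.commute)
qed

lemma zeta_sum_2: "zeta_sum 2 = of_real (pi\<^sup>2 / 6)"
proof -
  have "1 * of_nat (Suc n) powr (- 2) = complex_of_real (1 / (real n + 1)\<^sup>2)" for n
  proof -
    have "complex_of_nat (Suc n) powr (- 2) = inverse (of_nat (Suc n) powr (of_nat 2))"
      by (simp only: powr_minus of_nat_numeral)
    also have "\<dots> = inverse (of_nat (Suc n) ^ 2)" by (subst powr_nat) auto
    finally show ?thesis by (simp add: inverse_eq_divide add.commute)
  qed
  moreover have "(\<lambda>n. complex_of_real (1 / (real n + 1)\<^sup>2)) sums of_real (pi\<^sup>2 / 6)"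
    using sums_of_real[OF inverse_squares_sums, where 'a = complex] by (simp add: add.commute)
  ultimately show ?thesis by (simp only: zeta_sum_def sums_iff)
qed

section \<open>Non-vanishing on Re s >= 1\<close>

text \<open>Let g be a primitive of \<open>mangoldt_series\<close>. By
  \<open>zeta_sum_times_mangoldt\<close> the derivative of zeta times exp g is 0, so this product is
  constant; a single zero would make zeta vanish on the whole half-plane, contrary to its value at
  2.\<close>

lemma zeta_sum_nonzero:
  assumes s: "Re s > 1"
  shows "zeta_sum s \<noteq> 0"
proof
  let ?S = "{s. 1 < Re s}"
  assume 0: "zeta_sum s = 0"
  have S: "open ?S" "convex ?S" by (simp_all add: open_halfspace_Re_gt convex_halfspace_Re_gt)
  obtain g where g: "\<And>x. x \<in> ?S \<Longrightarrow> (g has_field_derivative mangoldt_series x) (at x within ?S)"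
    using holomorphic_convex_primitive'[OF S(2,1) mangoldt_series_holomorphic] by blast
  have D: "((\<lambda>x. zeta_sum x * exp (g x)) has_field_derivative 0) (at x within ?S)" if x: "x \<in> ?S" for x
  proof -
    have "(zeta_sum has_field_derivative deriv zeta_sum x) (at x within ?S)"
      using holomorphic_derivI[OF zeta_sum_holomorphic S(1) x] by (rule has_field_derivative_at_within)
    from DERIV_mult[OF this DERIV_chain2[OF DERIV_exp g[OF x]]]
    have "((\<lambda>x. zeta_sum x * exp (g x)) has_field_derivative
        exp (g x) * (deriv zeta_sum x + zeta_sum x * mangoldt_series x)) (at x within ?S)"
      by (simp add: algebra_simps)
    thus ?thesis using zeta_sum_times_mangoldt[of x] x by simp
  qed
  from has_field_derivative_zero_constant[OF S(2) D]
  obtain c where c: "\<forall>x\<in>?S. zeta_sum x * exp (g x) = c" by blast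
  from bspec[OF c, of s] s 0 have "c = 0" by simp
  with bspec[OF c, of 2] show False by (simp add: zeta_sum_2)
qed

lemma zeta_reg_nonzero_gt_1: "Re s > 1 \<Longrightarrow> zeta_reg s \<noteq> 0"
  using zeta_sum_nonzero[of s] by (auto simp: zeta_reg_eq_sum)

lemma zeta_reg_log_deriv:
  assumes s: "Re s > 1"
  shows "deriv zeta_reg s / zeta_reg s = 1 / (s - 1) - mangoldt_series s"
proof -
  let ?S = "{s. 1 < Re s}"
  have S: "open ?S" by (simp add: open_halfspace_Re_gt)
  have s1: "s \<noteq> 1" using s by auto
  have "(zeta_sum has_field_derivative deriv zeta_sum s) (at s)"
    using s by (intro holomorphic_derivI[OF zeta_sum_holomorphic S]) auto
  hence "((\<lambda>s. (s - 1) * zeta_sum s) has_field_derivative zeta_sum s + (s - 1) * deriv zeta_sum s) (at s)"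
    by (auto intro!: derivative_eq_intros)
  hence "(zeta_reg has_field_derivative zeta_sum s + (s - 1) * deriv zeta_sum s) (at s)"
    by (rule has_field_derivative_transform_within_open[OF _ S]) (use s in \<open>auto simp: zeta_reg_eq_sum\<close>)
  hence "deriv zeta_reg s = zeta_sum s - (s - 1) * (zeta_sum s * mangoldt_series s)"
    using zeta_sum_times_mangoldt[OF s] by (simp add: DERIV_imp_deriv)
  moreover have "Z - d * (Z * m) = (d * Z) * (1 / d - m)" if "d \<noteq> 0" for Z d m :: complex
    using that by (simp add: field_simps)
  ultimately have "deriv zeta_reg s = zeta_reg s * (1 / (s - 1) - mangoldt_series s)"
    using s1 by (simp add: zeta_reg_eq_sum[OF s])
  thus ?thesis using s1 zeta_sum_nonzero[OF s] by (simp add: zeta_reg_eq_sum[OF s])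
qed

text \<open>Writing h = g (z - \<rho>)^m with g \<rho> nonzero gives h'/h = g'/g + m / (z - \<rho>),
  and only the second part survives multiplication by e. The case m = 0, where \<rho> is not a zero,
  is included.\<close>

lemma log_deriv_near_zero:
  assumes hol: "h holomorphic_on UNIV" and nz: "h w \<noteq> 0"
  shows "((\<lambda>e. of_real e * (deriv h (\<rho> + of_real e) / h (\<rho> + of_real e))) \<longlongrightarrow> of_nat (zmult h \<rho>)) (at_right 0)"
proof -
  obtain g where g: "g holomorphic_on UNIV" "\<And>z. h z = g z * (z - \<rho>) ^ zmult h \<rho>" "g \<rho> \<noteq> 0"
    using entire_divide_zero[OF hol nz] by metis
  define m where "m = zmult h \<rho>"
  have contg: "isCont g \<rho>"
    using g(1) by (simp add: holomorphic_on_imp_differentiable_at field_differentiable_imp_continuous_at)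
  have contdg: "isCont (deriv g) \<rho>"
    using holomorphic_deriv[OF g(1)]
      by (simp add: holomorphic_on_imp_differentiable_at field_differentiable_imp_continuous_at)
  have lim: "((\<lambda>e. \<rho> + of_real e) \<longlongrightarrow> \<rho>) (at_right (0::real))"
    by (auto intro!: tendsto_eq_intros)
  have gl: "((\<lambda>e. g (\<rho> + of_real e)) \<longlongrightarrow> g \<rho>) (at_right (0::real))"
    by (rule isCont_tendsto_compose[OF contg lim])
  have dgl: "((\<lambda>e. deriv g (\<rho> + of_real e)) \<longlongrightarrow> deriv g \<rho>) (at_right (0::real))"
    by (rule isCont_tendsto_compose[OF contdg lim])
  have "eventually (\<lambda>e. g (\<rho> + of_real e) \<noteq> 0) (at_right (0::real))"
    using tendsto_imp_eventually_ne[OF gl g(3)] .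
  moreover have "eventually (\<lambda>e::real. e > 0) (at_right 0)" by (rule eventually_at_right_less)
  ultimately have ev: "eventually (\<lambda>e. of_nat m + of_real e * (deriv g (\<rho> + of_real e) / g (\<rho> + of_real e))
      = of_real e * (deriv h (\<rho> + of_real e) / h (\<rho> + of_real e))) (at_right (0::real))"
  proof eventually_elim
    case (elim e)
    define z where "z = \<rho> + of_real e"
    have z: "z - \<rho> = of_real e" "z - \<rho> \<noteq> 0" and gz: "g z \<noteq> 0" using elim by (auto simp: z_def)
    have dg: "(g has_field_derivative deriv g z) (at z)"
      using g(1) by (intro holomorphic_derivI[of _ UNIV]) auto
    have "((\<lambda>z. (z - \<rho>) ^ m) has_field_derivative of_nat m * (1 * (z - \<rho>) ^ (m - Suc 0))) (at z)"
      by (rule DERIV_power) (auto intro!: derivative_eq_intros)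
    also have "of_nat m * (1 * (z - \<rho>) ^ (m - Suc 0)) = (z - \<rho>) ^ m * (of_nat m / (z - \<rho>))"
      using z(2) by (cases m) auto
    finally have "((\<lambda>z. (z - \<rho>) ^ m) has_field_derivative (z - \<rho>) ^ m * (of_nat m / (z - \<rho>))) (at z)" .
    from has_field_derivative_mult_log_deriv[OF dg this gz]
    have "(h has_field_derivative h z * (deriv g z / g z + of_nat m / (z - \<rho>))) (at z)"
      using g(2) unfolding m_def by (metis (no_types, lifting) ext)
    moreover have "h z \<noteq> 0" using g(2)[of z] gz z(2) by simp
    ultimately have "deriv h z / h z = deriv g z / g z + of_nat m / (z - \<rho>)"
      by (simp add: DERIV_imp_deriv)
    thus ?case using elim unfolding z_def[symmetric] z(1) by (simp add: distrib_left)
  qed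
  have "((\<lambda>e. of_nat m + of_real e * (deriv g (\<rho> + of_real e) / g (\<rho> + of_real e))) \<longlongrightarrow> of_nat m + of_real 0 * (deriv g \<rho> / g \<rho>)) (at_right (0::real))"
    by (intro tendsto_intros gl dgl g(3))
  hence "((\<lambda>e. of_real e * (deriv h (\<rho> + of_real e) / h (\<rho> + of_real e))) \<longlongrightarrow> of_nat m + of_real 0 * (deriv g \<rho> / g \<rho>)) (at_right (0::real))"
    by (rule Lim_transform_eventually[OF _ ev])
  thus ?thesis by (simp add: m_def)
qed

lemma zmult_pos:
  assumes hol: "h holomorphic_on UNIV" and nz: "h w \<noteq> 0" and 0: "h \<rho> = 0"
  shows "zmult h \<rho> > 0"
proof (rule ccontr)
  obtain g where g: "\<And>z. h z = g z * (z - \<rho>) ^ zmult h \<rho>" "g \<rho> \<noteq> 0"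
    using entire_divide_zero[OF hol nz] by metis
  assume "\<not> zmult h \<rho> > 0"
  with g(1)[of \<rho>] g(2) 0 show False by simp
qed

text \<open>Termwise positivity from 3 + 4 cos y + cos (2 y) = 2 (1 + cos y)^2.\<close>

lemma mangoldt_series_341:
  assumes e: "\<sigma> > 1"
  shows "3 * Re (mangoldt_series (of_real \<sigma>)) + 4 * Re (mangoldt_series (Complex \<sigma> t)) + Re (mangoldt_series (Complex \<sigma> (2 * t))) \<ge> 0"
proof -
  have s: "(\<lambda>n. mangoldt (Suc n) * (real (Suc n) powr (- \<sigma>) * cos (y * ln (real (Suc n))))) sums Re (mangoldt_series (Complex \<sigma> y))" for y
  proof -
    have e1: "(\<lambda>n. Re (mangoldt (Suc n) * of_nat (Suc n) powr (- Complex \<sigma> y))) sums Re (mangoldt_series (Complex \<sigma> y))"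
      by (intro sums_Re mangoldt_series_sums) (use e in simp)
    have e2: "Re (mangoldt (Suc n) * of_nat (Suc n) powr (- Complex \<sigma> y)) = mangoldt (Suc n) * (real (Suc n) powr (- \<sigma>) * cos (y * ln (real (Suc n))))" for n
    proof -
      have L: "Ln (of_nat (Suc n)) = complex_of_real (ln (real (Suc n)))"
        by (metis Ln_of_real of_nat_0_less_iff of_real_of_nat_eq zero_less_Suc)
      have "Re (of_nat (Suc n) powr (- Complex \<sigma> y)) = exp (- \<sigma> * ln (real (Suc n))) * cos (y * ln (real (Suc n)))"
        unfolding powr_def L by (simp add: Re_exp del: of_nat_Suc)
      also have "exp (- \<sigma> * ln (real (Suc n))) = real (Suc n) powr (- \<sigma>)" by (simp add: powr_def)
      finally have "Re (of_nat (Suc n) powr (- Complex \<sigma> y)) = real (Suc n) powr (- \<sigma>) * cos (y * ln (real (Suc n)))" .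
      moreover have "Re (mangoldt (Suc n) * w) = mangoldt (Suc n) * Re w" for w
      proof -
        have "Re (complex_of_real (mangoldt (Suc n)) * w) = mangoldt (Suc n) * Re w"
          by (simp del: of_real_mangoldt)
        thus ?thesis by simp
      qed
      ultimately show ?thesis by simp
    qed
    show ?thesis using e1 unfolding e2 .
  qed
  have c0: "complex_of_real \<sigma> = Complex \<sigma> 0" by (simp add: complex_eq_iff)
  have S1: "(\<lambda>n. 3 * (mangoldt (Suc n) * (real (Suc n) powr (- \<sigma>) * cos (0 * ln (real (Suc n)))))
     + 4 * (mangoldt (Suc n) * (real (Suc n) powr (- \<sigma>) * cos (t * ln (real (Suc n)))))
     + mangoldt (Suc n) * (real (Suc n) powr (- \<sigma>) * cos ((2 * t) * ln (real (Suc n)))))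
     sums (3 * Re (mangoldt_series (Complex \<sigma> 0)) + 4 * Re (mangoldt_series (Complex \<sigma> t)) + Re (mangoldt_series (Complex \<sigma> (2 * t))))"
    by (intro sums_add sums_mult s)
  have N1: "0 \<le> 3 * (mangoldt (Suc n) * (real (Suc n) powr (- \<sigma>) * cos (0 * ln (real (Suc n)))))
     + 4 * (mangoldt (Suc n) * (real (Suc n) powr (- \<sigma>) * cos (t * ln (real (Suc n)))))
     + mangoldt (Suc n) * (real (Suc n) powr (- \<sigma>) * cos ((2 * t) * ln (real (Suc n))))" for n
  proof -
    define c where "c = cos (t * ln (real (Suc n)))"
    have "cos ((2 * t) * ln (real (Suc n))) = 2 * c\<^sup>2 - 1"
      unfolding c_def using cos_double_cos[of "t * ln (real (Suc n))"] by (simp only: mult.assoc)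
    moreover have "3 * (x * (y * 1)) + 4 * (x * (y * c)) + x * (y * (2 * c\<^sup>2 - 1)) = x * y * (2 * (1 + c)\<^sup>2)" for x y :: real
      by (simp add: power2_eq_square algebra_simps)
    ultimately show ?thesis unfolding c_def[symmetric] using mangoldt_nonneg[of "Suc n"] by simp
  qed
  show ?thesis unfolding c0 by (rule sums_le[OF N1 sums_zero S1])
qed

text \<open>Multiplying the 3-4-1 inequality at abscissa 1 + e by e and letting e tend to 0 gives 3
  (1 - m 0) - 4 m t - m (2 t) >= 0 for the multiplicities, where the 1 stems from the pole of zeta.
  A zero would have m t >= 1, which is impossible.\<close>

lemma zeta_reg_nonzero_1_line:
  "zeta_reg (Complex 1 t) \<noteq> 0"
proof (cases "t = 0")
  case True
  have "Complex 1 0 = 1" by (simp add: complex_eq_iff)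
  thus ?thesis using True zeta_reg_1 by simp
next
  case t: False
  show ?thesis
  proof
    assume zero: "zeta_reg (Complex 1 t) = 0"
    define m where "m = (\<lambda>y. zmult zeta_reg (Complex 1 y))"
    have lim: "((\<lambda>e. e * Re (mangoldt_series (Complex (1 + e) y))) \<longlongrightarrow> (if y = 0 then 1 else 0) - real (m y)) (at_right 0)" for y
    proof -
      have c: "Complex 1 y + of_real e = Complex (1 + e) y" for e by (simp add: complex_eq_iff)
      have "((\<lambda>e. Re (of_real e * (deriv zeta_reg (Complex 1 y + of_real e) / zeta_reg (Complex 1 y + of_real e)))) \<longlongrightarrow> Re (of_nat (m y))) (at_right 0)"
        unfolding m_def by (intro tendsto_Re log_deriv_near_zero[OF zeta_reg_holomorphic zeta_reg_1])
      hence 1: "((\<lambda>e. Re (of_real e * (deriv zeta_reg (Complex (1 + e) y) / zeta_reg (Complex (1 + e) y)))) \<longlongrightarrow> real (m y)) (at_right 0)"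
        unfolding c by simp
      have 2: "((\<lambda>e. Re (of_real e / Complex e y)) \<longlongrightarrow> (if y = 0 then 1 else 0)) (at_right 0)"
      proof (cases "y = 0")
        case True
        have "eventually (\<lambda>e. Re (of_real e / Complex e y) = 1) (at_right (0::real))"
          using eventually_at_right_less[of "0::real"]
        proof eventually_elim
          case (elim e)
          have "Complex e y = of_real e" using True by (simp add: complex_eq_iff)
          thus ?case using elim by simp
        qed
        thus ?thesis using True by (simp add: tendsto_eventually)
      next
        case False
        have C: "Complex e y = of_real e + \<i> * of_real y" for e by (simp add: complex_eq_iff)
        have "((\<lambda>e. Re (of_real e / (of_real e + \<i> * of_real y))) \<longlongrightarrow> Re (of_real 0 / (of_real 0 + \<i> * of_real y))) (at_right (0::real))"
          by (intro tendsto_intros) (use False in auto)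
        thus ?thesis unfolding C using False by simp
      qed
      have "eventually (\<lambda>e. Re (of_real e / Complex e y) - Re (of_real e * (deriv zeta_reg (Complex (1 + e) y) / zeta_reg (Complex (1 + e) y)))
          = e * Re (mangoldt_series (Complex (1 + e) y))) (at_right (0::real))"
        using eventually_at_right_less[of "0::real"]
      proof eventually_elim
        case (elim e)
        have "Complex (1 + e) y - 1 = Complex e y" by (simp add: complex_eq_iff)
        hence "deriv zeta_reg (Complex (1 + e) y) / zeta_reg (Complex (1 + e) y) = 1 / Complex e y - mangoldt_series (Complex (1 + e) y)"
          using zeta_reg_log_deriv[of "Complex (1 + e) y"] elim by simp
        hence "Re (of_real e * (deriv zeta_reg (Complex (1 + e) y) / zeta_reg (Complex (1 + e) y)))
           = Re (of_real e / Complex e y - of_real e * mangoldt_series (Complex (1 + e) y))"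
          by (simp add: right_diff_distrib)
        thus ?case by simp
      qed
      from Lim_transform_eventually[OF tendsto_diff[OF 2 1] this] show ?thesis .
    qed
    have c0: "complex_of_real x = Complex x 0" for x by (simp add: complex_eq_iff)
    have "((\<lambda>e. 3 * (e * Re (mangoldt_series (Complex (1 + e) 0))) + 4 * (e * Re (mangoldt_series (Complex (1 + e) t)))
       + e * Re (mangoldt_series (Complex (1 + e) (2 * t)))) \<longlongrightarrow>
       3 * ((if (0::real) = 0 then 1 else 0) - real (m 0)) + 4 * ((if t = 0 then 1 else 0) - real (m t)) + ((if 2 * t = 0 then 1 else 0) - real (m (2 * t)))) (at_right 0)"
      by (intro tendsto_intros lim)
    moreover have "eventually (\<lambda>e. 0 \<le> 3 * (e * Re (mangoldt_series (Complex (1 + e) 0))) + 4 * (e * Re (mangoldt_series (Complex (1 + e) t)))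
       + e * Re (mangoldt_series (Complex (1 + e) (2 * t)))) (at_right (0::real))"
      using eventually_at_right_less[of "0::real"]
    proof eventually_elim
      case (elim e)
      have "0 \<le> e * (3 * Re (mangoldt_series (Complex (1 + e) 0)) + 4 * Re (mangoldt_series (Complex (1 + e) t)) + Re (mangoldt_series (Complex (1 + e) (2 * t))))"
        using mangoldt_series_341[of "1 + e" t] elim unfolding c0 by (intro mult_nonneg_nonneg) auto
      thus ?case by (simp add: algebra_simps)
    qed
    ultimately have "0 \<le> 3 * ((if (0::real) = 0 then 1 else 0) - real (m 0)) + 4 * ((if t = 0 then 1 else 0) - real (m t)) + ((if 2 * t = 0 then 1 else 0) - real (m (2 * t)))"
      by (rule tendsto_lowerbound) simp
    hence "m t = 0" using t by simp
    moreover have "m t > 0" unfolding m_def by (rule zmult_pos[OF zeta_reg_holomorphic zeta_reg_1 zero])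
    ultimately show False by simp
  qed
qed

lemma zeta_reg_nonzero_ge_1:
  assumes "Re s \<ge> 1"
  shows "zeta_reg s \<noteq> 0"
proof (cases "Re s = 1")
  case True
  hence "s = Complex 1 (Im s)" by (simp add: complex_eq_iff)
  thus ?thesis using zeta_reg_nonzero_1_line by metis
qed (use assms zeta_reg_nonzero_gt_1 in auto)

text \<open>The reciprocal Gamma factor vanishes only at -2, -4, and so on. To the right of -2 the
  zeros are therefore those of the symmetric function \<open>Xi\<close>.\<close>

lemma zeta_reg_zero_iff_Xi:
  assumes "Re s > -2"
  shows "zeta_reg s = 0 \<longleftrightarrow> Xi s = 0"
proof -
  have "s / 2 + 1 \<notin> \<int>\<^sub>\<le>\<^sub>0"
  proof
    assume "s / 2 + 1 \<in> \<int>\<^sub>\<le>\<^sub>0"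
    then obtain n where n: "s / 2 + 1 = of_int n" "n \<le> 0" by (elim nonpos_Ints_cases)
    from arg_cong[OF n(1), of Re] have "Re s / 2 + 1 = of_int n" by simp
    thus False using assms n(2) by linarith
  qed
  thus ?thesis by (simp add: zeta_reg_def rGamma_eq_zero_iff)
qed

lemma zeta_reg_zero_in_strip:
  assumes "Re s > -2" "zeta_reg s = 0"
  shows "0 < Re s" "Re s < 1"
proof -
  show 1: "Re s < 1" using zeta_reg_nonzero_ge_1[of s] assms(2) by force
  have "Xi (1 - s) = 0" using assms zeta_reg_zero_iff_Xi by (simp add: Xi_sym)
  hence "zeta_reg (1 - s) = 0" using 1 by (subst zeta_reg_zero_iff_Xi) auto
  thus "0 < Re s" using zeta_reg_nonzero_ge_1[of "1 - s"] by force
qed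

text \<open>Contours and discs reach to the left of the critical strip; with this form a zero met
  there is recognised as non-trivial without first being located in the strip.\<close>

lemma nontrivial_zero_iff: "nontrivial_zero \<rho> \<longleftrightarrow> zeta_reg \<rho> = 0 \<and> Re \<rho> > -2"
proof
  assume *: "nontrivial_zero \<rho>"
  hence "\<rho> \<noteq> 1" by (auto simp: nontrivial_zero_def)
  with * show "zeta_reg \<rho> = 0 \<and> Re \<rho> > -2" by (auto simp: nontrivial_zero_def zeta_eq)
next
  assume *: "zeta_reg \<rho> = 0 \<and> Re \<rho> > -2"
  hence "\<rho> \<noteq> 1" "0 < Re \<rho>" "Re \<rho> < 1" using zeta_reg_1 zeta_reg_zero_in_strip by auto
  with * show "nontrivial_zero \<rho>" by (simp add: nontrivial_zero_def zeta_eq)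
qed

section \<open>Existence of a non-trivial zero\<close>

lemma Xi_2: "Xi 2 = of_real (pi / 3)"
proof -
  have g: "rGamma (2::complex) = 1"
    using Gamma_fact[of 1, where ?'a = complex] by (simp add: rGamma_inverse_Gamma)
  have "of_real pi * Xi 2 / 2 = of_real (pi\<^sup>2 / 6)"
    using zeta_reg_eq_sum[of 2] g by (simp add: zeta_sum_2 zeta_reg_def)
  thus ?thesis by (simp add: power2_eq_square field_simps)
qed

text \<open>An entire function of order less than \<open>2\<close> without zeros is \<open>exp\<close> of a linear function;
  the symmetry of \<open>Xi\<close> would then make it constant, but \<open>Xi 0 = 1\<close> and \<open>Xi 2 = \<pi> / 3\<close>.\<close>

lemma Xi_has_zero: "\<exists>\<rho>. Xi \<rho> = 0"
proof (rule ccontr)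
  assume "\<not> (\<exists>\<rho>. Xi \<rho> = 0)"
  hence nz: "Xi z \<noteq> 0" for z by auto
  obtain g where g: "g holomorphic_on UNIV" "\<And>z. exp (g z) = Xi z"
    using holomorphic_logarithm_exists[of UNIV Xi 0] Xi_holomorphic nz
      by (metis UNIV_I convex_UNIV open_UNIV)
  define L where "L = (\<lambda>z. g z - g 0)"
  have L: "L holomorphic_on UNIV" unfolding L_def by (intro holomorphic_intros g)
  have "exp (g 0) = 1" by (simp add: g Xi_def)
  hence eL: "exp (L z) = Xi z" for z by (simp add: L_def exp_diff g)
  \<comment> \<open>The estimate below gives the coefficient 6, namely 4 from the polynomial
    prefactor and 2 from the integral; 7 makes the inequality strict.\<close>
  define M where "M = (\<lambda>R::real. 7 * (R + 2) powr (3/2))"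
  have M0: "M R > 0" if "R > 0" for R using that by (simp add: M_def)
  have ReL: "Re (L z) < M R" if z: "norm z \<le> R" for z R
  proof -
    have R: "R \<ge> 0" using z norm_ge_zero order_trans by blast
    define Q where "Q = 2 * (R + 2) powr (3/2)"
    have X: "norm (xi_integral z) \<le> 4 * exp Q"
    proof -
      have "2 * (norm z + 2) powr (3/2) \<le> Q"
        unfolding Q_def using z by (intro mult_left_mono powr_mono2) auto
      thus ?thesis using norm_xi_integral_le[of z] by (smt (verit) exp_le_cancel_iff)
    qed
    have "norm (z * (z - 1)) \<le> R * (R + 1)"
      unfolding norm_mult using z norm_triangle_ineq4[of z 1] R by (intro mult_mono) auto
    hence "norm (z * (z - 1) * xi_integral z) \<le> R * (R + 1) * (4 * exp Q)"
      unfolding norm_mult[of _ "xi_integral z"] using X R by (intro mult_mono) auto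
    hence "norm (Xi z) \<le> 1 + R * (R + 1) * (4 * exp Q)"
      using norm_triangle_ineq[of 1 "z * (z - 1) * xi_integral z"] by (simp add: Xi_def)
    also have "\<dots> \<le> (2 * (R + 2))\<^sup>2 * exp Q"
    proof -
      have "1 * 1 \<le> 1 * exp Q" by (simp add: Q_def)
      moreover have "1 * exp Q + R * (R + 1) * (4 * exp Q) \<le> (2 * (R + 2))\<^sup>2 * exp Q"
        unfolding mult.assoc[symmetric] distrib_right[symmetric] using R
        by (intro mult_right_mono) (auto simp: power2_eq_square algebra_simps)
      ultimately show ?thesis by linarith
    qed
    also have "\<dots> \<le> (exp (2 * (R + 2)))\<^sup>2 * exp Q"
    proof (intro mult_right_mono power_mono)
      show "2 * (R + 2) \<le> exp (2 * (R + 2))" using exp_ge_add_one_self[of "2 * (R + 2)"] by linarith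
    qed (use R in auto)
    also have "\<dots> = exp (4 * (R + 2) + Q)"
      by (simp add: exp_add power2_eq_square flip: exp_double) (simp flip: exp_add)
    finally have "exp (Re (L z)) \<le> exp (4 * (R + 2) + Q)" by (simp flip: eL)
    hence "Re (L z) \<le> 4 * (R + 2) + Q" by simp
    also have "R + 2 \<le> (R + 2) powr (3/2)"
      using R powr_mono[of 1 "3/2" "R + 2"] by simp
    finally have "Re (L z) \<le> 6 * (R + 2) powr (3/2)" by (simp add: Q_def)
    also have "\<dots> < M R" using R by (simp add: M_def)
    finally show ?thesis .
  qed
  have Lb: "norm (L z) \<le> 2 * M (2 * R)" if z: "norm z \<le> R" and R: "R > 0" for z R
  proof -
    have "norm (L z) \<le> 2 * M (2 * R) * norm (z - 0) / (2 * R - norm (z - 0))"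
      by (rule Borel_Caratheodory[of L 0 "2 * R"])
         (use L R M0 ReL z in \<open>auto simp: L_def intro: holomorphic_on_subset\<close>)
    also have "\<dots> \<le> 2 * M (2 * R) * R / R"
      using z R M0[of "2 * R"] by (intro frac_le mult_left_mono) auto
    finally show ?thesis using R by simp
  qed
  \<comment> \<open>On a circle of radius x around \<xi> the bound for \<open>L\<close> grows like
    x^(3/2), while Cauchy's inequality divides by x^2.\<close>
  have d2: "(deriv ^^ 2) L \<xi> = 0" for \<xi>
  proof -
    have "norm ((deriv ^^ 2) L \<xi>) \<le> fact 2 * (2 * M (2 * (norm \<xi> + x))) / x ^ 2" if x: "x > 0" for x
    proof (rule Cauchy_inequality[OF _ _ x])
      fix w assume "norm (\<xi> - w) = x"
      hence "norm w \<le> norm \<xi> + x" using norm_triangle_ineq2[of w \<xi>] by (simp add: norm_minus_commute)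
      thus "norm (L w) \<le> 2 * M (2 * (norm \<xi> + x))" by (rule Lb) (use x norm_ge_zero[of \<xi>] in linarith)
    qed (use L in \<open>auto intro: holomorphic_on_subset holomorphic_on_imp_continuous_on\<close>)
    hence "eventually (\<lambda>x. norm ((deriv ^^ 2) L \<xi>) \<le> fact 2 * (2 * M (2 * (norm \<xi> + x))) / x ^ 2) at_top"
      by (intro eventually_mono[OF eventually_gt_at_top[of 0]])
    moreover have "((\<lambda>x. fact 2 * (2 * M (2 * (norm \<xi> + x))) / x ^ 2) \<longlongrightarrow> 0) at_top"
      unfolding M_def by real_asymp
    ultimately have "norm ((deriv ^^ 2) L \<xi>) \<le> 0"
      by (intro tendsto_lowerbound[of _ 0 at_top]) auto
    thus ?thesis by simp
  qed
  have dL: "(L has_field_derivative deriv L z) (at z)" for z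
    using L by (intro holomorphic_derivI[of _ UNIV]) auto
  have "deriv L holomorphic_on UNIV" using L by (simp add: holomorphic_deriv)
  hence "(deriv L has_field_derivative 0) (at z within UNIV)" for z
    using holomorphic_derivI[of "deriv L" UNIV z] d2[of z] by (simp add: eval_nat_numeral)
  from has_field_derivative_zero_constant[OF convex_UNIV this]
  obtain b where b: "\<And>z. deriv L z = b" by auto
  have "((\<lambda>z. L z - b * z) has_field_derivative 0) (at z within UNIV)" for z
    using dL[of z] b by (auto intro!: derivative_eq_intros)
  from has_field_derivative_zero_constant[OF convex_UNIV this]
  obtain c where c: "\<And>z. L z - b * z = c" by auto
  have "c = 0" using c[of 0] by (simp add: L_def)
  hence Lz: "L z = b * z" for z using c[of z] by (simp add: algebra_simps)
  have "b = 0"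
  proof (rule ccontr)
    assume b0: "b \<noteq> 0"
    \<comment> \<open>Chosen so that b s - b (1 - s) = 1; the symmetry then forces exp 1 =
      1.\<close>
    define s where "s = (1 + 1 / b) / 2"
    have "exp (b * s) = exp (b * (1 - s))" using eL[of s] eL[of "1 - s"] by (simp add: Lz Xi_sym)
    hence "exp (b * s - b * (1 - s)) = 1" by (simp add: exp_diff)
    moreover have "b * s - b * (1 - s) = of_real 1" using b0 by (simp add: s_def field_simps)
    ultimately have "exp (of_real 1 :: complex) = 1" by metis
    hence "exp (1::real) = 1" by (metis exp_of_real of_real_eq_1_iff)
    thus False by simp
  qed
  hence "Xi 2 = 1" using eL[of 2] by (simp add: Lz)
  hence "pi / 3 = 1" unfolding Xi_2 by (simp only: of_real_eq_1_iff)
  thus False using pi_approx by simp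
qed

lemma exists_nontrivial_zero_ge_half: "\<exists>\<rho>. nontrivial_zero \<rho> \<and> Re \<rho> \<ge> 1 / 2"
proof -
  obtain \<rho> where \<rho>: "Xi \<rho> = 0" using Xi_has_zero by blast
  define \<rho>' where "\<rho>' = (if Re \<rho> \<ge> 1 / 2 then \<rho> else 1 - \<rho>)"
  have "Xi \<rho>' = 0" "Re \<rho>' \<ge> 1 / 2" using \<rho> by (auto simp: \<rho>'_def Xi_sym)
  hence "nontrivial_zero \<rho>'" by (simp add: nontrivial_zero_iff zeta_reg_zero_iff_Xi)
  thus ?thesis using \<open>Re \<rho>' \<ge> 1 / 2\<close> by blast
qed

section \<open>Counting zeros\<close>

text \<open>Radius 27/10 is the middle one of three. The discs of radius 5/2 reach the line Re s =
  -1/2, where the logarithmic derivative is wanted; those of radius 29/10 stay in Re s >= -9/10,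
  where growth is controlled. As 2^2 + (3/2)^2 = (5/2)^2, every non-trivial zero within 3/2 of
  height t is included.\<close>

definition zeros_near :: "real \<Rightarrow> complex set" where
  "zeros_near t = {z \<in> cball (Complex 2 t) (27/10). zeta_reg z = 0}"

lemma finite_zeros_near: "finite (zeros_near t)"
  unfolding zeros_near_def by (rule finite_zeros_entire[OF zeta_reg_holomorphic zeta_reg_1]) auto

text \<open>The terms after the first have total modulus at most \<pi>^2 / 6 - 1 < 3/4. This is the
  lower bound at the centre of the discs, uniform in t.\<close>

lemma norm_zeta_sum_2_line: "norm (zeta_sum (Complex 2 t)) \<ge> 1 / 4"
proof -
  let ?s = "Complex 2 t"
  have "(\<lambda>n. 1 * of_nat (Suc n) powr (- ?s)) sums zeta_sum ?s"
    unfolding zeta_sum_def by (rule dirichlet_series(1)[OF zeta_sum_summable]) simp_all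
  hence s1: "(\<lambda>n. of_nat (Suc (Suc n)) powr (- ?s)) sums (zeta_sum ?s - 1)"
    using sums_Suc_iff[of "\<lambda>n. of_nat (Suc n) powr (- ?s)" "zeta_sum ?s - 1"]
      by (simp del: of_nat_Suc) simp
  have n: "norm (of_nat (Suc (Suc n)) powr (- ?s)) = 1 / (real (Suc (Suc n)))\<^sup>2" for n
  proof -
    have "norm (of_nat (Suc (Suc n)) powr (- ?s)) = real (Suc (Suc n)) powr (- 2)"
      unfolding norm_of_nat_Suc_powr by simp
    also have "\<dots> = 1 / (real (Suc (Suc n)))\<^sup>2" by (subst powr_minus_divide) (simp add: powr_numeral)
    finally show ?thesis .
  qed
  have "(\<lambda>n. 1 / (real (Suc n))\<^sup>2) sums (pi\<^sup>2 / 6)"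
    using inverse_squares_sums by (simp add: add.commute)
  hence s2: "(\<lambda>n. 1 / (real (Suc (Suc n)))\<^sup>2) sums (pi\<^sup>2 / 6 - 1)"
    using sums_Suc_iff[of "\<lambda>n. 1 / (real (Suc n))\<^sup>2" "pi\<^sup>2 / 6 - 1"] by simp
  have "norm (zeta_sum ?s - 1) \<le> pi\<^sup>2 / 6 - 1"
    using norm_sums_le[OF s1 s2] n by simp
  moreover have "pi\<^sup>2 \<le> (16/5)\<^sup>2" by (intro power_mono) (use pi_approx in auto)
  hence "pi\<^sup>2 / 6 - 1 \<le> 3 / 4" by (simp add: power2_eq_square)
  ultimately show ?thesis using norm_triangle_ineq2[of 1 "1 - zeta_sum ?s"] by (simp add: norm_minus_commute)
qed

text \<open>\<open>log_deriv_local\<close> around 2 + i t: growth and the lower bound at the centre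
  make \<open>B\<close> cubic in |t| + 3, so ln B is of order ln (|t| + 3). The shift by 3 keeps
  that logarithm at least 1, which lets it absorb constants.\<close>

lemma zeta_reg_local:
  obtains C where "C > 0"
    "\<And>t. real (\<Sum>\<rho>\<in>zeros_near t. zmult zeta_reg \<rho>) \<le> C * ln (\<bar>t\<bar> + 3)"
    "\<And>t z. z \<in> cball (Complex 2 t) (5/2) \<Longrightarrow> zeta_reg z \<noteq> 0 \<Longrightarrow>
       norm (deriv zeta_reg z / zeta_reg z - (\<Sum>\<rho>\<in>zeros_near t. of_nat (zmult zeta_reg \<rho>) / (z - \<rho>))) \<le> C * ln (\<bar>t\<bar> + 3)"
proof -
  obtain C0 where C0: "C0 > 0" "\<And>s. Re s \<ge> -9/10 \<Longrightarrow> norm (zeta_reg s) \<le> C0 * (norm s + 1) ^ 3"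
    using zeta_reg_growth by blast
  define K where "K = \<bar>ln (4 * C0 * 8)\<bar> + 3"
  define C1 where "C1 = 1 / ln ((29/10) / (27/10 :: real))"
  define C2 where "C2 = 8 * (27/10) / (27/10 - 5/2)\<^sup>2 + (27/10) / (((29/10)\<^sup>2 - (27/10)\<^sup>2) * ln ((29/10) / (27/10 :: real)))"
  have lpos: "ln ((29/10) / (27/10 :: real)) > 0" by simp
  have C12: "C1 > 0" "C2 > 0" unfolding C1_def C2_def using lpos
    by (auto intro!: add_pos_pos divide_pos_pos mult_pos_pos simp: power2_eq_square simp del: ln_gt_zero_iff)
  have K: "K \<ge> 3" by (simp add: K_def)
  have key: "real (\<Sum>\<rho>\<in>zeros_near t. zmult zeta_reg \<rho>) \<le> C1 * (K * ln (\<bar>t\<bar> + 3))"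
     "z \<in> cball (Complex 2 t) (5/2) \<Longrightarrow> zeta_reg z \<noteq> 0 \<Longrightarrow>
       norm (deriv zeta_reg z / zeta_reg z - (\<Sum>\<rho>\<in>zeros_near t. of_nat (zmult zeta_reg \<rho>) / (z - \<rho>))) \<le> C2 * ((K + 1) * ln (\<bar>t\<bar> + 3))" for t z
  proof -
    define a where "a = Complex 2 t"
    define B where "B = 4 * C0 * 8 * (\<bar>t\<bar> + 3) ^ 3"
    have ha: "norm (zeta_reg a) \<ge> 1 / 4"
    proof -
      have "1 \<le> norm (a - 1)" using complex_Re_le_cmod[of "a - 1"] by (simp add: a_def)
      hence "1 * (1 / 4) \<le> norm (a - 1) * norm (zeta_sum a)"
        using norm_zeta_sum_2_line[of t] by (intro mult_mono) (auto simp: a_def)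
      moreover have "zeta_reg a = (a - 1) * zeta_sum a" by (rule zeta_reg_eq_sum) (simp add: a_def)
      ultimately show ?thesis by (simp add: norm_mult)
    qed
    have a0: "zeta_reg a \<noteq> 0" using ha by auto
    have bound: "norm (zeta_reg z) \<le> B * norm (zeta_reg a)" if z: "z \<in> cball a (29/10)" for z
    proof -
      have az: "norm (a - z) \<le> 29/10" using z by (simp add: dist_norm)
      have "\<bar>Re a - Re z\<bar> \<le> 29/10" using abs_Re_le_cmod[of "a - z"] az by simp
      moreover have "Re a = 2" by (simp add: a_def)
      ultimately have Re: "Re z \<ge> - 9/10" by linarith
      have na: "norm a \<le> 2 + \<bar>t\<bar>" using cmod_le[of a] by (simp add: a_def)
      have "norm z \<le> norm a + norm (a - z)" using norm_triangle_ineq4[of a "a - z"] by simp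
      hence "norm z + 1 \<le> 2 * (\<bar>t\<bar> + 3)" using na az by simp
      hence "(norm z + 1) ^ 3 \<le> (2 * (\<bar>t\<bar> + 3)) ^ 3" by (intro power_mono) auto
      also have "\<dots> = 8 * (\<bar>t\<bar> + 3) ^ 3" by (simp only: power_mult_distrib) simp
      finally have "C0 * (norm z + 1) ^ 3 \<le> C0 * (8 * (\<bar>t\<bar> + 3) ^ 3)"
        using C0 by (intro mult_left_mono) auto
      hence "norm (zeta_reg z) \<le> B * (1 / 4)" using C0(2)[OF Re] by (simp add: B_def)
      also have "\<dots> \<le> B * norm (zeta_reg a)" using ha C0 by (intro mult_left_mono) (auto simp: B_def)
      finally show ?thesis .
    qed
    have l1: "1 \<le> ln (\<bar>t\<bar> + 3)"
    proof -
      have "exp (1::real) \<le> 3" by (rule exp_le)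
      thus ?thesis by (subst ln_ge_iff) auto
    qed
    have "ln B = ln (4 * C0 * 8) + ln ((\<bar>t\<bar> + 3) ^ 3)"
      unfolding B_def using C0 by (subst ln_mult) auto
    also have "ln ((\<bar>t\<bar> + 3) ^ 3) = 3 * ln (\<bar>t\<bar> + 3)" by (simp add: ln_realpow)
    also have "ln (4 * C0 * 8) \<le> \<bar>ln (4 * C0 * 8)\<bar> * ln (\<bar>t\<bar> + 3)"
      using mult_left_mono[OF l1, of "\<bar>ln (4 * C0 * 8)\<bar>"] by simp
    finally have lnB: "ln B \<le> K * ln (\<bar>t\<bar> + 3)" by (simp add: K_def algebra_simps)
    have Z: "{z \<in> cball a (27/10). zeta_reg z = 0} = zeros_near t" by (simp add: zeros_near_def a_def)
    note loc = log_deriv_local[OF zeta_reg_holomorphic a0, of "5/2" "27/10" "29/10" B, unfolded Z]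
    have "real (\<Sum>\<rho>\<in>zeros_near t. zmult zeta_reg \<rho>) * ln ((29/10) / (27/10)) \<le> ln B"
      by (rule loc(1)) (use bound in auto)
    hence "real (\<Sum>\<rho>\<in>zeros_near t. zmult zeta_reg \<rho>) \<le> C1 * ln B"
      unfolding C1_def using lpos by (simp only: pos_le_divide_eq times_divide_eq_left mult_1_left)
    also have "\<dots> \<le> C1 * (K * ln (\<bar>t\<bar> + 3))" using lnB C12 by (intro mult_left_mono) auto
    finally show "real (\<Sum>\<rho>\<in>zeros_near t. zmult zeta_reg \<rho>) \<le> C1 * (K * ln (\<bar>t\<bar> + 3))" .
    show "norm (deriv zeta_reg z / zeta_reg z - (\<Sum>\<rho>\<in>zeros_near t. of_nat (zmult zeta_reg \<rho>) / (z - \<rho>))) \<le> C2 * ((K + 1) * ln (\<bar>t\<bar> + 3))"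
      if "z \<in> cball (Complex 2 t) (5/2)" "zeta_reg z \<noteq> 0"
    proof -
      have "norm (deriv zeta_reg z / zeta_reg z - (\<Sum>\<rho>\<in>zeros_near t. of_nat (zmult zeta_reg \<rho>) / (z - \<rho>))) \<le> C2 * (ln B + 1)"
        unfolding C2_def by (rule loc(2)) (use bound that in \<open>auto simp: a_def\<close>)
      also have "\<dots> \<le> C2 * ((K + 1) * ln (\<bar>t\<bar> + 3))"
        using lnB l1 C12 by (intro mult_left_mono) (auto simp: distrib_right)
      finally show ?thesis .
    qed
  qed
  have l0: "0 \<le> ln (\<bar>t\<bar> + 3)" for t :: real by simp
  show thesis
  proof (rule that[of "(C1 + C2) * (K + 1)"])
    show "(C1 + C2) * (K + 1) > 0" using C12 K by (intro mult_pos_pos) auto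
    fix t
    have "C1 * (K * ln (\<bar>t\<bar> + 3)) = C1 * K * ln (\<bar>t\<bar> + 3)" by simp
    also have "\<dots> \<le> (C1 + C2) * (K + 1) * ln (\<bar>t\<bar> + 3)"
      using C12 K l0 by (intro mult_right_mono mult_mono) auto
    finally show "real (\<Sum>\<rho>\<in>zeros_near t. zmult zeta_reg \<rho>) \<le> (C1 + C2) * (K + 1) * ln (\<bar>t\<bar> + 3)"
      using key(1)[of t] by linarith
    fix z assume z: "z \<in> cball (Complex 2 t) (5/2)" "zeta_reg z \<noteq> 0"
    have "C2 * ((K + 1) * ln (\<bar>t\<bar> + 3)) = C2 * (K + 1) * ln (\<bar>t\<bar> + 3)" by simp
    also have "\<dots> \<le> (C1 + C2) * (K + 1) * ln (\<bar>t\<bar> + 3)"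
      using C12 K l0 by (intro mult_right_mono mult_mono) auto
    finally show "norm (deriv zeta_reg z / zeta_reg z - (\<Sum>\<rho>\<in>zeros_near t. of_nat (zmult zeta_reg \<rho>) / (z - \<rho>))) \<le> (C1 + C2) * (K + 1) * ln (\<bar>t\<bar> + 3)"
      using key(2)[OF z] by linarith
  qed
qed

lemma zeros_near_strip:
  assumes "\<rho> \<in> zeros_near t"
  shows "nontrivial_zero \<rho>"
proof -
  have "\<bar>2 - Re \<rho>\<bar> \<le> 27/10" "zeta_reg \<rho> = 0"
    using assms abs_Re_le_cmod[of "Complex 2 t - \<rho>"] by (auto simp: zeros_near_def dist_norm)
  thus ?thesis unfolding nontrivial_zero_iff by linarith
qed

lemma nontrivial_zero_near:
  assumes "nontrivial_zero \<rho>" "\<bar>Im \<rho> - t\<bar> \<le> 3/2"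
  shows "\<rho> \<in> zeros_near t"
proof -
  have Re: "0 < Re \<rho>" "Re \<rho> < 1" using assms(1) by (auto simp: nontrivial_zero_def)
  have z: "zeta_reg \<rho> = 0" using assms(1) nontrivial_zero_iff by blast
  have "(cmod (Complex 2 t - \<rho>))\<^sup>2 = (2 - Re \<rho>)\<^sup>2 + (t - Im \<rho>)\<^sup>2" by (simp add: cmod_power2)
  also have "\<dots> \<le> 2\<^sup>2 + (3/2)\<^sup>2"
  proof -
    have "\<bar>2 - Re \<rho>\<bar> \<le> 2" "\<bar>t - Im \<rho>\<bar> \<le> 3/2" using Re assms(2) by linarith+
    thus ?thesis by (intro add_mono power2_le_iff_abs_le[THEN iffD2]) auto
  qed
  also have "\<dots> \<le> (27/10)\<^sup>2" by (simp add: power2_eq_square)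
  finally have "cmod (Complex 2 t - \<rho>) \<le> 27/10" by (rule power2_le_imp_le) simp
  thus ?thesis using z by (simp add: zeros_near_def dist_norm)
qed

lemma zmult_nontrivial_zero: "nontrivial_zero \<rho> \<Longrightarrow> zmult zeta_reg \<rho> > 0"
  by (rule zmult_pos[OF zeta_reg_holomorphic zeta_reg_1]) (simp add: nontrivial_zero_iff)

definition zeros_upto :: "real \<Rightarrow> complex set" where
  "zeros_upto T = {\<rho>. nontrivial_zero \<rho> \<and> \<bar>Im \<rho>\<bar> \<le> T}"

lemma finite_zeros_upto: "finite (zeros_upto T)"
proof (rule finite_subset)
  show "zeros_upto T \<subseteq> {z \<in> cbox (Complex 0 (- T)) (Complex 1 T). zeta_reg z = 0}"
  proof
    fix \<rho> assume "\<rho> \<in> zeros_upto T"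
    hence *: "nontrivial_zero \<rho>" "\<bar>Im \<rho>\<bar> \<le> T" by (simp_all add: zeros_upto_def)
    from * have "0 < Re \<rho>" "Re \<rho> < 1" by (simp_all add: nontrivial_zero_def)
    moreover from * have "zeta_reg \<rho> = 0" using nontrivial_zero_iff by blast
    ultimately show "\<rho> \<in> {z \<in> cbox (Complex 0 (- T)) (Complex 1 T). zeta_reg z = 0}"
      using *(2) by (auto simp: in_cbox_complex_iff)
  qed
  show "finite {z \<in> cbox (Complex 0 (- T)) (Complex 1 T). zeta_reg z = 0}"
    by (rule finite_zeros_entire[OF zeta_reg_holomorphic zeta_reg_1]) auto
qed

text \<open>Zeros are grouped by k, the floor of |Im \<rho>|. For k >= 1 they lie in the discs at
  heights k and -k, so their multiplicities add up to O(ln (k + 3)), each weighted by at most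
  k^(-3/2), and the series over k converges.\<close>

lemma zeros_weighted_sum_bounded:
  obtains C where "C > 0" "\<And>T. (\<Sum>\<rho>\<in>zeros_upto T. real (zmult zeta_reg \<rho>) * norm \<rho> powr (- 3/2)) \<le> C"
proof -
  obtain C where C: "C > 0"
    "\<And>t. real (\<Sum>\<rho>\<in>zeros_near t. zmult zeta_reg \<rho>) \<le> C * ln (\<bar>t\<bar> + 3)"
    using zeta_reg_local by metis
  define w where "w = (\<lambda>\<rho>. real (zmult zeta_reg \<rho>) * norm \<rho> powr (- 3/2))"
  have w0: "w \<rho> \<ge> 0" for \<rho> by (simp add: w_def)
  \<comment> \<open>(k + 1) / 2 is at most k for k >= 1 and, unlike k, positive for k = 0.\<close>
  define b where "b = (\<lambda>k::nat. 2 * C * ln (real k + 3) * ((real k + 1) / 2) powr (- 3/2))"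
  have b0: "b k \<ge> 0" for k using C(1) by (simp add: b_def)
  have sb: "summable b"
  proof (rule summable_comparison_test_bigo)
    show "summable (\<lambda>n. norm (real n powr (- 5/4)))" by (simp add: summable_real_powr_iff)
    show "b \<in> O(\<lambda>n. real n powr (- 5/4))" unfolding b_def by real_asymp
  qed
  \<comment> \<open>The modulus is not bounded below by k when k = 0; a fixed finite sum over the
    zeros up to height 1 takes the place of that term.\<close>
  define c0 where "c0 = (\<Sum>\<rho>\<in>zeros_upto 1. w \<rho>)"
  have c0: "c0 \<ge> 0" unfolding c0_def by (intro sum_nonneg w0)
  define B where "B = (\<lambda>k. if k = 0 then c0 else b k)"
  have sB: "summable B"
  proof (rule summable_comparison_test')
    show "summable b" by fact
    show "norm (B k) \<le> b k" if "k \<ge> 1" for k using that b0 by (simp add: B_def)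
  qed
  have B0: "B k \<ge> 0" for k using b0 c0 by (simp add: B_def)
  have bd: "(\<Sum>\<rho>\<in>zeros_upto T. w \<rho>) \<le> (\<Sum>k. B k) + 1" for T
  proof -
    define fl where "fl = (\<lambda>\<rho>. nat \<lfloor>\<bar>Im \<rho>\<bar>\<rfloor>)"
    have fl: "real (fl \<rho>) \<le> \<bar>Im \<rho>\<bar>" "\<bar>Im \<rho>\<bar> < real (fl \<rho>) + 1" for \<rho>
      by (simp_all add: fl_def)
    have box: "(\<Sum>\<rho>\<in>{\<rho> \<in> zeros_upto T. fl \<rho> = k}. w \<rho>) \<le> B k" for k
    proof (cases "k = 0")
      case True
      have "{\<rho> \<in> zeros_upto T. fl \<rho> = k} \<subseteq> zeros_upto 1"
      proof
        fix \<rho> assume "\<rho> \<in> {\<rho> \<in> zeros_upto T. fl \<rho> = k}"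
        thus "\<rho> \<in> zeros_upto 1" using fl(2)[of \<rho>] True by (simp add: zeros_upto_def)
      qed
      hence "(\<Sum>\<rho>\<in>{\<rho> \<in> zeros_upto T. fl \<rho> = k}. w \<rho>) \<le> c0"
        unfolding c0_def by (intro sum_mono2 finite_zeros_upto w0)
      thus ?thesis using True by (simp add: B_def)
    next
      case False
      let ?U = "zeros_near (real k) \<union> zeros_near (- real k)"
      have sub: "{\<rho> \<in> zeros_upto T. fl \<rho> = k} \<subseteq> ?U"
      proof
        fix \<rho> assume \<rho>: "\<rho> \<in> {\<rho> \<in> zeros_upto T. fl \<rho> = k}"
        hence nz: "nontrivial_zero \<rho>" by (simp add: zeros_upto_def)
        have k: "real (fl \<rho>) = real k" using \<rho> by simp
        have "\<bar>Im \<rho> - real k\<bar> \<le> 3/2 \<or> \<bar>Im \<rho> - (- real k)\<bar> \<le> 3/2"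
        proof (cases "Im \<rho> \<ge> 0")
          case True
          hence "\<bar>Im \<rho> - real k\<bar> \<le> 3/2" using fl[of \<rho>] k by linarith
          thus ?thesis ..
        next
          case False
          hence "\<bar>Im \<rho> - (- real k)\<bar> \<le> 3/2" using fl[of \<rho>] k by linarith
          thus ?thesis ..
        qed
        thus "\<rho> \<in> ?U" using nontrivial_zero_near[OF nz] by blast
      qed
      have wle: "w \<rho> \<le> real (zmult zeta_reg \<rho>) * ((real k + 1) / 2) powr (- 3/2)"
        if "\<rho> \<in> {\<rho> \<in> zeros_upto T. fl \<rho> = k}" for \<rho>
      proof -
        have "(real k + 1) / 2 \<le> real k" using False by simp
        also have "\<dots> \<le> norm \<rho>" using fl(1)[of \<rho>] that abs_Im_le_cmod[of \<rho>] by simp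
        finally have "norm \<rho> powr (- 3/2) \<le> ((real k + 1) / 2) powr (- 3/2)" by (intro powr_mono2') auto
        thus ?thesis unfolding w_def by (intro mult_left_mono) auto
      qed
      have "(\<Sum>\<rho>\<in>{\<rho> \<in> zeros_upto T. fl \<rho> = k}. w \<rho>)
         \<le> (\<Sum>\<rho>\<in>{\<rho> \<in> zeros_upto T. fl \<rho> = k}. real (zmult zeta_reg \<rho>) * ((real k + 1) / 2) powr (- 3/2))"
        by (intro sum_mono wle)
      also have "\<dots> \<le> (\<Sum>\<rho>\<in>?U. real (zmult zeta_reg \<rho>) * ((real k + 1) / 2) powr (- 3/2))"
        using finite_zeros_near by (intro sum_mono2 sub) auto
      also have "\<dots> = (\<Sum>\<rho>\<in>?U. real (zmult zeta_reg \<rho>)) * ((real k + 1) / 2) powr (- 3/2)"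
        by (rule sum_distrib_right[symmetric])
      also have "(\<Sum>\<rho>\<in>?U. real (zmult zeta_reg \<rho>)) \<le> (\<Sum>\<rho>\<in>zeros_near (real k). real (zmult zeta_reg \<rho>)) + (\<Sum>\<rho>\<in>zeros_near (- real k). real (zmult zeta_reg \<rho>))"
        using finite_zeros_near by (subst sum.union_inter[symmetric]) (auto intro!: sum_nonneg)
      also have "\<dots> \<le> C * ln (real k + 3) + C * ln (real k + 3)"
        using C(2)[of "real k"] C(2)[of "- real k"] by (intro add_mono) simp_all
      finally show ?thesis using False by (simp add: B_def b_def mult_right_mono)
    qed
    define K where "K = (\<Sum>\<rho>\<in>zeros_upto T. fl \<rho>)"
    have "(\<Sum>\<rho>\<in>zeros_upto T. w \<rho>) = (\<Sum>k\<in>{..K}. \<Sum>\<rho>\<in>{\<rho> \<in> zeros_upto T. fl \<rho> = k}. w \<rho>)"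
      by (rule sum.group[symmetric]) (auto simp: finite_zeros_upto K_def intro!: member_le_sum)
    also have "\<dots> \<le> (\<Sum>k\<in>{..K}. B k)" by (intro sum_mono box)
    also have "\<dots> \<le> (\<Sum>k. B k)" by (intro sum_le_suminf sB B0) auto
    finally show ?thesis by simp
  qed
  show thesis
  proof (rule that)
    show "(\<Sum>k. B k) + 1 > 0" using suminf_nonneg[OF sB B0] by simp
    show "(\<Sum>\<rho>\<in>zeros_upto T. real (zmult zeta_reg \<rho>) * norm \<rho> powr (- 3/2)) \<le> (\<Sum>k. B k) + 1" for T
      using bd[of T] by (simp add: w_def)
  qed
qed

text \<open>Pigeonhole: let n be the size of S. If each of the n + 1 points a + j / (n + 1) with j
  <= n were closer than half their spacing to some element of S, two of them would share that
  element.\<close>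

lemma exists_gap:
  fixes S :: "real set"
  assumes "finite S"
  shows "\<exists>x\<in>{a..a+1}. \<forall>y\<in>S. \<bar>x - y\<bar> \<ge> 1 / (2 * (real (card S) + 1))"
proof (rule ccontr)
  define n where "n = card S"
  define p where "p = (\<lambda>j::nat. a + real j / (real n + 1))"
  assume *: "\<not> ?thesis"
  have "\<exists>y\<in>S. \<bar>p j - y\<bar> < 1 / (2 * (real n + 1))" if "j \<in> {..n}" for j
  proof -
    have "p j \<in> {a..a+1}" using that by (auto simp: p_def divide_le_eq)
    thus ?thesis using * unfolding n_def by (meson not_le_imp_less)
  qed
  then obtain f where f: "\<And>j. j \<in> {..n} \<Longrightarrow> f j \<in> S \<and> \<bar>p j - f j\<bar> < 1 / (2 * (real n + 1))" by metis
  have "inj_on f {..n}"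
  proof (rule inj_onI, rule ccontr)
    fix i j assume ij: "i \<in> {..n}" "j \<in> {..n}" "f i = f j" "i \<noteq> j"
    have "\<bar>p i - p j\<bar> < 1 / (2 * (real n + 1)) + 1 / (2 * (real n + 1))"
      using f[OF ij(1)] f[OF ij(2)] ij(3) by linarith
    also have "\<dots> = 1 / (real n + 1)" by (simp add: field_simps)
    finally have "\<bar>real i - real j\<bar> / (real n + 1) < 1 / (real n + 1)"
      by (simp add: p_def diff_divide_distrib[symmetric] abs_divide)
    hence "\<bar>real i - real j\<bar> < 1" by (simp add: divide_less_cancel)
    thus False using ij(4) by linarith
  qed
  hence "card {..n} \<le> card S" using f assms by (intro card_inj_on_le[of f]) auto
  thus False by (simp add: n_def)
qed

lemma sum_zmult_over_distance:
  assumes d: "d > 0" and "\<And>\<rho>. \<rho> \<in> zeros_near t \<Longrightarrow> d \<le> norm (z - \<rho>)"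
  shows "norm (\<Sum>\<rho>\<in>zeros_near t. of_nat (zmult zeta_reg \<rho>) / (z - \<rho>)) \<le> real (\<Sum>\<rho>\<in>zeros_near t. zmult zeta_reg \<rho>) / d"
proof -
  have "norm (\<Sum>\<rho>\<in>zeros_near t. of_nat (zmult zeta_reg \<rho>) / (z - \<rho>)) \<le> (\<Sum>\<rho>\<in>zeros_near t. real (zmult zeta_reg \<rho>) / d)"
  proof (rule sum_norm_le)
    fix \<rho> assume "\<rho> \<in> zeros_near t"
    thus "norm (of_nat (zmult zeta_reg \<rho>) / (z - \<rho>)) \<le> real (zmult zeta_reg \<rho>) / d"
      using assms by (simp add: norm_divide divide_left_mono frac_le)
  qed
  thus ?thesis by (simp add: sum_divide_distrib)
qed

section \<open>The logarithmic derivative on the contour\<close>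

text \<open>The point -1/2 + i t is on the edge of the disc of radius 5/2 and has distance at least
  1/2 from every non-trivial zero, so each zero in the local formula contributes at most twice its
  multiplicity.\<close>

lemma zeta_reg_left_line:
  obtains C where "C > 0" "\<And>t. zeta_reg (Complex (-1/2) t) \<noteq> 0"
    "\<And>t. norm (deriv zeta_reg (Complex (-1/2) t) / zeta_reg (Complex (-1/2) t)) \<le> C * ln (\<bar>t\<bar> + 3)"
proof -
  obtain C where C: "C > 0"
    "\<And>t. real (\<Sum>\<rho>\<in>zeros_near t. zmult zeta_reg \<rho>) \<le> C * ln (\<bar>t\<bar> + 3)"
    "\<And>t z. z \<in> cball (Complex 2 t) (5/2) \<Longrightarrow> zeta_reg z \<noteq> 0 \<Longrightarrow>
       norm (deriv zeta_reg z / zeta_reg z - (\<Sum>\<rho>\<in>zeros_near t. of_nat (zmult zeta_reg \<rho>) / (z - \<rho>))) \<le> C * ln (\<bar>t\<bar> + 3)"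
    using zeta_reg_local by blast
  have nz: "zeta_reg (Complex (-1/2) t) \<noteq> 0" for t
    using zeta_reg_zero_in_strip[of "Complex (-1/2) t"] by auto
  show thesis
  proof (rule that[OF _ nz])
    show "3 * C > 0" using C by simp
    fix t
    define z where "z = Complex (-1/2) t"
    define S where "S = (\<Sum>\<rho>\<in>zeros_near t. of_nat (zmult zeta_reg \<rho>) / (z - \<rho>))"
    have "Complex 2 t - z = of_real (5/2)" by (simp add: z_def complex_eq_iff)
    hence "z \<in> cball (Complex 2 t) (5/2)" by (simp only: mem_cball dist_norm norm_of_real)
    from C(3)[OF this] have 1: "norm (deriv zeta_reg z / zeta_reg z - S) \<le> C * ln (\<bar>t\<bar> + 3)"
      using nz by (simp add: z_def S_def)
    have "norm S \<le> real (\<Sum>\<rho>\<in>zeros_near t. zmult zeta_reg \<rho>) / (1/2)" unfolding S_def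
    proof (rule sum_zmult_over_distance)
      fix \<rho> assume "\<rho> \<in> zeros_near t"
      hence "Re \<rho> > 0" using zeros_near_strip by (simp add: nontrivial_zero_def)
      thus "1 / 2 \<le> norm (z - \<rho>)" using abs_Re_le_cmod[of "z - \<rho>"] by (simp add: z_def)
    qed simp
    hence "norm S \<le> 2 * (C * ln (\<bar>t\<bar> + 3))" using C(2)[of t] by simp
    moreover have "norm (deriv zeta_reg z / zeta_reg z) \<le> norm (deriv zeta_reg z / zeta_reg z - S) + norm S"
      using norm_triangle_ineq[of "deriv zeta_reg z / zeta_reg z - S" S] by simp
    ultimately have "norm (deriv zeta_reg z / zeta_reg z) \<le> 3 * C * ln (\<bar>t\<bar> + 3)" using 1 by linarith
    thus "norm (deriv zeta_reg (Complex (-1/2) t) / zeta_reg (Complex (-1/2) t)) \<le> 3 * C * ln (\<bar>t\<bar> + 3)"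
      by (simp only: z_def)
  qed
qed

text \<open>There are O(ln T) zeros near the heights T and -T, so by \<open>exists_gap\<close> some
  T' keeps a distance of at least a constant over ln T from all of them. The sum in the local
  formula then has O(ln T) terms, with multiplicity, of size O(ln T).\<close>

lemma zeta_reg_good_height:
  obtains C where "C > 0"
    "\<And>T. T \<ge> 2 \<Longrightarrow> \<exists>T'\<in>{T-1..T}. (\<forall>\<rho>. nontrivial_zero \<rho> \<longrightarrow> \<bar>Im \<rho>\<bar> \<noteq> T') \<and>
       (\<forall>\<sigma> \<tau>. -1/2 \<le> \<sigma> \<longrightarrow> \<sigma> \<le> 2 \<longrightarrow> \<bar>\<tau>\<bar> = T' \<longrightarrow>
          norm (deriv zeta_reg (Complex \<sigma> \<tau>) / zeta_reg (Complex \<sigma> \<tau>)) \<le> C * (ln (T + 3))\<^sup>2)"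
proof -
  obtain C where C: "C > 0"
    "\<And>t. real (\<Sum>\<rho>\<in>zeros_near t. zmult zeta_reg \<rho>) \<le> C * ln (\<bar>t\<bar> + 3)"
    "\<And>t z. z \<in> cball (Complex 2 t) (5/2) \<Longrightarrow> zeta_reg z \<noteq> 0 \<Longrightarrow>
       norm (deriv zeta_reg z / zeta_reg z - (\<Sum>\<rho>\<in>zeros_near t. of_nat (zmult zeta_reg \<rho>) / (z - \<rho>))) \<le> C * ln (\<bar>t\<bar> + 3)"
    using zeta_reg_local by blast
  have card_le: "real (card (zeros_near t)) \<le> C * ln (\<bar>t\<bar> + 3)" for t
  proof -
    have "card (zeros_near t) \<le> (\<Sum>\<rho>\<in>zeros_near t. zmult zeta_reg \<rho>)"
      unfolding card_eq_sum
    proof (rule sum_mono)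
      fix \<rho> assume "\<rho> \<in> zeros_near t"
      thus "1 \<le> zmult zeta_reg \<rho>" using zmult_nontrivial_zero[OF zeros_near_strip] by fastforce
    qed
    hence "real (card (zeros_near t)) \<le> real (\<Sum>\<rho>\<in>zeros_near t. zmult zeta_reg \<rho>)"
      by (simp only: of_nat_le_iff)
    thus ?thesis using C(2)[of t] by linarith
  qed
  show thesis
  proof (rule that[of "C * (2 * (2 * C + 1)) + C"])
    show "C * (2 * (2 * C + 1)) + C > 0" using C(1) by (intro add_pos_pos mult_pos_pos) auto
    fix T :: real assume T: "T \<ge> 2"
    define l where "l = ln (T + 3)"
    have l1: "l \<ge> 1"
    proof -
      have "exp (1::real) \<le> 3" by (rule exp_le)
      thus ?thesis unfolding l_def using T by (subst ln_ge_iff) auto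
    qed
    \<comment> \<open>Absolute values of the imaginary parts are collected so that one height serves
      both the upper and the lower edge.\<close>
    define S where "S = (\<lambda>\<rho>. \<bar>Im \<rho>\<bar>) ` (zeros_near T \<union> zeros_near (- T))"
    have finS: "finite S" by (simp add: S_def finite_zeros_near)
    have "card S \<le> card (zeros_near T \<union> zeros_near (- T))"
      unfolding S_def by (intro card_image_le) (simp add: finite_zeros_near)
    also have "\<dots> \<le> card (zeros_near T) + card (zeros_near (- T))" by (rule card_Un_le)
    finally have "real (card S) \<le> real (card (zeros_near T)) + real (card (zeros_near (- T)))"
      by linarith
    also have "\<dots> \<le> 2 * C * l" using card_le[of T] card_le[of "- T"] T by (simp add: l_def)
    finally have cS: "real (card S) \<le> 2 * C * l" .
    define d where "d = 1 / (2 * (real (card S) + 1))"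
    have d: "d > 0" "d \<le> 1 / 2" by (auto simp: d_def field_simps)
    have id: "1 / d \<le> 2 * (2 * C + 1) * l"
    proof -
      have "1 / d = 2 * (real (card S) + 1)" by (simp add: d_def)
      also have "\<dots> \<le> 2 * (2 * C * l + l)" using cS l1 by (intro mult_left_mono add_mono) auto
      finally show ?thesis by (simp add: algebra_simps)
    qed
    obtain T' where T': "T' \<in> {T-1..T-1+1}" "\<And>y. y \<in> S \<Longrightarrow> \<bar>T' - y\<bar> \<ge> d"
      using exists_gap[OF finS, of "T - 1"] unfolding d_def by blast
    \<comment> \<open>A zero within 1/2 of T' is within 3/2 of T or of -T and hence recorded in
      \<open>S\<close>; for all others the distance is at least 1/2, which is no less than
      d.\<close>
    have gap: "\<bar>\<bar>Im \<rho>\<bar> - T'\<bar> \<ge> d" if nz: "nontrivial_zero \<rho>" for \<rho>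
    proof (cases "\<bar>\<bar>Im \<rho>\<bar> - T'\<bar> < 1 / 2")
      case True
      have T'': "T - 1 \<le> T'" "T' \<le> T" using T'(1) by auto
      have "\<bar>Im \<rho> - T\<bar> \<le> 3/2 \<or> \<bar>Im \<rho> - (- T)\<bar> \<le> 3/2"
      proof (cases "Im \<rho> \<ge> 0")
        case True
        hence "\<bar>Im \<rho> - T\<bar> \<le> 3/2" using T'' \<open>\<bar>\<bar>Im \<rho>\<bar> - T'\<bar> < 1 / 2\<close> by linarith
        thus ?thesis ..
      next
        case False
        hence "\<bar>Im \<rho> - (- T)\<bar> \<le> 3/2" using T'' \<open>\<bar>\<bar>Im \<rho>\<bar> - T'\<bar> < 1 / 2\<close> by linarith
        thus ?thesis ..
      qed
      hence "\<rho> \<in> zeros_near T \<union> zeros_near (- T)" using nontrivial_zero_near[OF nz] by blast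
      hence "\<bar>Im \<rho>\<bar> \<in> S" by (auto simp: S_def)
      from T'(2)[OF this] show ?thesis by linarith
    qed (use d in linarith)
    show "\<exists>T'\<in>{T-1..T}. (\<forall>\<rho>. nontrivial_zero \<rho> \<longrightarrow> \<bar>Im \<rho>\<bar> \<noteq> T') \<and>
       (\<forall>\<sigma> \<tau>. -1/2 \<le> \<sigma> \<longrightarrow> \<sigma> \<le> 2 \<longrightarrow> \<bar>\<tau>\<bar> = T' \<longrightarrow>
          norm (deriv zeta_reg (Complex \<sigma> \<tau>) / zeta_reg (Complex \<sigma> \<tau>)) \<le> (C * (2 * (2 * C + 1)) + C) * (ln (T + 3))\<^sup>2)"
    proof (intro bexI conjI allI impI)
      show "T' \<in> {T-1..T}" using T'(1) by simp
      show "\<bar>Im \<rho>\<bar> \<noteq> T'" if "nontrivial_zero \<rho>" for \<rho> using gap[OF that] d by auto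
      fix \<sigma> \<tau> :: real assume \<sigma>: "-1/2 \<le> \<sigma>" "\<sigma> \<le> 2" and \<tau>: "\<bar>\<tau>\<bar> = T'"
      define z where "z = Complex \<sigma> \<tau>"
      define Q where "Q = (\<Sum>\<rho>\<in>zeros_near \<tau>. of_nat (zmult zeta_reg \<rho>) / (z - \<rho>))"
      have "Complex 2 \<tau> - z = of_real (2 - \<sigma>)" by (simp add: z_def complex_eq_iff)
      hence zb: "z \<in> cball (Complex 2 \<tau>) (5/2)" using \<sigma> by (simp only: mem_cball dist_norm norm_of_real)
      have znz: "zeta_reg z \<noteq> 0"
      proof
        assume "zeta_reg z = 0"
        hence "nontrivial_zero z" using \<sigma> by (simp add: nontrivial_zero_iff z_def)
        from gap[OF this] d \<tau> show False by (simp add: z_def)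
      qed
      have lt: "ln (\<bar>\<tau>\<bar> + 3) \<le> l" using T'(1) \<tau> T by (simp add: l_def)
      have 1: "norm (deriv zeta_reg z / zeta_reg z - Q) \<le> C * l"
        using C(3)[OF zb znz] mult_left_mono[OF lt, of C] C(1) unfolding Q_def by linarith
      have "norm Q \<le> real (\<Sum>\<rho>\<in>zeros_near \<tau>. zmult zeta_reg \<rho>) / d" unfolding Q_def
      proof (rule sum_zmult_over_distance[OF d(1)])
        fix \<rho> assume "\<rho> \<in> zeros_near \<tau>"
        from gap[OF zeros_near_strip[OF this]] have "d \<le> \<bar>Im (z - \<rho>)\<bar>" using \<tau> by (simp add: z_def)
        thus "d \<le> norm (z - \<rho>)" using abs_Im_le_cmod[of "z - \<rho>"] by linarith
      qed
      also have "\<dots> = real (\<Sum>\<rho>\<in>zeros_near \<tau>. zmult zeta_reg \<rho>) * (1 / d)" by simp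
      also have "\<dots> \<le> (C * l) * (2 * (2 * C + 1) * l)"
      proof (rule mult_mono[OF _ id])
        show "real (\<Sum>\<rho>\<in>zeros_near \<tau>. zmult zeta_reg \<rho>) \<le> C * l"
          using C(2)[of \<tau>] mult_left_mono[OF lt, of C] C(1) by linarith
      qed (use C l1 d in auto)
      finally have 2: "norm Q \<le> C * (2 * (2 * C + 1)) * l\<^sup>2" by (simp add: power2_eq_square mult_ac)
      have "C * l \<le> C * l\<^sup>2" using l1 C(1) self_le_power[of l 2] by (intro mult_left_mono) auto
      moreover have "norm (deriv zeta_reg z / zeta_reg z) \<le> norm (deriv zeta_reg z / zeta_reg z - Q) + norm Q"
        using norm_triangle_ineq[of "deriv zeta_reg z / zeta_reg z - Q" Q] by simp
      ultimately have "norm (deriv zeta_reg z / zeta_reg z) \<le> C * l\<^sup>2 + C * (2 * (2 * C + 1)) * l\<^sup>2"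
        using 1 2 by linarith
      also have "\<dots> = (C * (2 * (2 * C + 1)) + C) * l\<^sup>2" by (simp add: algebra_simps)
      finally show "norm (deriv zeta_reg (Complex \<sigma> \<tau>) / zeta_reg (Complex \<sigma> \<tau>)) \<le> (C * (2 * (2 * C + 1)) + C) * (ln (T + 3))\<^sup>2"
        by (simp only: z_def l_def)
    qed
  qed
qed

section \<open>The truncated Perron formula\<close>

text \<open>For L = ln (X / m), X times this kernel is X powr (s + 1) m powr (- s) / (s (s + 1)),
  the factor of \<Lambda>(m) in the Perron integrand.\<close>

definition perron_fun :: "real \<Rightarrow> complex \<Rightarrow> complex" where
  "perron_fun L s = exp (of_real L * s) / (s * (s + 1))"

lemma norm_perron_fun: "norm (perron_fun L s) = exp (L * Re s) / (norm s * norm (s + 1))"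
  by (simp add: perron_fun_def norm_divide norm_mult norm_exp_eq_Re)

lemma perron_fun_continuous: "0 \<notin> A \<Longrightarrow> -1 \<notin> A \<Longrightarrow> continuous_on A (perron_fun L)"
  unfolding perron_fun_def[abs_def]
  by (intro continuous_intros) (auto simp: add_eq_0_iff2)

text \<open>Only the denominator is estimated, by T^2; the exponential is integrated exactly, so
  that a long segment costs no more than a factor of order 1 / |L|. The quotient is positive for
  both signs of L.\<close>

lemma perron_horizontal:
  assumes L: "L \<noteq> 0" and T: "T > 0" "\<bar>\<tau>\<bar> = T" and pq: "p < q"
  shows "norm (contour_integral (linepath (Complex p \<tau>) (Complex q \<tau>)) (perron_fun L))
     \<le> (exp (L * q) - exp (L * p)) / (L * T\<^sup>2)"
proof -
  let ?l = "linepath (Complex p \<tau>) (Complex q \<tau>)"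
  have Im: "Im z = \<tau>" if "z \<in> closed_segment (Complex p \<tau>) (Complex q \<tau>)" for z
    using that by (auto simp: closed_segment_same_Im)
  have l: "?l x = Complex (p + x * (q - p)) \<tau>" for x
    by (simp add: linepath_def complex_eq_iff algebra_simps)
  have "continuous_on (closed_segment (Complex p \<tau>) (Complex q \<tau>)) (perron_fun L)"
    by (rule perron_fun_continuous) (use Im T in force)+
  hence ci: "perron_fun L contour_integrable_on ?l" by (rule contour_integrable_continuous_linepath)
  have bma: "Complex q \<tau> - Complex p \<tau> = of_real (q - p)" by (simp add: complex_eq_iff)
  have int: "((\<lambda>x. perron_fun L (?l x) * of_real (q - p)) has_integral contour_integral ?l (perron_fun L)) {0..1}"
    using has_contour_integral_integral[OF ci] unfolding has_contour_integral_linepath bma .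
  have hg: "((\<lambda>x. exp (L * (p + x * (q - p))) / T\<^sup>2 * (q - p)) has_integral
      (exp (L * (p + 1 * (q - p))) / (L * T\<^sup>2) - exp (L * (p + 0 * (q - p))) / (L * T\<^sup>2))) {0..1}"
    by (rule fundamental_theorem_of_calculus)
       (use L T in \<open>auto intro!: derivative_eq_intros simp: has_real_derivative_iff_has_vector_derivative[symmetric]\<close>)
  have "norm (integral {0..1} (\<lambda>x. perron_fun L (?l x) * of_real (q - p)))
     \<le> integral {0..1} (\<lambda>x. exp (L * (p + x * (q - p))) / T\<^sup>2 * (q - p))"
  proof (rule Henstock_Kurzweil_Integration.integral_norm_bound_integral)
    fix x :: real assume "x \<in> {0..1}"
    have n: "norm (Complex u \<tau>) \<ge> T" for u using abs_Im_le_cmod[of "Complex u \<tau>"] T by simp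
    have n1: "norm (Complex u \<tau> + 1) \<ge> T" for u using abs_Im_le_cmod[of "Complex u \<tau> + 1"] T by simp
    have "T * T \<le> norm (?l x) * norm (?l x + 1)" unfolding l using n n1 T by (intro mult_mono) auto
    hence "norm (perron_fun L (?l x)) \<le> exp (L * (p + x * (q - p))) / T\<^sup>2"
      unfolding norm_perron_fun using T by (intro frac_le) (auto simp: l power2_eq_square)
    thus "norm (perron_fun L (?l x) * of_real (q - p)) \<le> exp (L * (p + x * (q - p))) / T\<^sup>2 * (q - p)"
      using pq unfolding norm_mult norm_of_real by (intro mult_mono) auto
  qed (use int hg in \<open>auto simp: has_integral_iff\<close>)
  also have "\<dots> = (exp (L * q) - exp (L * p)) / (L * T\<^sup>2)"
    by (subst integral_unique[OF hg]) (simp add: diff_divide_distrib)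
  also have "integral {0..1} (\<lambda>x. perron_fun L (?l x) * of_real (q - p)) = contour_integral ?l (perron_fun L)"
    using int by (rule integral_unique)
  finally show ?thesis .
qed

lemma exp_neg_le_inverse: "u > 0 \<Longrightarrow> exp (- u) \<le> 1 / (u::real)"
proof -
  assume "u > 0"
  moreover have "u \<le> exp u" using exp_ge_add_one_self[of u] by linarith
  ultimately show ?thesis by (simp add: exp_minus field_simps)
qed

lemma perron_vertical:
  assumes T: "T > 0" and d: "D > 0" and D: "\<And>t. \<bar>t\<bar> \<le> T \<Longrightarrow> D \<le> norm (Complex p t) * norm (Complex p t + 1)"
  shows "norm (contour_integral (linepath (Complex p (-T)) (Complex p T)) (perron_fun L)) \<le> exp (L * p) / D * (2 * T)"
proof -
  have seg: "Re z = p \<and> \<bar>Im z\<bar> \<le> T" if "z \<in> closed_segment (Complex p (-T)) (Complex p T)" for z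
    using that T by (auto simp: closed_segment_same_Re closed_segment_eq_real_ivl)
  have D': "D \<le> norm z * norm (z + 1)" if "z \<in> closed_segment (Complex p (-T)) (Complex p T)" for z
    using D[of "Im z"] seg[OF that] by (metis complex.collapse)
  have "continuous_on (closed_segment (Complex p (-T)) (Complex p T)) (perron_fun L)"
    by (rule perron_fun_continuous) (use D' d in force)+
  hence ci: "perron_fun L contour_integrable_on linepath (Complex p (-T)) (Complex p T)"
    by (rule contour_integrable_continuous_linepath)
  have "Complex p T - Complex p (-T) = \<i> * of_real (2 * T)" by (simp add: complex_eq_iff)
  hence n: "norm (Complex p T - Complex p (-T)) = 2 * T"
    using T by (simp only: norm_mult norm_ii norm_of_real)
  have "norm (contour_integral (linepath (Complex p (-T)) (Complex p T)) (perron_fun L))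
     \<le> exp (L * p) / D * norm (Complex p T - Complex p (-T))"
  proof (rule has_contour_integral_bound_linepath[OF has_contour_integral_integral[OF ci]])
    fix z assume z: "z \<in> closed_segment (Complex p (-T)) (Complex p T)"
    show "norm (perron_fun L z) \<le> exp (L * p) / D"
      unfolding norm_perron_fun using seg[OF z] D'[OF z] d by (intro frac_le) auto
  qed (use d in auto)
  thus ?thesis unfolding n .
qed

text \<open>Moving the segment to the right when \<open>L \<le> 0\<close>, and to the left across the poles \<open>0\<close>
  and \<open>-1\<close> when \<open>L > 0\<close>, where the integrand decays.\<close>

lemma perron_kernel_le_0:
  assumes c: "0 < c" and T: "T > 0" and L: "L \<le> 0"
  defines "V \<equiv> contour_integral (linepath (Complex c (-T)) (Complex c T)) (perron_fun L)"
  shows "L < 0 \<Longrightarrow> norm V \<le> 4 * exp (L * c) / (T\<^sup>2 * \<bar>L\<bar>)" and "L = 0 \<Longrightarrow> norm V \<le> 4 / T"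
proof -
  define a where "a = Complex c (-T)"
  \<comment> \<open>Width T places the right edge where both |s| and |s + 1| are at least T.\<close>
  define b where "b = Complex (c + T) T"
  have cor: "Complex (Re b) (Im a) = Complex (c + T) (-T)" "Complex (Re a) (Im b) = Complex c T"
    by (simp_all add: a_def b_def)
  have box: "path_image (rectpath a b) \<subseteq> {s. Re s > 0}"
    using T c by (subst path_image_rectpath_cbox_minus_box) (auto simp: a_def b_def in_cbox_complex_iff)
  have hol: "perron_fun L holomorphic_on {s. Re s > 0}"
    unfolding perron_fun_def[abs_def] by (intro holomorphic_intros) (auto simp: add_eq_0_iff2)
  have "contour_integral (rectpath a b) (perron_fun L) = 0"
    by (intro contour_integral_unique Cauchy_theorem_convex_simple[OF hol _ _ box] convex_halfspace_Re_gt) auto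
  moreover have "continuous_on (path_image (rectpath a b)) (perron_fun L)"
    using holomorphic_on_imp_continuous_on[OF hol] box continuous_on_subset by blast
  ultimately have sum: "contour_integral (linepath a (Complex (c + T) (-T))) (perron_fun L)
     + contour_integral (linepath (Complex (c + T) (-T)) b) (perron_fun L)
     + contour_integral (linepath b (Complex c T)) (perron_fun L)
     + contour_integral (linepath (Complex c T) a) (perron_fun L) = 0"
    by (simp only: contour_integral_rectpath cor)
  have rev: "contour_integral (linepath u v) (perron_fun L) = - contour_integral (linepath v u) (perron_fun L)"
    if "Re u > 0" "Re v > 0" for u v
  proof (rule contour_integral_reverse_linepath, rule perron_fun_continuous)
    have "closed_segment u v \<subseteq> {s. Re s > 0}"
      using that by (intro closed_segment_subset convex_halfspace_Re_gt) auto
    thus "0 \<notin> closed_segment u v" "-1 \<notin> closed_segment u v" by auto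
  qed
  define H1 H2 R where "H1 = contour_integral (linepath (Complex c (-T)) (Complex (c + T) (-T))) (perron_fun L)"
    and "H2 = contour_integral (linepath (Complex c T) (Complex (c + T) T)) (perron_fun L)"
    and "R = contour_integral (linepath (Complex (c + T) (-T)) (Complex (c + T) T)) (perron_fun L)"
  have V: "V = H1 + R - H2"
    using sum rev[of "Complex c T" a] rev[of b "Complex c T"] c T
    by (simp add: H1_def H2_def R_def V_def a_def b_def algebra_simps)
  have R: "norm R \<le> exp (L * (c + T)) / T\<^sup>2 * (2 * T)" unfolding R_def
  proof (rule perron_vertical)
    fix t
    have "T \<le> norm (Complex (c + T) t)" using complex_Re_le_cmod[of "Complex (c + T) t"] c T by simp
    moreover have "T \<le> norm (Complex (c + T) t + 1)"
      using complex_Re_le_cmod[of "Complex (c + T) t + 1"] c T by simp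
    ultimately show "T\<^sup>2 \<le> norm (Complex (c + T) t) * norm (Complex (c + T) t + 1)"
      unfolding power2_eq_square using T by (intro mult_mono) auto
  qed (use T in auto)
  have Vle: "norm V \<le> norm H1 + norm R + norm H2"
    unfolding V using norm_triangle_ineq4[of "H1 + R" H2] norm_triangle_ineq[of H1 R] by linarith
  show "norm V \<le> 4 * exp (L * c) / (T\<^sup>2 * \<bar>L\<bar>)" if L0: "L < 0"
  proof -
    have h: "(exp (L * (c + T)) - exp (L * c)) / (L * T\<^sup>2) \<le> exp (L * c) / (T\<^sup>2 * \<bar>L\<bar>)"
      using L0 T mult_pos_neg[of "T\<^sup>2" L] by (simp add: divide_simps)
    have "norm H1 \<le> exp (L * c) / (T\<^sup>2 * \<bar>L\<bar>)" unfolding H1_def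
      using perron_horizontal[of L T "-T" c "c + T"] L0 T h by simp
    moreover have "norm H2 \<le> exp (L * c) / (T\<^sup>2 * \<bar>L\<bar>)" unfolding H2_def
      using perron_horizontal[of L T T c "c + T"] L0 T h by simp
    moreover have "norm R \<le> 2 * (exp (L * c) / (T\<^sup>2 * \<bar>L\<bar>))"
    proof -
      have e: "exp (L * T) \<le> 1 / (\<bar>L\<bar> * T)"
        using exp_neg_le_inverse[of "\<bar>L\<bar> * T"] L0 T mult_neg_pos[of L T] by simp
      have "exp (L * (c + T)) / T\<^sup>2 * (2 * T) = (2 * exp (L * c) / T) * exp (L * T)"
        using T by (simp add: distrib_left exp_add power2_eq_square)
      also have "\<dots> \<le> (2 * exp (L * c) / T) * (1 / (\<bar>L\<bar> * T))"
        by (intro mult_left_mono e) (use T in auto)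
      also have "\<dots> = 2 * (exp (L * c) / (T\<^sup>2 * \<bar>L\<bar>))" by (simp add: power2_eq_square mult_ac)
      finally show ?thesis using R by simp
    qed
    moreover have "v \<le> 4 * q" if "h1 \<le> q" "h2 \<le> q" "h3 \<le> 2 * q" "v \<le> h1 + h3 + h2" for v q h1 h2 h3 :: real
      using that by linarith
    ultimately have "norm V \<le> 4 * (exp (L * c) / (T\<^sup>2 * \<bar>L\<bar>))" using Vle by metis
    thus ?thesis by simp
  qed
  \<comment> \<open>Without decay of the exponential, each horizontal edge is bounded by its length
    T times 1 / T^2, and the right edge by 2 T times 1 / T^2.\<close>
  show "norm V \<le> 4 / T" if L0: "L = 0"
  proof -
    have h: "norm (contour_integral (linepath (Complex c \<tau>) (Complex (c + T) \<tau>)) (perron_fun L)) \<le> 1 / T"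
      if t: "\<bar>\<tau>\<bar> = T" for \<tau>
    proof -
      have pos: "closed_segment (Complex c \<tau>) (Complex (c + T) \<tau>) \<subseteq> {s. Re s > 0}"
        using c T by (intro closed_segment_subset convex_halfspace_Re_gt) auto
      have "norm (contour_integral (linepath (Complex c \<tau>) (Complex (c + T) \<tau>)) (perron_fun L))
         \<le> 1 / T\<^sup>2 * norm (Complex (c + T) \<tau> - Complex c \<tau>)"
      proof (rule has_contour_integral_bound_linepath)
        show "(perron_fun L has_contour_integral contour_integral (linepath (Complex c \<tau>) (Complex (c + T) \<tau>)) (perron_fun L)) (linepath (Complex c \<tau>) (Complex (c + T) \<tau>))"
          by (intro has_contour_integral_integral contour_integrable_continuous_linepath perron_fun_continuous) (use pos in auto)
        fix z assume "z \<in> closed_segment (Complex c \<tau>) (Complex (c + T) \<tau>)"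
        hence "Im z = \<tau>" by (auto simp: closed_segment_same_Im)
        hence "T \<le> norm z" "T \<le> norm (z + 1)"
          using t abs_Im_le_cmod[of z] abs_Im_le_cmod[of "z + 1"] by auto
        hence "T\<^sup>2 \<le> norm z * norm (z + 1)" unfolding power2_eq_square using T by (intro mult_mono) auto
        thus "norm (perron_fun L z) \<le> 1 / T\<^sup>2"
          unfolding norm_perron_fun L0 using T by (intro frac_le) auto
      qed auto
      also have "Complex (c + T) \<tau> - Complex c \<tau> = of_real T" by (simp add: complex_eq_iff)
      finally show ?thesis using T by (simp add: power2_eq_square)
    qed
    have "norm R \<le> 2 / T" using R L0 T by (simp add: power2_eq_square)
    moreover have "norm H1 \<le> 1 / T" "norm H2 \<le> 1 / T" unfolding H1_def H2_def using T by (auto intro!: h)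
    ultimately show ?thesis using Vle by simp
  qed
qed

lemma perron_kernel_pos:
  assumes c: "0 < c" and T: "T \<ge> 2" and L: "L > 0"
  defines "V \<equiv> contour_integral (linepath (Complex c (-T)) (Complex c T)) (perron_fun L)"
  shows "norm (V - 2 * of_real pi * \<i> * of_real (1 - exp (- L))) \<le> 6 * exp (L * c) / (T\<^sup>2 * L)"
proof -
  define a where "a = Complex (-T) (-T)"
  define b where "b = Complex c T"
  have cor: "Complex (Re b) (Im a) = Complex c (-T)" "Complex (Re a) (Im b) = Complex (-T) T"
    by (simp_all add: a_def b_def)
  have ab: "Re a \<le> Re b" "Im a \<le> Im b" using c T by (auto simp: a_def b_def)
  have in_box: "0 \<in> box a b" "-1 \<in> box a b" using c T by (auto simp: a_def b_def in_box_complex_iff)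
  have path: "0 \<notin> path_image (rectpath a b)" "-1 \<notin> path_image (rectpath a b)"
    using in_box ab by (auto simp: path_image_rectpath_cbox_minus_box)
  define e where "e = (\<lambda>s::complex. exp (of_real L * s))"
  have hol: "e holomorphic_on UNIV" unfolding e_def by (intro holomorphic_intros)
  have ci: "((\<lambda>s. e s / (s - z)) has_contour_integral (2 * pi * \<i> * e z)) (rectpath a b)"
    if "z \<in> box a b" "z \<notin> path_image (rectpath a b)" for z
  proof -
    have "path_image (rectpath a b) \<subseteq> UNIV - {z}" using that(2) by blast
    from Cauchy_integral_formula_convex_simple[OF convex_UNIV hol _ _ this]
    show ?thesis using winding_number_rectpath[OF that(1)] by simp
  qed
  \<comment> \<open>Partial fractions 1 / (s (s + 1)) = 1 / s - 1 / (s + 1), so the residues are 1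
    at 0 and -exp (-L) at -1.\<close>
  have "((\<lambda>s. e s / (s - 0) - e s / (s - (-1))) has_contour_integral (2 * pi * \<i> * e 0 - 2 * pi * \<i> * e (-1))) (rectpath a b)"
    by (intro has_contour_integral_diff ci in_box path)
  also have "2 * pi * \<i> * e 0 - 2 * pi * \<i> * e (-1) = 2 * of_real pi * \<i> * of_real (1 - exp (- L))"
    by (simp add: e_def exp_of_real[symmetric] algebra_simps)
  finally have "(perron_fun L has_contour_integral 2 * of_real pi * \<i> * of_real (1 - exp (- L))) (rectpath a b)"
  proof (rule has_contour_integral_eq)
    fix s assume "s \<in> path_image (rectpath a b)"
    hence "s \<noteq> 0" "s + 1 \<noteq> 0" using path by (auto simp: add_eq_0_iff2)
    thus "e s / (s - 0) - e s / (s - (-1)) = perron_fun L s"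
      by (simp add: perron_fun_def e_def field_simps)
  qed
  moreover have "continuous_on (path_image (rectpath a b)) (perron_fun L)"
    by (intro perron_fun_continuous path)
  ultimately have sum: "contour_integral (linepath a (Complex c (-T))) (perron_fun L)
     + contour_integral (linepath (Complex c (-T)) b) (perron_fun L)
     + contour_integral (linepath b (Complex (-T) T)) (perron_fun L)
     + contour_integral (linepath (Complex (-T) T) a) (perron_fun L) = 2 * of_real pi * \<i> * of_real (1 - exp (- L))"
    by (simp only: contour_integral_rectpath[symmetric] cor[symmetric] contour_integral_unique)
  have sub: "closed_segment b (Complex (-T) T) \<subseteq> path_image (rectpath a b)"
    "closed_segment (Complex (-T) T) a \<subseteq> path_image (rectpath a b)"
    unfolding path_image_rectpath_segments cor by blast+
  have rev: "contour_integral (linepath b (Complex (-T) T)) (perron_fun L) = - contour_integral (linepath (Complex (-T) T) b) (perron_fun L)"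
     "contour_integral (linepath (Complex (-T) T) a) (perron_fun L) = - contour_integral (linepath a (Complex (-T) T)) (perron_fun L)"
    by (rule contour_integral_reverse_linepath, rule perron_fun_continuous; use sub path in blast)+
  define H1 H2 R where "H1 = contour_integral (linepath (Complex (-T) (-T)) (Complex c (-T))) (perron_fun L)"
    and "H2 = contour_integral (linepath (Complex (-T) T) (Complex c T)) (perron_fun L)"
    and "R = contour_integral (linepath (Complex (-T) (-T)) (Complex (-T) T)) (perron_fun L)"
  have V: "V - 2 * of_real pi * \<i> * of_real (1 - exp (- L)) = R + H2 - H1"
    unfolding sum[symmetric] rev by (simp add: H1_def H2_def R_def V_def a_def b_def)
  have h: "(exp (L * c) - exp (L * (-T))) / (L * T\<^sup>2) \<le> exp (L * c) / (T\<^sup>2 * L)"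
    using L T by (simp add: divide_simps)
  have "norm H1 \<le> exp (L * c) / (T\<^sup>2 * L)" unfolding H1_def
    using perron_horizontal[of L T "-T" "-T" c] L T c h by simp
  moreover have "norm H2 \<le> exp (L * c) / (T\<^sup>2 * L)" unfolding H2_def
    using perron_horizontal[of L T T "-T" c] L T c h by simp
  moreover have "norm R \<le> 4 * (exp (L * c) / (T\<^sup>2 * L))"
  proof -
    have "norm R \<le> exp (L * (-T)) / (T * (T / 2)) * (2 * T)" unfolding R_def
    proof (rule perron_vertical)
      fix t
      have "T \<le> norm (Complex (-T) t)" using abs_Re_le_cmod[of "Complex (-T) t"] T by simp
      \<comment> \<open>On Re s = -T the factor s + 1 has modulus at least T - 1, hence at least T /
        2 because T >= 2.\<close>
      moreover have "T / 2 \<le> norm (Complex (-T) t + 1)"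
        using abs_Re_le_cmod[of "Complex (-T) t + 1"] T by simp
      ultimately show "T * (T / 2) \<le> norm (Complex (-T) t) * norm (Complex (-T) t + 1)"
        using T by (intro mult_mono) auto
    qed (use T in auto)
    also have "\<dots> = 4 / T * exp (- (L * T))" using T by simp
    also have "\<dots> \<le> 4 / T * (exp (L * c) * (1 / (L * T)))"
    proof (intro mult_left_mono)
      have "exp (- (L * T)) \<le> 1 / (L * T)" by (rule exp_neg_le_inverse) (use L T in auto)
      also have "\<dots> \<le> exp (L * c) * (1 / (L * T))"
        using L T c mult_right_mono[of 1 "exp (L * c)" "1 / (L * T)"] by simp
      finally show "exp (- (L * T)) \<le> exp (L * c) * (1 / (L * T))" .
    qed (use T in auto)
    also have "\<dots> = 4 * (exp (L * c) / (T\<^sup>2 * L))" by (simp add: power2_eq_square mult_ac)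
    finally show ?thesis .
  qed
  moreover have "norm (R + H2 - H1) \<le> norm R + norm H2 + norm H1"
    using norm_triangle_ineq4[of "R + H2" H1] norm_triangle_ineq[of R H2] by linarith
  moreover have "v \<le> 6 * q" if "h1 \<le> q" "h2 \<le> q" "h3 \<le> 4 * q" "v \<le> h3 + h2 + h1" for v q h1 h2 h3 :: real
    using that by linarith
  ultimately have "norm (R + H2 - H1) \<le> 6 * (exp (L * c) / (T\<^sup>2 * L))" by metis
  thus ?thesis unfolding V by simp
qed

section \<open>Elementary sums for the Perron error\<close>

text \<open>Each m is counted once for every n with m <= n < N, so this is the sum of \<psi>(n) over
  n < N.\<close>

definition psi1 :: "nat \<Rightarrow> real" where
  "psi1 N = (\<Sum>m\<in>{1..N}. mangoldt m * (real N - real m))"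

text \<open>The comparison of a sum with an integral in a form that telescopes; it follows from ln
  (1 - 1 / m) <= -1 / m and exp y >= 1 + y.\<close>

lemma powr_decrease_le:
  assumes d: "\<delta> > 0" and m: "m \<ge> (2::real)"
  shows "\<delta> * m powr (- (1 + \<delta>)) \<le> (m - 1) powr (- \<delta>) - m powr (- \<delta>)"
proof -
  have "1 + \<delta> / m \<le> 1 - \<delta> * ln (1 - 1 / m)"
  proof -
    have "ln (1 - 1 / m) \<le> (1 - 1 / m) - 1" using m by (intro ln_le_minus_one) simp
    hence "\<delta> * ln (1 - 1 / m) \<le> \<delta> * (- (1 / m))" using d by (intro mult_left_mono) auto
    thus ?thesis by simp
  qed
  also have "\<dots> \<le> exp (- \<delta> * ln (1 - 1 / m))" using exp_ge_add_one_self[of "- \<delta> * ln (1 - 1 / m)"] by simp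
  also have "\<dots> = (1 - 1 / m) powr (- \<delta>)" using m by (simp add: powr_def)
  finally have "m powr (- \<delta>) * (1 + \<delta> / m) \<le> m powr (- \<delta>) * (1 - 1 / m) powr (- \<delta>)"
    by (intro mult_left_mono) auto
  also have "\<dots> = (m * (1 - 1 / m)) powr (- \<delta>)" using m by (subst powr_mult) auto
  also have "m * (1 - 1 / m) = m - 1" using m by (simp add: field_simps)
  finally have "m powr (- \<delta>) + \<delta> * (m powr (- \<delta>) / m) \<le> (m - 1) powr (- \<delta>)"
    by (simp add: algebra_simps)
  moreover have "m powr (- \<delta>) / m = m powr (- (1 + \<delta>))"
  proof -
    have "- (1 + \<delta>) = - \<delta> - 1" by simp
    thus ?thesis using m by (simp only: powr_diff) simp
  qed
  ultimately show ?thesis by simp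
qed

lemma suminf_Suc_powr_le:
  assumes d: "\<delta> > 0"
  shows "(\<Sum>n. real (Suc n) powr (- (1 + \<delta>))) \<le> 1 + 1 / \<delta>"
proof (rule suminf_le_const)
  show "summable (\<lambda>n. real (Suc n) powr (- (1 + \<delta>)))" by (rule summable_Suc_powr) (use d in simp)
  have "(\<Sum>n<Suc N. real (Suc n) powr (- (1 + \<delta>))) \<le> 1 + (1 - real (Suc N) powr (- \<delta>)) / \<delta>" for N
  proof (induction N)
    case (Suc N)
    have "\<delta> * real (Suc (Suc N)) powr (- (1 + \<delta>)) \<le> real (Suc N) powr (- \<delta>) - real (Suc (Suc N)) powr (- \<delta>)"
      using powr_decrease_le[OF d, of "real (Suc (Suc N))"] by simp
    hence "real (Suc (Suc N)) powr (- (1 + \<delta>)) \<le> (real (Suc N) powr (- \<delta>) - real (Suc (Suc N)) powr (- \<delta>)) / \<delta>"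
      using d by (simp add: pos_le_divide_eq mult.commute)
    thus ?case using Suc unfolding sum.lessThan_Suc[of _ "Suc N"] by (simp add: diff_divide_distrib)
  qed simp
  moreover have "1 + (1 - real (Suc N) powr (- \<delta>)) / \<delta> \<le> 1 + 1 / \<delta>" for N
    using d by (simp add: divide_right_mono)
  ultimately have *: "(\<Sum>n<Suc N. real (Suc n) powr (- (1 + \<delta>))) \<le> 1 + 1 / \<delta>" for N
    using order_trans by blast
  show "(\<Sum>n<N. real (Suc n) powr (- (1 + \<delta>))) \<le> 1 + 1 / \<delta>" for N
    using *[of N] by (rule order_trans[rotated]) (intro sum_mono2; auto)
qed

text \<open>Half of the excess 1 / L in the exponent is spent on the logarithm, through ln n <= n^d
  / d with d = 1 / (2 L); the other half keeps the remaining sum below 1 + 1 / d.\<close>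

lemma suminf_ln_Suc_powr_le:
  assumes L: "L \<ge> (1::real)"
  shows "(\<Sum>n. ln (real (Suc n)) * real (Suc n) powr (- (1 + 1 / L))) \<le> 6 * L\<^sup>2"
proof -
  define d where "d = 1 / (2 * L)"
  have d: "d > 0" using L by (simp add: d_def)
  have s: "summable (\<lambda>n. real (Suc n) powr (- (1 + d)))" by (rule summable_Suc_powr) (use d in simp)
  have "(\<Sum>n. ln (real (Suc n)) * real (Suc n) powr (- (1 + 1 / L))) \<le> (\<Sum>n. (1 / d) * real (Suc n) powr (- (1 + d)))"
  proof (rule suminf_le)
    fix n
    have "ln (real (Suc n)) * real (Suc n) powr (- (1 + 1 / L)) \<le> (real (Suc n) powr d / d) * real (Suc n) powr (- (1 + 1 / L))"
      using ln_powr_bound[of "real (Suc n)" d] d by (intro mult_right_mono) auto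
    also have "\<dots> = (1 / d) * (real (Suc n) powr d * real (Suc n) powr (- (1 + 1 / L)))" by simp
    also have "real (Suc n) powr d * real (Suc n) powr (- (1 + 1 / L)) = real (Suc n) powr (- (1 + d))"
      unfolding powr_add[symmetric]
        using L by (intro arg_cong2[of _ _ _ _ "(powr)"]) (auto simp: d_def field_simps)
    finally show "ln (real (Suc n)) * real (Suc n) powr (- (1 + 1 / L)) \<le> (1 / d) * real (Suc n) powr (- (1 + d))" .
  next
    show "summable (\<lambda>n. ln (real (Suc n)) * real (Suc n) powr (- (1 + 1 / L)))"
      by (rule summable_ln_Suc_powr) (use L in simp)
  qed (intro summable_mult s)
  also have "\<dots> = (1 / d) * (\<Sum>n. real (Suc n) powr (- (1 + d)))" by (intro suminf_mult s)
  also have "\<dots> \<le> (1 / d) * (1 + 1 / d)" using d by (intro mult_left_mono suminf_Suc_powr_le) auto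
  also have "1 / d = 2 * L" using L by (simp add: d_def)
  also have "2 * L * (1 + 2 * L) \<le> 2 * L * (3 * L)" using L by (intro mult_left_mono) auto
  also have "\<dots> = 6 * L\<^sup>2" by (simp add: power2_eq_square)
  finally show ?thesis .
qed

lemma harmonic_le:
  assumes "N \<ge> 1"
  shows "(\<Sum>k<N. 1 / real (Suc k)) \<le> 1 + ln (real N)"
  using assms
proof (induction N rule: dec_induct)
  case (step n)
  have "ln (real n / real (Suc n)) \<le> real n / real (Suc n) - 1"
    using step by (intro ln_le_minus_one) auto
  also have "real n / real (Suc n) - 1 = - (1 / real (Suc n))" by (simp add: field_simps)
  also have "ln (real n / real (Suc n)) = ln (real n) - ln (real (Suc n))"
    using step by (subst ln_div) auto
  finally show ?case using step by simp
qed simp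

text \<open>The integers n + 1 run from 1 to 2 N - 1, symmetrically about N, so the sum consists of
  two copies of one harmonic sum.\<close>

lemma sum_inverse_distance_le:
  assumes N: "N \<ge> 1"
  shows "(\<Sum>n<2 * N - 1. if Suc n = N then 0 else 1 / \<bar>real N - real (Suc n)\<bar>) \<le> 2 * (1 + ln (real N))"
proof -
  let ?f = "\<lambda>n. if Suc n = N then 0 else 1 / \<bar>real N - real (Suc n)\<bar>"
  have "{..<2 * N - 1} = {..<N - 1} \<union> {N - 1} \<union> {N..<N + (N - 1)}" using N by auto
  moreover have "sum ?f ({..<N - 1} \<union> {N - 1} \<union> {N..<N + (N - 1)}) = sum ?f ({..<N - 1} \<union> {N - 1}) + sum ?f {N..<N + (N - 1)}"
    by (rule sum.union_disjoint) (use N in auto)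
  moreover have "sum ?f ({..<N - 1} \<union> {N - 1}) = sum ?f {..<N - 1} + sum ?f {N - 1}"
    by (rule sum.union_disjoint) auto
  ultimately have "sum ?f {..<2 * N - 1} = sum ?f {..<N - 1} + sum ?f {N - 1} + sum ?f {N..<N + (N - 1)}"
    by (simp only:)
  also have "sum ?f {N - 1} = 0" using N by simp
  also have "sum ?f {..<N - 1} = (\<Sum>k<N - 1. 1 / real (Suc (N - 1 - Suc k)))"
    by (rule sum.cong) (auto simp: of_nat_diff)
  also have "\<dots> = (\<Sum>k<N - 1. 1 / real (Suc k))" by (rule sum.nat_diff_reindex)
  also have "sum ?f {N..<N + (N - 1)} = (\<Sum>k<N - 1. 1 / real (Suc k))"
    by (rule sum.reindex_bij_witness[of _ "\<lambda>k. k + N" "\<lambda>n. n - N"]) (auto simp: of_nat_diff)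
  also have "(\<Sum>k<N - 1. 1 / real (Suc k)) + 0 + (\<Sum>k<N - 1. 1 / real (Suc k)) \<le> 2 * (\<Sum>k<N. 1 / real (Suc k))"
    using sum_mono2[of "{..<N}" "{..<N - 1}" "\<lambda>k. 1 / real (Suc k)"] by auto
  also have "\<dots> \<le> 2 * (1 + ln (real N))" using harmonic_le[OF N] by simp
  finally show ?thesis .
qed

text \<open>The inequality ln u <= u - 1, taken at the smaller value over the larger, bounds the
  logarithm from below by the relative distance.\<close>

lemma inverse_abs_ln_le:
  assumes "x > 0" "y > 0" "x \<noteq> (y::real)"
  shows "1 / \<bar>ln (x / y)\<bar> \<le> max x y / \<bar>x - y\<bar>" "ln (x / y) \<noteq> 0"
proof -
  have *: "(x - y) / x \<le> ln (x / y)" if "x > y" "y > 0" for x y :: real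
    using ln_le_minus_one[of "y / x"] that by (simp add: ln_div field_simps)
  have "\<bar>x - y\<bar> / max x y \<le> \<bar>ln (x / y)\<bar>"
  proof (cases "x > y")
    case True
    hence "0 \<le> (x - y) / x" using assms by simp
    thus ?thesis using *[OF True assms(2)] True by simp
  next
    case False
    hence xy: "y > x" using assms by simp
    have "ln (x / y) = - ln (y / x)" using assms by (simp add: ln_div)
    moreover have "0 \<le> (y - x) / y" using assms xy by simp
    ultimately show ?thesis using *[OF xy assms(1)] xy by simp
  qed
  moreover have "\<bar>x - y\<bar> / max x y > 0" using assms by simp
  ultimately show "1 / \<bar>ln (x / y)\<bar> \<le> max x y / \<bar>x - y\<bar>"
    using le_imp_inverse_le[of "\<bar>x - y\<bar> / max x y" "\<bar>ln (x / y)\<bar>"] by (simp add: inverse_eq_divide)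
  show "ln (x / y) \<noteq> 0" using \<open>\<bar>x - y\<bar> / max x y \<le> \<bar>ln (x / y)\<bar>\<close> \<open>\<bar>x - y\<bar> / max x y > 0\<close> by auto
qed

section \<open>The truncated formula for the weighted sum\<close>

definition perron_integrand :: "real \<Rightarrow> complex \<Rightarrow> complex" where
  "perron_integrand X s = mangoldt_series s * (of_real X powr (s + 1) / (s * (s + 1)))"

definition perron_coeff :: "real \<Rightarrow> real \<Rightarrow> real \<Rightarrow> complex" where
  "perron_coeff c T L = contour_integral (linepath (Complex c (-T)) (Complex c T)) (perron_fun L)"

text \<open>On the compact segment the Dirichlet series converges uniformly, which allows
  integration term by term.\<close>

lemma perron_integrand_sums:
  assumes X: "X > 0" and c: "c > 1" and T: "T > 0"
  shows "(\<lambda>n. of_real (X * mangoldt (Suc n)) * perron_coeff c T (ln (X / real (Suc n)))) sums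
     contour_integral (linepath (Complex c (-T)) (Complex c T)) (perron_integrand X)"
proof -
  let ?l = "linepath (Complex c (-T)) (Complex c T)"
  let ?S = "closed_segment (Complex c (-T)) (Complex c T)"
  define F where "F = (\<lambda>n s. of_real (X * mangoldt (Suc n)) * perron_fun (ln (X / real (Suc n))) s)"
  have Re: "Re s = c" if "s \<in> ?S" for s using that by (auto simp: closed_segment_same_Re)
  have S0: "0 \<notin> ?S" "-1 \<notin> ?S" using Re c by force+
  have Feq: "F n s = of_real X powr (s + 1) / (s * (s + 1)) * (mangoldt (Suc n) * of_nat (Suc n) powr (- s))" for n s
  proof -
    have L: "Ln (of_nat (Suc n)) = complex_of_real (ln (real (Suc n)))"
      by (metis Ln_of_real of_nat_0_less_iff of_real_of_nat_eq zero_less_Suc)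
    have "exp (of_real (ln (X / real (Suc n))) * s) = of_real X powr s * of_nat (Suc n) powr (- s)"
    proof -
      have "of_real (ln (X / real (Suc n))) * s = s * of_real (ln X) + (- s) * of_real (ln (real (Suc n)))"
        using X by (subst ln_div) (simp_all add: algebra_simps del: of_nat_Suc)
      hence "exp (of_real (ln (X / real (Suc n))) * s) = exp (s * of_real (ln X)) * exp ((- s) * of_real (ln (real (Suc n))))"
        by (simp only: exp_add)
      moreover have "of_real X powr s = exp (s * of_real (ln X))"
        using X by (simp add: powr_def Ln_of_real)
      moreover have "of_nat (Suc n) powr (- s) = exp ((- s) * of_real (ln (real (Suc n))))"
        unfolding powr_def L by (simp del: of_nat_Suc)
      ultimately show ?thesis by simp
    qed
    moreover have "of_real X powr (s + 1) = of_real X powr s * of_real X" using X by (simp add: powr_add)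
    moreover have "complex_of_real (mangoldt (Suc n)) = mangoldt (Suc n)" by simp
    ultimately show ?thesis unfolding F_def perron_fun_def of_real_mult
      by (simp del: of_nat_Suc)
  qed
  have nF: "norm (F n s) \<le> X * X powr c * (norm (mangoldt (Suc n) :: complex) * real (Suc n) powr (- c))"
    if s: "s \<in> ?S" for n s
  proof -
    have n1: "1 \<le> norm s" "1 \<le> norm (s + 1)"
      using complex_Re_le_cmod[of s] complex_Re_le_cmod[of "s + 1"] Re[OF s] c by auto
    have "1 * 1 \<le> norm s * norm (s + 1)" using n1 by (intro mult_mono) auto
    moreover have "norm (of_real X powr (s + 1)) = X * X powr c"
      using X Re[OF s] by (subst norm_powr_real_powr) (auto simp: powr_add)
    ultimately have "norm (of_real X powr (s + 1) / (s * (s + 1))) \<le> (X * X powr c) / 1"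
      unfolding norm_divide norm_mult[of s] using X by (intro frac_le) auto
    hence "norm (of_real X powr (s + 1) / (s * (s + 1))) * norm (mangoldt (Suc n) * of_nat (Suc n) powr (- s))
       \<le> X * X powr c * norm (mangoldt (Suc n) * of_nat (Suc n) powr (- s))"
      by (intro mult_right_mono) auto
    moreover have "norm (mangoldt (Suc n) * of_nat (Suc n) powr (- s)) = norm (mangoldt (Suc n) :: complex) * real (Suc n) powr (- c)"
      unfolding norm_mult norm_of_nat_Suc_powr using Re[OF s] by simp
    ultimately show ?thesis unfolding Feq norm_mult[of "of_real X powr (s + 1) / (s * (s + 1))"] by simp
  qed
  have ul: "uniform_limit ?S (\<lambda>N s. \<Sum>n<N. F n s) (\<lambda>s. \<Sum>n. F n s) sequentially"
    by (rule Weierstrass_m_test[OF nF summable_mult[OF mangoldt_summable[OF c]]])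
  have sumF: "(\<Sum>n. F n s) = perron_integrand X s" if "s \<in> ?S" for s
  proof -
    have "(\<lambda>n. F n s) sums (of_real X powr (s + 1) / (s * (s + 1)) * mangoldt_series s)"
      unfolding Feq by (intro sums_mult mangoldt_series_sums) (use Re[OF that] c in simp)
    thus ?thesis by (simp add: sums_iff perron_integrand_def mult.commute)
  qed
  have ul': "uniform_limit (path_image ?l) (\<lambda>N s. \<Sum>n<N. F n s) (perron_integrand X) sequentially"
    unfolding path_image_linepath using ul by (rule uniform_limit_cong'[THEN iffD1, rotated -1]) (use sumF in auto)
  have ciF: "F n contour_integrable_on ?l" for n
    unfolding F_def
    by (intro contour_integrable_continuous_linepath continuous_on_mult continuous_on_const perron_fun_continuous S0)
  have lim: "(\<lambda>N. contour_integral ?l (\<lambda>s. \<Sum>n<N. F n s)) \<longlonglongrightarrow> contour_integral ?l (perron_integrand X)"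
  proof (rule contour_integral_uniform_limit(2)[OF _ ul'])
    show "\<forall>\<^sub>F N in sequentially. (\<lambda>s. \<Sum>n<N. F n s) contour_integrable_on ?l"
      by (intro always_eventually allI contour_integrable_sum ciF) auto
    show "norm (vector_derivative ?l (at t)) \<le> norm (Complex c T - Complex c (-T))" for t by simp
  qed auto
  have "contour_integral ?l (\<lambda>s. \<Sum>n<N. F n s) = (\<Sum>n<N. of_real (X * mangoldt (Suc n)) * perron_coeff c T (ln (X / real (Suc n))))" for N
  proof -
    have "contour_integral ?l (\<lambda>s. \<Sum>n<N. F n s) = (\<Sum>n<N. contour_integral ?l (F n))"
      by (intro contour_integral_sum ciF) auto
    moreover have "contour_integral ?l (F n) = of_real (X * mangoldt (Suc n)) * perron_coeff c T (ln (X / real (Suc n)))" for n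
      unfolding F_def perron_coeff_def
      by (intro contour_integral_lmul contour_integrable_continuous_linepath perron_fun_continuous S0)
    ultimately show ?thesis by simp
  qed
  thus ?thesis using lim unfolding sums_def by simp
qed

text \<open>The maximum equals 1 - exp (-L) for m < X and 0 otherwise, so it covers both directions
  of the contour shift. At X = m the logarithm vanishes and only the weaker order 1 / T is
  available.\<close>

lemma perron_coeff_bound:
  assumes X: "X > 0" and m: "m > 0" and c: "c > 0" and T: "T \<ge> 2"
  shows "X \<noteq> m \<Longrightarrow> norm (perron_coeff c T (ln (X / m)) - 2 * of_real pi * \<i> * of_real (max 0 (1 - m / X))) \<le> 6 * (X / m) powr c / T\<^sup>2 * (max X m / \<bar>X - m\<bar>)"
    and "X = m \<Longrightarrow> norm (perron_coeff c T (ln (X / m)) - 2 * of_real pi * \<i> * of_real (max 0 (1 - m / X))) \<le> 4 / T"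
proof -
  define L where "L = ln (X / m)"
  have e: "exp (L * c) = (X / m) powr c" using X m by (simp add: L_def powr_def mult.commute)
  have T0: "T > 0" using T by simp
  show "norm (perron_coeff c T (ln (X / m)) - 2 * of_real pi * \<i> * of_real (max 0 (1 - m / X))) \<le> 4 / T"
    if "X = m"
  proof -
    have "L = 0" using that X by (simp add: L_def)
    from perron_kernel_le_0(2)[OF c T0 _ this] show ?thesis
      using that X \<open>L = 0\<close> by (simp add: perron_coeff_def L_def)
  qed
  assume ne: "X \<noteq> m"
  note l = inverse_abs_ln_le[OF X m ne]
  have main: "norm (perron_coeff c T L - 2 * of_real pi * \<i> * of_real (max 0 (1 - m / X))) \<le> 6 * exp (L * c) / (T\<^sup>2 * \<bar>L\<bar>)"
  proof (cases "L > 0")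
    case True
    hence "X / m > 1" using X m by (simp add: L_def)
    hence "m < X" using m by simp
    moreover have "exp (- L) = m / X" using X m by (simp add: L_def exp_minus)
    ultimately show ?thesis
      using perron_kernel_pos[OF c T True] True X by (simp add: perron_coeff_def)
  next
    case False
    hence L: "L < 0" using l(2) by (simp add: L_def)
    hence "X / m < 1" using X m by (simp add: L_def)
    hence "1 - m / X \<le> 0" using X m by simp
    hence "norm (perron_coeff c T L - 2 * of_real pi * \<i> * of_real (max 0 (1 - m / X))) = norm (perron_coeff c T L)"
      by simp
    also have "\<dots> \<le> 4 * exp (L * c) / (T\<^sup>2 * \<bar>L\<bar>)"
      unfolding perron_coeff_def by (rule perron_kernel_le_0(1)[OF c T0 _ L]) (use L in simp)
    also have "\<dots> \<le> 6 * exp (L * c) / (T\<^sup>2 * \<bar>L\<bar>)" by (intro divide_right_mono mult_right_mono) auto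
    finally show ?thesis .
  qed
  also have "6 * exp (L * c) / (T\<^sup>2 * \<bar>L\<bar>) = 6 * (X / m) powr c / T\<^sup>2 * (1 / \<bar>L\<bar>)" by (simp add: e)
  also have "\<dots> \<le> 6 * (X / m) powr c / T\<^sup>2 * (max X m / \<bar>X - m\<bar>)"
    using l(1) by (intro mult_left_mono) (auto simp: L_def)
  finally show "norm (perron_coeff c T (ln (X / m)) - 2 * of_real pi * \<i> * of_real (max 0 (1 - m / X))) \<le> 6 * (X / m) powr c / T\<^sup>2 * (max X m / \<bar>X - m\<bar>)"
    by (simp only: L_def)
qed

text \<open>The abscissa c = 1 + 1 / ln X makes X powr c equal to e X, while the majorant of the
  series at c is only of order ln^2 X. The terms are split into m = X, m between X / 2 and 2 X, and
  the rest.\<close>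

lemma perron_formula:
  assumes N: "N \<ge> 3" and T: "2 \<le> T" "T \<le> real N"
  defines "X \<equiv> real N" and "c \<equiv> 1 + 1 / ln (real N)"
  shows "norm (contour_integral (linepath (Complex c (-T)) (Complex c T)) (perron_integrand X) - 2 * of_real pi * \<i> * of_real (psi1 N))
     \<le> 700 * X\<^sup>2 * (ln X)\<^sup>2 / T\<^sup>2"
proof -
  define l where "l = ln X"
  have X: "X \<ge> 3" "X > 0" using N by (auto simp: X_def)
  have l1: "l \<ge> 1"
  proof -
    have "exp (1::real) \<le> 3" by (rule exp_le)
    thus ?thesis unfolding l_def using X by (subst ln_ge_iff) auto
  qed
  have c: "c > 1" "c \<le> 2" "c = 1 + 1 / l" using l1 by (auto simp: c_def l_def X_def)
  have T0: "T > 0" "T \<le> X" using T by (auto simp: X_def)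
  have c0: "c > 0" using c(1) by simp
  define K where "K = (\<lambda>n. perron_coeff c T (ln (X / real (Suc n))) - 2 * of_real pi * \<i> * of_real (max 0 (1 - real (Suc n) / X)))"
  have "(\<lambda>n. X * mangoldt (Suc n) * max 0 (1 - real (Suc n) / X)) sums (\<Sum>n<N. X * mangoldt (Suc n) * max 0 (1 - real (Suc n) / X))"
    by (rule sums_finite) (use X in \<open>auto simp: X_def field_simps\<close>)
  also have "(\<Sum>n<N. X * mangoldt (Suc n) * max 0 (1 - real (Suc n) / X)) = (\<Sum>n<N. mangoldt (Suc n) * (real N - real (Suc n)))"
  proof (rule sum.cong[OF refl])
    fix n assume "n \<in> {..<N}"
    hence "real (Suc n) \<le> X" by (auto simp: X_def)
    hence "max 0 (1 - real (Suc n) / X) = 1 - real (Suc n) / X" using X by (simp del: of_nat_Suc)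
    moreover have "X * (1 - real (Suc n) / X) = X - real (Suc n)" using X by (simp add: field_simps)
    ultimately show "X * mangoldt (Suc n) * max 0 (1 - real (Suc n) / X) = mangoldt (Suc n) * (real N - real (Suc n))"
      by (simp only: X_def mult.assoc mult.left_commute[of "real N"])
  qed
  also have "\<dots> = psi1 N" unfolding psi1_def
    by (rule sum.reindex_bij_witness[of _ "\<lambda>m. m - 1" Suc]) auto
  finally have "(\<lambda>n. 2 * of_real pi * \<i> * of_real (X * mangoldt (Suc n) * max 0 (1 - real (Suc n) / X))) sums (2 * of_real pi * \<i> * of_real (psi1 N))"
    by (intro sums_mult sums_of_real)
  from sums_diff[OF perron_integrand_sums[OF X(2) c(1) T0(1)] this]
  have S: "(\<lambda>n. of_real (X * mangoldt (Suc n)) * K n) sums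
     (contour_integral (linepath (Complex c (-T)) (Complex c T)) (perron_integrand X) - 2 * of_real pi * \<i> * of_real (psi1 N))"
    unfolding K_def of_real_mult[of "X * _"] by (simp only: right_diff_distrib mult_ac)
  \<comment> \<open>\<open>A\<close> belongs to m far from X (36 = 3 * 12, with e <= 3),
    \<open>B\<close> to m comparable to X (96 = 2 * 48), and \<open>D\<close> to m = X. Together
    with the sums 6 ln^2 X and 4 ln X this gives 6 * 36 + 4 * 96 = 600 from the first two and 4 from
    the last.\<close>
  define A where "A = 36 * X\<^sup>2 / T\<^sup>2"
  define B where "B = 96 * X\<^sup>2 * l / T\<^sup>2"
  define D where "D = 4 * X\<^sup>2 * l / T\<^sup>2"
  have AB: "A \<ge> 0" "B \<ge> 0" "D \<ge> 0" using l1 X by (auto simp: A_def B_def D_def)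
  define g1 where "g1 = (\<lambda>n. ln (real (Suc n)) * real (Suc n) powr (- (1 + 1 / l)))"
  define g2 where "g2 = (\<lambda>n. if Suc n = N then 0 else 1 / \<bar>real N - real (Suc n)\<bar>)"
  have g10: "g1 n \<ge> 0" for n by (simp add: g1_def)
  have g20: "g2 n \<ge> 0" for n by (simp add: g2_def)
  have Xc: "X powr c = exp 1 * X"
  proof -
    have "X powr c = exp (ln X + 1)"
      unfolding powr_def c(3) using X l1 by (simp add: l_def[symmetric] field_simps)
    thus ?thesis using X by (simp add: exp_add)
  qed
  have bound: "norm (of_real (X * mangoldt (Suc n)) * K n) \<le> A * g1 n + (B * (if n < 2 * N - 1 then g2 n else 0) + (if n = N - 1 then D else 0))" for n
  proof -
    define m where "m = real (Suc n)"
    have m: "m \<ge> 1" "m > 0" by (auto simp: m_def)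
    have Lm: "0 \<le> (mangoldt (Suc n) :: real)" "mangoldt (Suc n) \<le> ln m"
      using mangoldt_nonneg[of "Suc n"] mangoldt_le[of "Suc n"] by (simp_all add: m_def)
    have nrm: "norm (of_real (X * mangoldt (Suc n)) * K n) \<le> X * ln m * norm (K n)"
      unfolding norm_mult norm_of_real
        using X Lm by (intro mult_right_mono) (auto simp: abs_mult intro!: mult_left_mono)
    have lnm: "ln m \<ge> 0" using m by simp
    consider "Suc n = N" | "Suc n \<noteq> N" "n < 2 * N - 1" "2 * Suc n > N" | "Suc n \<noteq> N" "n \<ge> 2 * N - 1 \<or> 2 * Suc n \<le> N"
      by linarith
    thus ?thesis
    proof cases
      \<comment> \<open>Here m = X. The error is only O(1 / T), but it occurs once, and T <= X turns
        X ln X / T into X^2 ln X / T^2.\<close>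
      case 1
      hence mX: "m = X" by (simp add: m_def X_def)
      have "norm (K n) \<le> 4 / T"
        unfolding K_def m_def[symmetric]
          by (rule perron_coeff_bound(2)[OF X(2) m(2) c0 T(1)]) (simp add: mX)
      hence "X * ln m * norm (K n) \<le> X * l * (4 / T)"
        using X l1 mX by (intro mult_mono) (auto simp: l_def)
      also have "\<dots> \<le> D"
      proof -
        have "X * l * (4 / T) = 4 * X * l * T / T\<^sup>2" using T0 by (simp add: power2_eq_square)
        also have "\<dots> \<le> 4 * X * l * X / T\<^sup>2"
          using T0 X l1 by (intro divide_right_mono mult_left_mono) auto
        also have "\<dots> = D" by (simp add: D_def power2_eq_square)
        finally show ?thesis .
      qed
      finally have "norm (of_real (X * mangoldt (Suc n)) * K n) \<le> D" using nrm by linarith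
      moreover have "n = N - 1" using 1 by simp
      ultimately show ?thesis using AB g10[of n] g20[of n] by (simp add: add_nonneg_nonneg add_increasing)
    next
      case 2
      have mX: "X \<noteq> m" "m \<le> 2 * X" "X \<le> 2 * m" using 2 by (auto simp: m_def X_def)
      have Kn: "norm (K n) \<le> 6 * (X / m) powr c / T\<^sup>2 * (max X m / \<bar>X - m\<bar>)"
        unfolding K_def m_def[symmetric]
          by (rule perron_coeff_bound(1)[OF X(2) m(2) c0 T(1)]) (simp add: mX)
      have "(X / m) powr c \<le> 2 powr c" using mX m X c by (intro powr_mono2) (auto simp: divide_le_eq)
      also have "\<dots> \<le> 2 powr 2" using c by (intro powr_mono) auto
      finally have "(X / m) powr c \<le> 4" by (simp add: powr_numeral)
      hence "6 * (X / m) powr c / T\<^sup>2 * (max X m / \<bar>X - m\<bar>) \<le> 6 * 4 / T\<^sup>2 * (2 * X / \<bar>X - m\<bar>)"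
        using mX X by (intro mult_mono divide_right_mono mult_left_mono) auto
      hence Kn: "norm (K n) \<le> 48 * X / T\<^sup>2 * (1 / \<bar>X - m\<bar>)" using Kn by simp
      have "ln m \<le> ln (2 * X)" using mX m by simp
      also have "\<dots> = ln 2 + l" using X by (simp add: ln_mult l_def)
      also have "ln (2::real) \<le> 1" using ln_2_less_1 by simp
      finally have "ln m \<le> 2 * l" using l1 by simp
      hence "X * ln m * norm (K n) \<le> X * (2 * l) * (48 * X / T\<^sup>2 * (1 / \<bar>X - m\<bar>))"
        using Kn X lnm by (intro mult_mono mult_left_mono) auto
      also have "\<dots> = B * g2 n" using 2 by (simp add: B_def g2_def power2_eq_square X_def m_def)
      finally have "norm (of_real (X * mangoldt (Suc n)) * K n) \<le> B * g2 n" using nrm by linarith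
      thus ?thesis using 2 AB g10[of n] by (simp add: add_increasing add_increasing2)
    next
      case 3
      have mX: "X \<noteq> m" using 3 by (auto simp: m_def X_def)
      have far: "m \<ge> 2 * X \<or> 2 * m \<le> X" using 3(2)
      proof
        assume "n \<ge> 2 * N - 1"
        hence "Suc n \<ge> 2 * N" by linarith
        hence "m \<ge> 2 * X" unfolding m_def X_def by linarith
        thus ?thesis ..
      next
        assume "2 * Suc n \<le> N"
        hence "2 * m \<le> X" unfolding m_def X_def by linarith
        thus ?thesis ..
      qed
      have mx: "max X m / \<bar>X - m\<bar> \<le> 2"
        using far
      proof
        assume "m \<ge> 2 * X"
        thus ?thesis using X by (simp add: max_def divide_le_eq)
      next
        assume "2 * m \<le> X"
        thus ?thesis using m by (simp add: max_def divide_le_eq)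
      qed
      have "norm (K n) \<le> 6 * (X / m) powr c / T\<^sup>2 * (max X m / \<bar>X - m\<bar>)"
        unfolding K_def m_def[symmetric]
          by (rule perron_coeff_bound(1)[OF X(2) m(2) c0 T(1)]) (simp add: mX)
      also have "\<dots> \<le> 6 * (X / m) powr c / T\<^sup>2 * 2" by (intro mult_left_mono mx) auto
      also have "(X / m) powr c = exp 1 * X * m powr (- c)"
        using X m by (simp add: powr_divide Xc powr_minus_divide)
      also have "6 * (exp 1 * X * m powr (- c)) / T\<^sup>2 * 2 = exp 1 * (12 * X * m powr (- c) / T\<^sup>2)"
        by simp
      also have "\<dots> \<le> 3 * (12 * X * m powr (- c) / T\<^sup>2)" using X exp_le by (intro mult_right_mono) auto
      finally have "X * ln m * norm (K n) \<le> X * ln m * (3 * (12 * X * m powr (- c) / T\<^sup>2))"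
        using X lnm by (intro mult_left_mono) auto
      also have "\<dots> = A * g1 n" by (simp add: A_def g1_def c(3) m_def power2_eq_square)
      finally have "norm (of_real (X * mangoldt (Suc n)) * K n) \<le> A * g1 n" using nrm by linarith
      thus ?thesis using AB g20[of n] by (simp add: add_increasing2)
    qed
  qed
  have s1: "g1 sums (\<Sum>n. g1 n)" unfolding g1_def by (intro summable_sums summable_ln_Suc_powr) (use l1 in simp)
  have s2: "(\<lambda>n. if n < 2 * N - 1 then g2 n else 0) sums (\<Sum>n<2 * N - 1. g2 n)"
    using sums_If_finite_set[of "{..<2 * N - 1}" g2] by simp
  have s3: "(\<lambda>n. if n = N - 1 then D else 0) sums D" using sums_single[of "N - 1" "\<lambda>_. D"] by simp
  have "norm (contour_integral (linepath (Complex c (-T)) (Complex c T)) (perron_integrand X) - 2 * of_real pi * \<i> * of_real (psi1 N))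
     \<le> A * (\<Sum>n. g1 n) + (B * (\<Sum>n<2 * N - 1. g2 n) + D)"
    by (rule norm_sums_le[OF S _ bound]) (intro sums_add sums_mult s1 s2 s3)
  also have "\<dots> \<le> A * (6 * l\<^sup>2) + (B * (4 * l) + D)"
  proof (intro add_mono mult_left_mono AB order_refl)
    show "(\<Sum>n. g1 n) \<le> 6 * l\<^sup>2" unfolding g1_def by (rule suminf_ln_Suc_powr_le[OF l1])
    have "(\<Sum>n<2 * N - 1. g2 n) \<le> 2 * (1 + ln (real N))"
      unfolding g2_def by (rule sum_inverse_distance_le) (use N in simp)
    also have "\<dots> \<le> 4 * l" using l1 by (simp add: l_def X_def)
    finally show "(\<Sum>n<2 * N - 1. g2 n) \<le> 4 * l" .
  qed
  also have "\<dots> = (600 * l\<^sup>2 + 4 * l) * (X\<^sup>2 / T\<^sup>2)"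
    by (simp add: A_def B_def D_def power2_eq_square algebra_simps add_divide_distrib)
  also have "\<dots> \<le> (700 * l\<^sup>2) * (X\<^sup>2 / T\<^sup>2)"
  proof (intro mult_right_mono)
    have "l \<le> l\<^sup>2" using l1 self_le_power[of l 2] by simp
    thus "600 * l\<^sup>2 + 4 * l \<le> 700 * l\<^sup>2" using l1 by simp
  qed auto
  finally show ?thesis by (simp add: l_def mult_ac)
qed

section \<open>The explicit formula\<close>

lemma rectpath_Cauchy_integral:
  assumes S: "convex S" "open S" and hol: "F holomorphic_on S" and z: "z \<in> S"
    and path: "path_image (rectpath a b) \<subseteq> S" and ab: "Re a \<le> Re b" "Im a \<le> Im b"
  shows "z \<in> box a b \<Longrightarrow> ((\<lambda>s. F s / (s - z)) has_contour_integral 2 * of_real pi * \<i> * F z) (rectpath a b)"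
    and "z \<notin> cbox a b \<Longrightarrow> ((\<lambda>s. F s / (s - z)) has_contour_integral 0) (rectpath a b)"
proof -
  have int: "z \<in> interior S" using z S by (simp add: interior_open)
  show "((\<lambda>s. F s / (s - z)) has_contour_integral 2 * of_real pi * \<i> * F z) (rectpath a b)"
    if "z \<in> box a b"
  proof -
    have "path_image (rectpath a b) \<subseteq> S - {z}"
      using path that path_image_rectpath_cbox_minus_box[OF ab] by blast
    from Cauchy_integral_formula_convex_simple[OF S(1) hol int _ this]
    show ?thesis using winding_number_rectpath[OF that] by simp
  qed
  show "((\<lambda>s. F s / (s - z)) has_contour_integral 0) (rectpath a b)" if "z \<notin> cbox a b"
  proof -
    have "path_image (rectpath a b) \<subseteq> S - {z}"
      using path that path_image_rectpath_cbox_minus_box[OF ab] by blast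
    from Cauchy_integral_formula_convex_simple[OF S(1) hol int _ this]
    show ?thesis using winding_number_rectpath_outside[OF ab that] by simp
  qed
qed

text \<open>On Re s > 1 the bracket equals \<open>mangoldt_series s\<close>. In this form it makes
  sense on the whole rectangle, with the pole of zeta isolated in 1 / (s - 1).\<close>

definition explicit_integrand :: "real \<Rightarrow> complex \<Rightarrow> complex" where
  "explicit_integrand X s = (1 / (s - 1) - deriv zeta_reg s / zeta_reg s) * (of_real X powr (s + 1) / (s * (s + 1)))"

text \<open>The integrals of \<open>v(s) / (s (s - \<rho>))\<close> are split by partial fractions into two Cauchy integrals.\<close>

lemma explicit_rectangle:
  assumes X: "X > 0" and T: "T > 0" and c: "c > 1" and gap: "\<And>\<rho>. nontrivial_zero \<rho> \<Longrightarrow> \<bar>Im \<rho>\<bar> \<noteq> T"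
  shows "(explicit_integrand X has_contour_integral
     2 * of_real pi * \<i> * (of_real (X\<^sup>2 / 2) - of_real X * (1 + deriv zeta_reg 0 / zeta_reg 0)
       - (\<Sum>\<rho>\<in>zeros_upto T. of_nat (zmult zeta_reg \<rho>) * (of_real X powr (\<rho> + 1) / (\<rho> * (\<rho> + 1))))))
     (rectpath (Complex (-1/2) (-T)) (Complex c T))"
proof -
  define a where "a = Complex (-1/2) (-T)"
  define b where "b = Complex c T"
  define \<gamma> where "\<gamma> = rectpath a b"
  \<comment> \<open>Zeros are removed up to height T + 1 so that the cofactor g has no zero in the
    open convex set \<open>S\<close> around the rectangle.\<close>
  define Z where "Z = zeros_upto (T + 1)"
  define m where "m = (\<lambda>\<rho>. complex_of_nat (zmult zeta_reg \<rho>))"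
  define v where "v = (\<lambda>s::complex. of_real X powr (s + 1) / (s + 1))"
  define S0 where "S0 = {s. -1 < Re s}"
  define S where "S = {s. -1 < Re s} \<inter> {s. Im s < T + 1} \<inter> {s. Im s > - (T + 1)}"
  have ab: "Re a \<le> Re b" "Im a \<le> Im b" using T c by (auto simp: a_def b_def)
  have finZ: "finite Z" by (simp add: Z_def finite_zeros_upto)
  obtain g where g: "g holomorphic_on UNIV" "\<And>z. zeta_reg z = g z * (\<Prod>\<rho>\<in>Z. (z - \<rho>) ^ zmult zeta_reg \<rho>)" "\<And>\<rho>. \<rho> \<in> Z \<Longrightarrow> g \<rho> \<noteq> 0"
    using entire_factorization[OF zeta_reg_holomorphic zeta_reg_1 finZ] by metis
  have S0: "convex S0" "open S0" by (auto simp: S0_def convex_halfspace_Re_gt open_halfspace_Re_gt)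
  have S: "convex S" "open S"
    unfolding S_def by (auto intro!: convex_Int convex_halfspace_Re_gt convex_halfspace_Im_gt convex_halfspace_Im_lt
      open_Int open_halfspace_Re_gt open_halfspace_Im_gt open_halfspace_Im_lt)
  have Zstrip: "0 < Re \<rho>" "Re \<rho> < 1" "zeta_reg \<rho> = 0" if "\<rho> \<in> Z" for \<rho>
    using that nontrivial_zero_iff by (auto simp: Z_def zeros_upto_def nontrivial_zero_def)
  have g0: "g z \<noteq> 0" if "z \<in> S" for z
  proof
    assume "g z = 0"
    hence "zeta_reg z = 0" using g(2) by simp
    hence "nontrivial_zero z" using that by (simp add: nontrivial_zero_iff S_def)
    hence "z \<in> Z" using that by (auto simp: Z_def zeros_upto_def S_def)
    thus False using g(3) \<open>g z = 0\<close> by blast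
  qed
  have pim: "path_image \<gamma> = cbox a b - box a b"
    unfolding \<gamma>_def by (rule path_image_rectpath_cbox_minus_box[OF ab])
  have path: "path_image \<gamma> \<subseteq> S" "path_image \<gamma> \<subseteq> S0" using T
    unfolding pim by (auto simp: in_cbox_complex_iff a_def b_def S_def S0_def)
  have zp: "z \<notin> path_image \<gamma>" if "z \<in> box a b" for z using that pim by blast
  have box01: "0 \<in> box a b" "1 \<in> box a b" using T c by (auto simp: a_def b_def in_box_complex_iff)
  have S01: "0 \<in> S" "0 \<in> S0" "1 \<in> S0" using T by (auto simp: S_def S0_def)
  have vhol: "v holomorphic_on S0" unfolding v_def
    by (intro holomorphic_intros) (use X in \<open>auto simp: S0_def add_eq_0_iff2\<close>)
  have qhol: "(\<lambda>s. v s * (deriv g s / g s)) holomorphic_on S"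
    by (intro holomorphic_intros holomorphic_on_subset[OF vhol] holomorphic_on_subset[OF holomorphic_deriv[OF g(1)]] holomorphic_on_subset[OF g(1)])
       (use g0 in \<open>auto simp: S_def S0_def\<close>)
  let ?c = "2 * of_real pi * \<i>"
  note cv = rectpath_Cauchy_integral[OF S0 vhol _ path(2)[unfolded \<gamma>_def] ab, folded \<gamma>_def]
  have i0: "((\<lambda>s. v s / (s - 0)) has_contour_integral ?c * v 0) \<gamma>" by (rule cv(1)[OF S01(2) box01(1)])
  have i1: "((\<lambda>s. v s / (s - 1)) has_contour_integral ?c * v 1) \<gamma>" by (rule cv(1)[OF S01(3) box01(2)])
  have iq: "((\<lambda>s. v s * (deriv g s / g s) / (s - 0)) has_contour_integral ?c * (v 0 * (deriv g 0 / g 0))) \<gamma>"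
    unfolding \<gamma>_def by (rule rectpath_Cauchy_integral(1)[OF S qhol S01(1) path(1)[unfolded \<gamma>_def] ab box01(1)])
  \<comment> \<open>Zeros in \<open>Z\<close> that lie outside the rectangle have integral 0; the
    indicator switches them off.\<close>
  define ind where "ind = (\<lambda>\<rho>. if \<rho> \<in> zeros_upto T then 1 else 0 :: complex)"
  have Zbox: "\<rho> \<in> box a b" if "\<rho> \<in> zeros_upto T" for \<rho>
  proof -
    have nz: "nontrivial_zero \<rho>" "\<bar>Im \<rho>\<bar> \<le> T" using that by (auto simp: zeros_upto_def)
    hence "\<bar>Im \<rho>\<bar> < T" using gap[OF nz(1)] by simp
    thus ?thesis using nz(1) c by (auto simp: in_box_complex_iff a_def b_def nontrivial_zero_def)
  qed
  have ir: "((\<lambda>s. v s / (s - \<rho>)) has_contour_integral ?c * (ind \<rho> * v \<rho>)) \<gamma>" if \<rho>: "\<rho> \<in> Z" for \<rho>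
  proof -
    have \<rho>S: "\<rho> \<in> S0" using Zstrip(1)[OF \<rho>] by (simp add: S0_def)
    show ?thesis
    proof (cases "\<rho> \<in> zeros_upto T")
      case True
      from cv(1)[OF \<rho>S Zbox[OF True]] True show ?thesis by (simp add: ind_def)
    next
      case False
      hence "\<bar>Im \<rho>\<bar> > T" using \<rho> by (auto simp: Z_def zeros_upto_def)
      hence "\<rho> \<notin> cbox a b" by (auto simp: in_cbox_complex_iff a_def b_def)
      from cv(2)[OF \<rho>S this] False show ?thesis by (simp add: ind_def)
    qed
  qed
  define I where "I = (?c * v 1 - ?c * v 0) - ?c * (v 0 * (deriv g 0 / g 0))
       - (\<Sum>\<rho>\<in>Z. (m \<rho> / \<rho>) * (?c * (ind \<rho> * v \<rho>) - ?c * v 0))"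
  have tot: "((\<lambda>s. (v s / (s - 1) - v s / (s - 0)) - v s * (deriv g s / g s) / (s - 0)
       - (\<Sum>\<rho>\<in>Z. (m \<rho> / \<rho>) * (v s / (s - \<rho>) - v s / (s - 0)))) has_contour_integral I) \<gamma>"
    unfolding I_def
    by (intro has_contour_integral_diff has_contour_integral_sum has_contour_integral_lmul i0 i1 iq ir finZ)
  have ld: "deriv zeta_reg s / zeta_reg s = deriv g s / g s + (\<Sum>\<rho>\<in>Z. m \<rho> / (s - \<rho>))"
    if s: "s \<in> S" "s \<notin> Z" for s
  proof -
    have dg: "(g has_field_derivative deriv g s) (at s)"
      using g(1) by (intro holomorphic_derivI[of _ UNIV]) auto
    have sZ: "s - \<rho> \<noteq> 0" if "\<rho> \<in> Z" for \<rho> using that s by auto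
    have "((\<lambda>z. \<Prod>\<rho>\<in>Z. (z - \<rho>) ^ zmult zeta_reg \<rho>) has_field_derivative
      (\<Prod>\<rho>\<in>Z. (s - \<rho>) ^ zmult zeta_reg \<rho>) * (\<Sum>\<rho>\<in>Z. of_nat (zmult zeta_reg \<rho>) * 1 / (s - \<rho>))) (at s)"
      by (rule has_field_derivative_prod_power) (use finZ sZ in \<open>auto intro!: derivative_eq_intros\<close>)
    from has_field_derivative_mult_log_deriv[OF dg this g0[OF s(1)]]
    have "((\<lambda>z. g z * (\<Prod>\<rho>\<in>Z. (z - \<rho>) ^ zmult zeta_reg \<rho>)) has_field_derivative
      (g s * (\<Prod>\<rho>\<in>Z. (s - \<rho>) ^ zmult zeta_reg \<rho>)) * (deriv g s / g s + (\<Sum>\<rho>\<in>Z. m \<rho> / (s - \<rho>)))) (at s)"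
      by (simp only: m_def mult_1_right)
    moreover have "(\<lambda>z. g z * (\<Prod>\<rho>\<in>Z. (z - \<rho>) ^ zmult zeta_reg \<rho>)) = zeta_reg"
      using g(2) by (intro ext) metis
    ultimately have "(zeta_reg has_field_derivative zeta_reg s * (deriv g s / g s + (\<Sum>\<rho>\<in>Z. m \<rho> / (s - \<rho>)))) (at s)"
      by metis
    moreover have "zeta_reg s \<noteq> 0" unfolding g(2)[of s] using g0[OF s(1)] sZ finZ by simp
    ultimately show ?thesis by (simp add: DERIV_imp_deriv)
  qed
  have eqI: "(v s / (s - 1) - v s / (s - 0)) - v s * (deriv g s / g s) / (s - 0)
       - (\<Sum>\<rho>\<in>Z. (m \<rho> / \<rho>) * (v s / (s - \<rho>) - v s / (s - 0))) = explicit_integrand X s" if s: "s \<in> path_image \<gamma>" for s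
  proof -
    have s01: "s \<noteq> 0" "s \<noteq> 1" using s zp box01 by auto
    have sS: "s \<in> S" using s path by blast
    have sZ: "s \<notin> Z"
    proof
      assume sZ: "s \<in> Z"
      show False
      proof (cases "s \<in> zeros_upto T")
        case True
        thus False using Zbox zp s by blast
      next
        case False
        hence "\<bar>Im s\<bar> > T" using sZ by (auto simp: Z_def zeros_upto_def)
        hence "s \<notin> cbox a b" by (auto simp: in_cbox_complex_iff a_def b_def)
        thus False using s pim by blast
      qed
    qed
    have "(m \<rho> / \<rho>) * (v s / (s - \<rho>) - v s / (s - 0)) = v s / s * (m \<rho> / (s - \<rho>))" if \<rho>: "\<rho> \<in> Z" for \<rho>
    proof -
      have r0: "\<rho> \<noteq> 0" "s - \<rho> \<noteq> 0" using Zstrip(1)[OF \<rho>] sZ \<rho> by auto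
      have "v s / (s - \<rho>) - v s / (s - 0) = v s * \<rho> / (s * (s - \<rho>))"
        using s01 r0 by (simp add: field_simps)
      thus ?thesis using r0 by simp
    qed
    hence "(\<Sum>\<rho>\<in>Z. (m \<rho> / \<rho>) * (v s / (s - \<rho>) - v s / (s - 0))) = v s / s * (\<Sum>\<rho>\<in>Z. m \<rho> / (s - \<rho>))"
      unfolding sum_distrib_left by (intro sum.cong) auto
    moreover have "v s / (s - 1) - v s / (s - 0) = v s / s * (1 / (s - 1))"
      using s01 by (simp add: field_simps)
    ultimately have "(v s / (s - 1) - v s / (s - 0)) - v s * (deriv g s / g s) / (s - 0)
       - (\<Sum>\<rho>\<in>Z. (m \<rho> / \<rho>) * (v s / (s - \<rho>) - v s / (s - 0)))
       = v s / s * (1 / (s - 1) - (deriv g s / g s + (\<Sum>\<rho>\<in>Z. m \<rho> / (s - \<rho>))))"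
      by (simp add: algebra_simps)
    also have "\<dots> = explicit_integrand X s"
      unfolding ld[OF sS sZ, symmetric] explicit_integrand_def v_def by (simp add: mult_ac)
    finally show ?thesis .
  qed
  have "(explicit_integrand X has_contour_integral I) \<gamma>"
    by (rule has_contour_integral_eq[OF tot eqI])
  moreover have "I = ?c * (of_real (X\<^sup>2 / 2) - of_real X * (1 + deriv zeta_reg 0 / zeta_reg 0)
       - (\<Sum>\<rho>\<in>zeros_upto T. of_nat (zmult zeta_reg \<rho>) * (of_real X powr (\<rho> + 1) / (\<rho> * (\<rho> + 1)))))"
  proof -
    have v0: "v 0 = of_real X" "v 1 = of_real (X\<^sup>2 / 2)"
      using X by (simp_all add: v_def powr_numeral)
    have "0 \<notin> Z" using Zstrip(1)[of 0] by auto
    \<comment> \<open>Each split zero leaves a term m / \<rho> at s = 0. Combined with g'/g they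
      form the logarithmic derivative of \<open>zeta_reg\<close> at 0.\<close>
    hence h0: "deriv zeta_reg 0 / zeta_reg 0 = deriv g 0 / g 0 - (\<Sum>\<rho>\<in>Z. m \<rho> / \<rho>)"
      using ld[OF S01(1)] by (simp add: sum_negf)
    have "(\<Sum>\<rho>\<in>Z. (m \<rho> / \<rho>) * (?c * (ind \<rho> * v \<rho>) - ?c * v 0))
        = ?c * (\<Sum>\<rho>\<in>Z. ind \<rho> * (m \<rho> * (v \<rho> / \<rho>))) - ?c * v 0 * (\<Sum>\<rho>\<in>Z. m \<rho> / \<rho>)"
      unfolding sum_distrib_left sum_subtractf[symmetric] by (intro sum.cong) (auto simp: algebra_simps)
    also have "(\<Sum>\<rho>\<in>Z. ind \<rho> * (m \<rho> * (v \<rho> / \<rho>))) = (\<Sum>\<rho>\<in>zeros_upto T. m \<rho> * (v \<rho> / \<rho>))"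
      by (rule sum.mono_neutral_cong_right) (use finZ in \<open>auto simp: ind_def Z_def zeros_upto_def\<close>)
    also have "\<dots> = (\<Sum>\<rho>\<in>zeros_upto T. of_nat (zmult zeta_reg \<rho>) * (of_real X powr (\<rho> + 1) / (\<rho> * (\<rho> + 1))))"
      by (simp add: m_def v_def mult.commute)
    finally show ?thesis unfolding I_def h0 v0 by (simp add: algebra_simps)
  qed
  ultimately show ?thesis by (simp add: \<gamma>_def a_def b_def)
qed

text \<open>The residues at 1 and 0 give X^2 / 2 and a term of order X. The horizontal edges cost
  X^2 ln^2 X / T^2, like the Perron error; the left edge costs T ln X sqrt X, which T <= sqrt X
  reduces to X ln X. The rectangle has a nearby height T' <= T that avoids the zeros; the sum over
  zeros is taken with absolute values and may afterwards be extended to T.\<close>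

lemma explicit_formula:
  obtains C where "C > 0"
    "\<And>N T. N \<ge> 3 \<Longrightarrow> 3 \<le> T \<Longrightarrow> T \<le> sqrt (real N) \<Longrightarrow>
      \<bar>psi1 N - (real N)\<^sup>2 / 2\<bar> \<le> real N * (\<Sum>\<rho>\<in>zeros_upto T. real (zmult zeta_reg \<rho>) * real N powr Re \<rho> * norm \<rho> powr (-2))
         + C * ((real N)\<^sup>2 * (ln (real N))\<^sup>2 / T\<^sup>2 + real N * ln (real N))"
proof -
  obtain C1 where C1: "C1 > 0" "\<And>t. zeta_reg (Complex (-1/2) t) \<noteq> 0"
    "\<And>t. norm (deriv zeta_reg (Complex (-1/2) t) / zeta_reg (Complex (-1/2) t)) \<le> C1 * ln (\<bar>t\<bar> + 3)"
    using zeta_reg_left_line by blast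
  obtain C2 where C2: "C2 > 0"
    "\<And>T. T \<ge> 2 \<Longrightarrow> \<exists>T'\<in>{T-1..T}. (\<forall>\<rho>. nontrivial_zero \<rho> \<longrightarrow> \<bar>Im \<rho>\<bar> \<noteq> T') \<and>
       (\<forall>\<sigma> \<tau>. -1/2 \<le> \<sigma> \<longrightarrow> \<sigma> \<le> 2 \<longrightarrow> \<bar>\<tau>\<bar> = T' \<longrightarrow>
          norm (deriv zeta_reg (Complex \<sigma> \<tau>) / zeta_reg (Complex \<sigma> \<tau>)) \<le> C2 * (ln (T + 3))\<^sup>2)"
    using zeta_reg_good_height by blast
  define H where "H = norm (1 + deriv zeta_reg 0 / zeta_reg 0)"
  define C where "C = 2000 + 100 * (1 + 4 * C2) + 16 * (1 + 2 * C1) + H"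
  have C: "C > 0" using C1 C2 by (auto simp: C_def H_def intro!: add_pos_nonneg)
  have main: "\<bar>psi1 N - (real N)\<^sup>2 / 2\<bar> \<le> real N * (\<Sum>\<rho>\<in>zeros_upto T. real (zmult zeta_reg \<rho>) * real N powr Re \<rho> * norm \<rho> powr (-2))
         + C * ((real N)\<^sup>2 * (ln (real N))\<^sup>2 / T\<^sup>2 + real N * ln (real N))"
    if N: "N \<ge> 3" and T: "3 \<le> T" "T \<le> sqrt (real N)" for N T
  proof -
    define X where "X = real N"
    define l where "l = ln X"
    have X: "X \<ge> 3" "X > 0" using N by (auto simp: X_def)
    have l1: "l \<ge> 1"
    proof -
      have "exp (1::real) \<le> 3" by (rule exp_le)
      thus ?thesis unfolding l_def using X by (subst ln_ge_iff) auto
    qed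
    have sX: "sqrt X \<le> X" using X real_sqrt_le_mono[of X "X\<^sup>2"] self_le_power[of X 2] by (simp add: real_sqrt_abs)
    have TX: "T \<le> X" using T sX by (simp add: X_def)
    define c where "c = 1 + 1 / l"
    have c: "c > 1" "c \<le> 2" using l1 by (auto simp: c_def)
    obtain T' where T': "T' \<in> {T-1..T}" "\<And>\<rho>. nontrivial_zero \<rho> \<Longrightarrow> \<bar>Im \<rho>\<bar> \<noteq> T'"
      "\<And>\<sigma> \<tau>. -1/2 \<le> \<sigma> \<Longrightarrow> \<sigma> \<le> 2 \<Longrightarrow> \<bar>\<tau>\<bar> = T' \<Longrightarrow>
          norm (deriv zeta_reg (Complex \<sigma> \<tau>) / zeta_reg (Complex \<sigma> \<tau>)) \<le> C2 * (ln (T + 3))\<^sup>2"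
      using C2(2)[of T] T by auto
    have T'b: "T' \<ge> 2" "T' \<le> X" "T' \<le> T" "T' > 0" using T' T TX by auto
    \<comment> \<open>T' >= T - 1 >= 2 T / 3 because T >= 3; this lets T replace T' at the cost of a
      factor 9/4.\<close>
    have T'T: "1 / T'\<^sup>2 \<le> 9 / (4 * T\<^sup>2)"
    proof -
      have "(2 / 3 * T)\<^sup>2 \<le> T'\<^sup>2" using T' T by (intro power_mono) auto
      hence "1 / T'\<^sup>2 \<le> 1 / (2 / 3 * T)\<^sup>2" using T T'b by (intro divide_left_mono) auto
      also have "\<dots> = 9 / (4 * T\<^sup>2)" by (simp add: power2_eq_square)
      finally show ?thesis .
    qed
    have lT: "ln (T + 3) \<le> 2 * l"
    proof -
      have "X * 3 \<le> X * X" using X by (intro mult_left_mono) auto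
      moreover have "T + 3 \<le> X * 3" using TX X by linarith
      ultimately have "T + 3 \<le> X * X" by linarith
      hence "ln (T + 3) \<le> ln (X * X)" using T by (subst ln_le_cancel_iff) auto
      also have "\<dots> = 2 * l" using X by (simp add: ln_mult l_def)
      finally show ?thesis .
    qed
    define a where "a = Complex (-1/2) (-T')"
    define b where "b = Complex c T'"
    define F where "F = explicit_integrand X"
    have cor: "Complex (Re b) (Im a) = Complex c (-T')" "Complex (Re a) (Im b) = Complex (-1/2) T'"
      by (simp_all add: a_def b_def)
    have ab: "Re a \<le> Re b" "Im a \<le> Im b" using T'b c by (auto simp: a_def b_def)
    have nz: "zeta_reg s \<noteq> 0 \<and> s \<noteq> 0 \<and> s \<noteq> 1 \<and> Re s > -1" if s: "s \<in> path_image (rectpath a b)" for s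
    proof -
      have s': "s \<in> cbox a b" "s \<notin> box a b" using s path_image_rectpath_cbox_minus_box[OF ab] by auto
      have "0 \<in> box a b" "1 \<in> box a b" using T'b c by (auto simp: a_def b_def in_box_complex_iff)
      moreover have Re: "Re s \<ge> -1/2" using s' by (auto simp: in_cbox_complex_iff a_def)
      moreover have "zeta_reg s \<noteq> 0"
      proof
        assume "zeta_reg s = 0"
        hence z: "nontrivial_zero s" using Re by (simp add: nontrivial_zero_iff)
        hence "0 < Re s" "Re s < 1" by (simp_all add: nontrivial_zero_def)
        moreover have "\<bar>Im s\<bar> \<noteq> T'" using T'(2)[OF z] .
        moreover have "\<bar>Im s\<bar> \<le> T'" using s' by (auto simp: in_cbox_complex_iff a_def b_def)
        ultimately have "s \<in> box a b" using c by (auto simp: in_box_complex_iff a_def b_def)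
        thus False using s' by blast
      qed
      ultimately show ?thesis using s' by auto
    qed
    have contF: "continuous_on (path_image (rectpath a b)) F"
    proof -
      have "continuous_on UNIV (deriv zeta_reg)" "continuous_on UNIV zeta_reg"
        using holomorphic_deriv[OF zeta_reg_holomorphic] zeta_reg_holomorphic
          by (auto intro: holomorphic_on_imp_continuous_on)
      hence "continuous_on (path_image (rectpath a b)) (deriv zeta_reg)" "continuous_on (path_image (rectpath a b)) zeta_reg"
        by (auto intro: continuous_on_subset)
      moreover have "s + 1 \<noteq> 0" if "s \<in> path_image (rectpath a b)" for s
        using nz[OF that] by (auto simp: add_eq_0_iff2)
      ultimately show ?thesis unfolding F_def explicit_integrand_def[abs_def]
        by (intro continuous_intros) (use nz X in auto)
    qed
    have seg: "closed_segment a (Complex c (-T')) \<subseteq> path_image (rectpath a b)"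
       "closed_segment b (Complex (-1/2) T') \<subseteq> path_image (rectpath a b)"
       "closed_segment (Complex (-1/2) T') a \<subseteq> path_image (rectpath a b)"
      unfolding path_image_rectpath_segments cor by blast+
    have ci: "(F has_contour_integral contour_integral (linepath u w) F) (linepath u w)"
      if "closed_segment u w \<subseteq> path_image (rectpath a b)" for u w
      by (intro has_contour_integral_integral contour_integrable_continuous_linepath)
         (use that contF continuous_on_subset in blast)
    have hor: "norm (F s) \<le> 3 * X\<^sup>2 * ((1 + 4 * C2) * l\<^sup>2) / T'\<^sup>2"
      if s: "-1/2 \<le> Re s" "Re s \<le> c" "\<bar>Im s\<bar> = T'" for s
    proof -
      have n: "T' \<le> norm s" "T' \<le> norm (s + 1)" "1 \<le> norm (s - 1)"
        using abs_Im_le_cmod[of s] abs_Im_le_cmod[of "s + 1"] abs_Im_le_cmod[of "s - 1"] s T'b by auto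
      have "1 / norm (s - 1) \<le> 1 / 1" using n by (intro frac_le) auto
      hence "norm (1 / (s - 1)) \<le> 1" by (simp add: norm_divide)
      moreover have "norm (deriv zeta_reg s / zeta_reg s) \<le> C2 * (ln (T + 3))\<^sup>2"
        using T'(3)[of "Re s" "Im s"] s c by simp
      moreover have "C2 * (ln (T + 3))\<^sup>2 \<le> C2 * (2 * l)\<^sup>2"
        using lT T C2 by (intro mult_left_mono power_mono) auto
      ultimately have 1: "norm (1 / (s - 1) - deriv zeta_reg s / zeta_reg s) \<le> 1 + C2 * (2 * l)\<^sup>2"
        using norm_triangle_ineq4[of "1 / (s - 1)" "deriv zeta_reg s / zeta_reg s"] by linarith
      have "1 \<le> l\<^sup>2" using l1 by simp
      hence 1: "norm (1 / (s - 1) - deriv zeta_reg s / zeta_reg s) \<le> (1 + 4 * C2) * l\<^sup>2"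
        using 1 by (simp add: power_mult_distrib distrib_right)
      have "norm (of_real X powr (s + 1)) = X powr (Re s + 1)"
        using X by (subst norm_powr_real_powr) auto
      also have "\<dots> \<le> X powr (c + 1)" using s X by (intro powr_mono) auto
      also have "X powr (c + 1) = exp (ln X + (ln X + 1))"
      proof -
        have "(c + 1) * ln X = ln X + (ln X + 1)" using l1 by (simp add: c_def l_def field_simps)
        thus ?thesis using X by (simp add: powr_def)
      qed
      also have "\<dots> = X * (X * exp 1)" using X by (simp only: exp_add exp_ln)
      also have "\<dots> \<le> X * (X * 3)" using X exp_le by (intro mult_left_mono) auto
      finally have 2: "norm (of_real X powr (s + 1)) \<le> 3 * X\<^sup>2" by (simp add: power2_eq_square mult_ac)
      have "T' * T' \<le> norm s * norm (s + 1)" using n T'b by (intro mult_mono) auto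
      hence "norm (of_real X powr (s + 1) / (s * (s + 1))) \<le> 3 * X\<^sup>2 / T'\<^sup>2"
        unfolding norm_divide norm_mult using 2 T'b by (intro frac_le) (auto simp: power2_eq_square)
      hence "norm (F s) \<le> ((1 + 4 * C2) * l\<^sup>2) * (3 * X\<^sup>2 / T'\<^sup>2)"
        unfolding F_def explicit_integrand_def norm_mult[of "1 / (s - 1) - _"]
          using 1 C2(1) by (intro mult_mono) auto
      thus ?thesis by (simp add: mult_ac)
    qed
    define M where "M = 3 * X\<^sup>2 * ((1 + 4 * C2) * l\<^sup>2) / T'\<^sup>2"
    have M0: "M \<ge> 0" using C2(1) by (simp add: M_def)
    have len: "norm (Complex c \<tau> - Complex (-1/2) \<tau>) \<le> 3" for \<tau>
    proof -
      have "Complex c \<tau> - Complex (-1/2) \<tau> = of_real (c + 1/2)" by (simp add: complex_eq_iff)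
      hence "norm (Complex c \<tau> - Complex (-1/2) \<tau>) = \<bar>c + 1/2\<bar>" by (simp only: norm_of_real)
      thus ?thesis using c by simp
    qed
    have bot: "norm (contour_integral (linepath a (Complex c (-T'))) F) \<le> 3 * M"
    proof -
      have "norm (contour_integral (linepath a (Complex c (-T'))) F) \<le> M * norm (Complex c (-T') - a)"
      proof (rule has_contour_integral_bound_linepath[OF ci[OF seg(1)] M0])
        fix s assume "s \<in> closed_segment a (Complex c (-T'))"
        hence "Im s = - T'" "-1/2 \<le> Re s" "Re s \<le> c" using c
          by (auto simp: a_def closed_segment_same_Im closed_segment_eq_real_ivl)
        thus "norm (F s) \<le> M" unfolding M_def using T'b by (intro hor) auto
      qed
      also have "\<dots> \<le> M * 3" unfolding a_def by (intro mult_left_mono len M0)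
      finally show ?thesis by simp
    qed
    have top: "norm (contour_integral (linepath b (Complex (-1/2) T')) F) \<le> 3 * M"
    proof -
      have "norm (contour_integral (linepath b (Complex (-1/2) T')) F) \<le> M * norm (Complex (-1/2) T' - b)"
      proof (rule has_contour_integral_bound_linepath[OF ci[OF seg(2)] M0])
        fix s assume "s \<in> closed_segment b (Complex (-1/2) T')"
        hence "Im s = T'" "-1/2 \<le> Re s" "Re s \<le> c" using c
          by (auto simp: b_def closed_segment_same_Im closed_segment_eq_real_ivl)
        thus "norm (F s) \<le> M" unfolding M_def using T'b by (intro hor) auto
      qed
      also have "\<dots> \<le> M * 3" using len[of T'] M0 unfolding b_def by (intro mult_left_mono) (auto simp: norm_minus_commute)
      finally show ?thesis by simp
    qed
    define Q where "Q = sqrt X * ((1 + 2 * C1) * l) * 4"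
    have Q0: "Q \<ge> 0" using C1(1) l1 X by (simp add: Q_def)
    have left: "norm (contour_integral (linepath (Complex (-1/2) T') a) F) \<le> Q * (2 * T)"
    proof -
      have "norm (contour_integral (linepath (Complex (-1/2) T') a) F) \<le> Q * norm (a - Complex (-1/2) T')"
      proof (rule has_contour_integral_bound_linepath[OF ci[OF seg(3)] Q0])
        fix s assume "s \<in> closed_segment (Complex (-1/2) T') a"
        hence s: "Re s = -1/2" "\<bar>Im s\<bar> \<le> T'" using T'b
          by (auto simp: a_def closed_segment_same_Re closed_segment_eq_real_ivl)
        hence sc: "s = Complex (-1/2) (Im s)" by (simp add: complex_eq_iff)
        have n: "1/2 \<le> norm s" "1/2 \<le> norm (s + 1)" "1 \<le> norm (s - 1)"
          using abs_Re_le_cmod[of s] abs_Re_le_cmod[of "s + 1"] abs_Re_le_cmod[of "s - 1"] s by auto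
        have "1 / norm (s - 1) \<le> 1 / 1" using n by (intro frac_le) auto
      hence "norm (1 / (s - 1)) \<le> 1" by (simp add: norm_divide)
        moreover have "norm (deriv zeta_reg s / zeta_reg s) \<le> C1 * ln (\<bar>Im s\<bar> + 3)"
          using C1(3)[of "Im s"] sc by metis
        moreover have "C1 * ln (\<bar>Im s\<bar> + 3) \<le> C1 * (2 * l)"
        proof (rule mult_left_mono)
          have "ln (\<bar>Im s\<bar> + 3) \<le> ln (T + 3)" using s(2) T'b by simp
          thus "ln (\<bar>Im s\<bar> + 3) \<le> 2 * l" using lT by linarith
        qed (use C1 in simp)
        ultimately have "norm (1 / (s - 1) - deriv zeta_reg s / zeta_reg s) \<le> 1 + C1 * (2 * l)"
          using norm_triangle_ineq4[of "1 / (s - 1)" "deriv zeta_reg s / zeta_reg s"] by linarith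
        hence 1: "norm (1 / (s - 1) - deriv zeta_reg s / zeta_reg s) \<le> (1 + 2 * C1) * l"
          using l1 by (simp add: distrib_right)
        have "norm (of_real X powr (s + 1)) = X powr (1/2)" using X s by (subst norm_powr_real_powr) auto
        also have "\<dots> = sqrt X" using X by (simp add: powr_half_sqrt)
        finally have 2: "norm (of_real X powr (s + 1)) = sqrt X" .
        have "(1/2) * (1/2) \<le> norm s * norm (s + 1)" using n by (intro mult_mono) auto
        hence "norm (of_real X powr (s + 1) / (s * (s + 1))) \<le> sqrt X / (1/4)"
          unfolding norm_divide norm_mult 2 using X by (intro frac_le) auto
        hence "norm (F s) \<le> ((1 + 2 * C1) * l) * (sqrt X / (1/4))"
          unfolding F_def explicit_integrand_def norm_mult[of "1 / (s - 1) - _"]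
            using 1 C1(1) l1 by (intro mult_mono) auto
        thus "norm (F s) \<le> Q" by (simp add: Q_def mult_ac)
      qed
      also have "a - Complex (-1/2) T' = \<i> * of_real (- 2 * T')" by (simp add: a_def complex_eq_iff)
      also have "norm (\<i> * of_real (- 2 * T')) = 2 * T'"
        using T'b by (simp only: norm_mult norm_ii norm_of_real)
      also have "Q * (2 * T') \<le> Q * (2 * T)" using T'b Q0 by (intro mult_left_mono) auto
      finally show ?thesis .
    qed
    define ZS where "ZS = (\<Sum>\<rho>\<in>zeros_upto T'. of_nat (zmult zeta_reg \<rho>) * (of_real X powr (\<rho> + 1) / (\<rho> * (\<rho> + 1))))"
    define P where "P = of_real (X\<^sup>2 / 2) - of_real X * (1 + deriv zeta_reg 0 / zeta_reg 0) - ZS"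
    have rect: "contour_integral (rectpath a b) F = 2 * of_real pi * \<i> * P"
      unfolding F_def a_def b_def P_def ZS_def
      by (rule contour_integral_unique, rule explicit_rectangle) (use X T'b c T'(2) in auto)
    define R where "R = contour_integral (linepath (Complex c (-T')) b) F"
    have Req: "R = contour_integral (linepath (Complex c (-T')) (Complex c T')) (perron_integrand X)"
      unfolding R_def b_def
    proof (rule contour_integral_eq)
      fix s assume "s \<in> path_image (linepath (Complex c (-T')) (Complex c T'))"
      hence "Re s > 1" using c by (auto simp: closed_segment_same_Re)
      thus "F s = perron_integrand X s"
        by (simp add: F_def explicit_integrand_def perron_integrand_def zeta_reg_log_deriv)
    qed
    have "norm (R - 2 * of_real pi * \<i> * of_real (psi1 N)) \<le> 700 * X\<^sup>2 * l\<^sup>2 / T'\<^sup>2"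
      unfolding Req using perron_formula[OF N, of T'] T'b by (simp add: X_def c_def l_def)
    moreover have "2 * of_real pi * \<i> * P = contour_integral (linepath a (Complex c (-T'))) F + R
       + contour_integral (linepath b (Complex (-1/2) T')) F + contour_integral (linepath (Complex (-1/2) T') a) F"
      unfolding rect[symmetric] contour_integral_rectpath[OF contF] cor R_def ..
    ultimately have "norm (2 * of_real pi * \<i> * (P - of_real (psi1 N))) \<le> 700 * X\<^sup>2 * l\<^sup>2 / T'\<^sup>2 + 6 * M + Q * (2 * T)"
    proof -
      have tri: "norm (x + r + y + z - p) \<le> norm (r - p) + norm x + norm y + norm z" for x y z r p :: complex
        using norm_triangle_ineq[of "r - p + x + y" z] norm_triangle_ineq[of "r - p + x" y] norm_triangle_ineq[of "r - p" x]
        by (simp add: algebra_simps)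
      assume 1: "norm (R - 2 * of_real pi * \<i> * of_real (psi1 N)) \<le> 700 * X\<^sup>2 * l\<^sup>2 / T'\<^sup>2"
        and 2: "2 * of_real pi * \<i> * P = contour_integral (linepath a (Complex c (-T'))) F + R
           + contour_integral (linepath b (Complex (-1/2) T')) F + contour_integral (linepath (Complex (-1/2) T') a) F"
      show ?thesis unfolding right_diff_distrib 2
        by (rule order_trans[OF tri]) (use 1 bot top left in linarith)
    qed
    moreover have "norm (2 * of_real pi * \<i> * (P - of_real (psi1 N))) = 2 * pi * norm (P - of_real (psi1 N))"
      by (simp add: norm_mult)
    moreover have "1 * norm (P - of_real (psi1 N)) \<le> 2 * pi * norm (P - of_real (psi1 N))"
      using pi_ge_two by (intro mult_right_mono) auto
    ultimately have Pb: "norm (P - of_real (psi1 N)) \<le> 700 * X\<^sup>2 * l\<^sup>2 / T'\<^sup>2 + 6 * M + Q * (2 * T)"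
      by linarith
    have E1: "700 * X\<^sup>2 * l\<^sup>2 / T'\<^sup>2 + 6 * M \<le> (2000 + 100 * (1 + 4 * C2)) * (X\<^sup>2 * l\<^sup>2 / T\<^sup>2)"
    proof -
      have "700 * X\<^sup>2 * l\<^sup>2 / T'\<^sup>2 + 6 * M = (700 + 18 * (1 + 4 * C2)) * (X\<^sup>2 * l\<^sup>2) * (1 / T'\<^sup>2)"
        by (simp add: M_def algebra_simps add_divide_distrib)
      also have "\<dots> \<le> (700 + 18 * (1 + 4 * C2)) * (X\<^sup>2 * l\<^sup>2) * (9 / (4 * T\<^sup>2))"
        using C2(1) by (intro mult_left_mono T'T) auto
      also have "\<dots> = ((700 + 18 * (1 + 4 * C2)) * (9 / 4)) * (X\<^sup>2 * l\<^sup>2 / T\<^sup>2)" by simp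
      also have "\<dots> \<le> (2000 + 100 * (1 + 4 * C2)) * (X\<^sup>2 * l\<^sup>2 / T\<^sup>2)"
        using C2(1) by (intro mult_right_mono) auto
      finally show ?thesis .
    qed
    have E2: "Q * (2 * T) \<le> (16 * (1 + 2 * C1)) * (X * l)"
    proof -
      have "Q * (2 * T) \<le> Q * (2 * sqrt X)" using T Q0 by (intro mult_left_mono) (auto simp: X_def)
      also have "\<dots> = (8 * (1 + 2 * C1)) * ((sqrt X * sqrt X) * l)" by (simp add: Q_def mult_ac)
      also have "sqrt X * sqrt X = X" using X by simp
      also have "(8 * (1 + 2 * C1)) * (X * l) \<le> (16 * (1 + 2 * C1)) * (X * l)"
        using C1(1) X l1 by (intro mult_right_mono) auto
      finally show ?thesis .
    qed
    have ZSb: "norm ZS \<le> X * (\<Sum>\<rho>\<in>zeros_upto T. real (zmult zeta_reg \<rho>) * X powr Re \<rho> * norm \<rho> powr (-2))"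
    proof -
      have "norm ZS \<le> (\<Sum>\<rho>\<in>zeros_upto T'. X * (real (zmult zeta_reg \<rho>) * X powr Re \<rho> * norm \<rho> powr (-2)))"
        unfolding ZS_def
      proof (rule sum_norm_le)
        fix \<rho> assume "\<rho> \<in> zeros_upto T'"
        hence Re: "0 < Re \<rho>" by (auto simp: zeros_upto_def nontrivial_zero_def)
        hence n0: "norm \<rho> > 0" by auto
        have "(norm \<rho>)\<^sup>2 \<le> (norm (\<rho> + 1))\<^sup>2"
          unfolding cmod_power2 using Re by (simp add: power2_eq_square algebra_simps)
        hence n1: "norm \<rho> \<le> norm (\<rho> + 1)" by (rule power2_le_imp_le) simp
        have "norm (of_real X powr (\<rho> + 1) / (\<rho> * (\<rho> + 1))) = X * X powr Re \<rho> / (norm \<rho> * norm (\<rho> + 1))"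
          unfolding norm_divide norm_mult using X by (subst norm_powr_real_powr) (auto simp: powr_add)
        also have "\<dots> \<le> X * X powr Re \<rho> / (norm \<rho> * norm \<rho>)"
          using X n0 n1 by (intro divide_left_mono mult_left_mono) (auto intro!: mult_pos_pos)
        also have "\<dots> = X * X powr Re \<rho> * norm \<rho> powr (-2)"
          using n0 by (simp add: powr_minus_divide powr_numeral power2_eq_square)
        finally have "real (zmult zeta_reg \<rho>) * norm (of_real X powr (\<rho> + 1) / (\<rho> * (\<rho> + 1)))
           \<le> real (zmult zeta_reg \<rho>) * (X * X powr Re \<rho> * norm \<rho> powr (-2))" by (intro mult_left_mono) auto
        thus "norm (of_nat (zmult zeta_reg \<rho>) * (of_real X powr (\<rho> + 1) / (\<rho> * (\<rho> + 1)))) \<le> X * (real (zmult zeta_reg \<rho>) * X powr Re \<rho> * norm \<rho> powr (-2))"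
          unfolding norm_mult[of "of_nat _"] norm_of_nat by (simp only: mult_ac)
      qed
      also have "\<dots> \<le> (\<Sum>\<rho>\<in>zeros_upto T. X * (real (zmult zeta_reg \<rho>) * X powr Re \<rho> * norm \<rho> powr (-2)))"
        using T'b X by (intro sum_mono2 finite_zeros_upto) (auto simp: zeros_upto_def)
      finally show ?thesis by (simp only: sum_distrib_left)
    qed
    have "complex_of_real (psi1 N - X\<^sup>2 / 2) = - (P - of_real (psi1 N)) - of_real X * (1 + deriv zeta_reg 0 / zeta_reg 0) - ZS"
      by (simp add: P_def)
    hence "norm (complex_of_real (psi1 N - X\<^sup>2 / 2)) = norm (- (P - of_real (psi1 N)) - of_real X * (1 + deriv zeta_reg 0 / zeta_reg 0) - ZS)"
      by (rule arg_cong)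
    also have "\<dots> \<le> norm (P - of_real (psi1 N)) + norm (of_real X * (1 + deriv zeta_reg 0 / zeta_reg 0)) + norm ZS"
      using norm_triangle_ineq4[of "- (P - of_real (psi1 N)) - of_real X * (1 + deriv zeta_reg 0 / zeta_reg 0)" ZS]
        norm_triangle_ineq4[of "- (P - of_real (psi1 N))" "of_real X * (1 + deriv zeta_reg 0 / zeta_reg 0)"]
      unfolding norm_minus_cancel by linarith
    also have "norm (of_real X * (1 + deriv zeta_reg 0 / zeta_reg 0)) \<le> H * (X * l)"
    proof -
      have "H * X * 1 \<le> H * X * l" using X l1 by (intro mult_left_mono) (auto simp: H_def)
      thus ?thesis using X by (simp add: H_def norm_mult mult_ac)
    qed
    finally have "\<bar>psi1 N - X\<^sup>2 / 2\<bar> \<le> norm (P - of_real (psi1 N)) + H * (X * l) + norm ZS"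
      unfolding norm_of_real by linarith
    also have "\<dots> \<le> ((2000 + 100 * (1 + 4 * C2)) * (X\<^sup>2 * l\<^sup>2 / T\<^sup>2) + (16 * (1 + 2 * C1)) * (X * l)) + H * (X * l) + norm ZS"
      using Pb E1 E2 by linarith
    also have "\<dots> \<le> C * (X\<^sup>2 * l\<^sup>2 / T\<^sup>2 + X * l) + norm ZS"
    proof -
      have *: "p * u + q * w + h * w \<le> (p + q + h) * (u + w)"
        if "p \<ge> 0" "q \<ge> 0" "h \<ge> 0" "u \<ge> 0" "w \<ge> 0" for p q h u w :: real
        using that by (simp add: algebra_simps add_nonneg_nonneg)
      have "(2000 + 100 * (1 + 4 * C2)) * (X\<^sup>2 * l\<^sup>2 / T\<^sup>2) + (16 * (1 + 2 * C1)) * (X * l) + H * (X * l)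
         \<le> C * (X\<^sup>2 * l\<^sup>2 / T\<^sup>2 + X * l)"
        unfolding C_def by (rule *) (use C1(1) C2(1) X l1 in \<open>auto simp: H_def\<close>)
      thus ?thesis by simp
    qed
    finally show ?thesis using ZSb by (simp add: X_def l_def)
  qed
  show thesis by (rule that[OF C main])
qed

section \<open>The mean of the remainder term\<close>

lemma psi1_Suc: "psi1 (Suc N) = psi1 N + (\<Sum>k\<in>{1..N}. mangoldt k)"
proof -
  have "psi1 (Suc N) = (\<Sum>m\<in>{1..N}. mangoldt m * (real (Suc N) - real m))"
    unfolding psi1_def by (simp add: atLeastAtMostSuc_conv)
  also have "\<dots> = (\<Sum>m\<in>{1..N}. mangoldt m * (real N - real m) + mangoldt m)"
    by (intro sum.cong) (auto simp: algebra_simps)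
  finally show ?thesis by (simp add: sum.distrib psi1_def)
qed

lemma sum_r: "(\<Sum>n\<in>{1..M}. r (real n)) = psi1 (Suc M) - real M * real (Suc M) / 2"
proof (induction M)
  case 0
  show ?case by (simp add: psi1_def)
next
  case (Suc M)
  have "r (real (Suc M)) = (\<Sum>k\<in>{1..Suc M}. mangoldt k) - real (Suc M)"
    by (simp add: r_def psi_def del: of_nat_Suc)
  thus ?case using Suc psi1_Suc[of "Suc M"] by (simp add: atLeastAtMostSuc_conv field_simps)
qed

text \<open>With X = floor x + 1 the main terms leave X^2 / 2 - X (X - 1) / 2 = X / 2 <= x, which
  after division by x is at most 1 <= ln x. Since Re \<rho> < 1, replacing X by 2 x costs at most a
  factor 2 in each term of the sum.\<close>

lemma rbar_bound:
  obtains C where "C > 0"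
    "\<And>x T. x \<ge> 3 \<Longrightarrow> 3 \<le> T \<Longrightarrow> T \<le> sqrt x \<Longrightarrow>
      \<bar>rbar x\<bar> \<le> 4 * (\<Sum>\<rho>\<in>zeros_upto T. real (zmult zeta_reg \<rho>) * x powr Re \<rho> * norm \<rho> powr (-2))
        + C * (x * (ln x)\<^sup>2 / T\<^sup>2 + ln x)"
proof -
  obtain C where C: "C > 0"
    "\<And>N T. N \<ge> 3 \<Longrightarrow> 3 \<le> T \<Longrightarrow> T \<le> sqrt (real N) \<Longrightarrow>
      \<bar>psi1 N - (real N)\<^sup>2 / 2\<bar> \<le> real N * (\<Sum>\<rho>\<in>zeros_upto T. real (zmult zeta_reg \<rho>) * real N powr Re \<rho> * norm \<rho> powr (-2))
         + C * ((real N)\<^sup>2 * (ln (real N))\<^sup>2 / T\<^sup>2 + real N * ln (real N))"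
    using explicit_formula by blast
  have main: "\<bar>rbar x\<bar> \<le> 4 * (\<Sum>\<rho>\<in>zeros_upto T. real (zmult zeta_reg \<rho>) * x powr Re \<rho> * norm \<rho> powr (-2))
        + (16 * C + 1) * (x * (ln x)\<^sup>2 / T\<^sup>2 + ln x)" if x: "x \<ge> 3" and T: "3 \<le> T" "T \<le> sqrt x" for x T
  proof -
    define M where "M = nat \<lfloor>x\<rfloor>"
    define N where "N = Suc M"
    define X where "X = real N"
    define l where "l = ln x"
    have Mx: "real M \<le> x" "x < real M + 1" using x by (simp_all add: M_def)
    have X: "x \<le> X" "X \<le> 2 * x" "X > 0" using Mx x by (auto simp: X_def N_def)
    have N3: "N \<ge> 3" using Mx x by (simp add: N_def)
    have l1: "l \<ge> 1"
    proof -
      have "exp (1::real) \<le> 3" by (rule exp_le)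
      thus ?thesis unfolding l_def using x by (subst ln_ge_iff) auto
    qed
    have lX: "0 \<le> ln X" "ln X \<le> 2 * l"
    proof -
      show "0 \<le> ln X" using X x by simp
      have "2 * x \<le> x * x" using x by (intro mult_right_mono) auto
      hence "X \<le> x * x" using X by linarith
      hence "ln X \<le> ln (x * x)" using X x by (subst ln_le_cancel_iff) auto
      thus "ln X \<le> 2 * l" using x by (simp add: ln_mult l_def)
    qed
    have TX: "T \<le> sqrt (real N)"
      using order_trans[OF T(2) real_sqrt_le_mono[OF X(1)]] unfolding X_def by simp
    define S where "S = (\<Sum>\<rho>\<in>zeros_upto T. real (zmult zeta_reg \<rho>) * x powr Re \<rho> * norm \<rho> powr (-2))"
    have S0: "S \<ge> 0" unfolding S_def by (intro sum_nonneg) auto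
    have SX: "(\<Sum>\<rho>\<in>zeros_upto T. real (zmult zeta_reg \<rho>) * X powr Re \<rho> * norm \<rho> powr (-2)) \<le> 2 * S"
      unfolding S_def sum_distrib_left
    proof (rule sum_mono)
      fix \<rho> assume "\<rho> \<in> zeros_upto T"
      hence Re: "0 < Re \<rho>" "Re \<rho> < 1" by (auto simp: zeros_upto_def nontrivial_zero_def)
      have "X powr Re \<rho> \<le> (2 * x) powr Re \<rho>" using X Re by (intro powr_mono2) auto
      also have "\<dots> = 2 powr Re \<rho> * x powr Re \<rho>" using x by (simp add: powr_mult)
      also have "\<dots> \<le> 2 powr 1 * x powr Re \<rho>" using Re by (intro mult_right_mono powr_mono) auto
      finally have "X powr Re \<rho> \<le> 2 * x powr Re \<rho>" by simp
      hence "real (zmult zeta_reg \<rho>) * X powr Re \<rho> * norm \<rho> powr (-2) \<le> real (zmult zeta_reg \<rho>) * (2 * x powr Re \<rho>) * norm \<rho> powr (-2)"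
        by (intro mult_right_mono mult_left_mono) auto
      thus "real (zmult zeta_reg \<rho>) * X powr Re \<rho> * norm \<rho> powr (-2) \<le> 2 * (real (zmult zeta_reg \<rho>) * x powr Re \<rho> * norm \<rho> powr (-2))"
        by (simp only: mult_ac)
    qed
    have "\<bar>psi1 N - X\<^sup>2 / 2\<bar> \<le> X * (2 * S) + C * (X\<^sup>2 * (ln X)\<^sup>2 / T\<^sup>2 + X * ln X)"
      using C(2)[OF N3 T(1) TX, folded X_def] mult_left_mono[OF SX, of X] X(3) by linarith
    also have "\<dots> \<le> (2 * x) * (2 * S) + C * ((2 * x)\<^sup>2 * (2 * l)\<^sup>2 / T\<^sup>2 + (2 * x) * (2 * l))"
    proof -
      have "X * (2 * S) \<le> (2 * x) * (2 * S)" using X S0 by (intro mult_right_mono) auto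
      moreover have "X\<^sup>2 * (ln X)\<^sup>2 / T\<^sup>2 \<le> (2 * x)\<^sup>2 * (2 * l)\<^sup>2 / T\<^sup>2"
        using X lX by (intro divide_right_mono mult_mono power_mono) auto
      moreover have "X * ln X \<le> (2 * x) * (2 * l)" using X lX by (intro mult_mono) auto
      ultimately show ?thesis using C(1) by (intro add_mono mult_left_mono) auto
    qed
    finally have P: "\<bar>psi1 N - X\<^sup>2 / 2\<bar> \<le> x * (4 * S + C * (16 * (x * l\<^sup>2 / T\<^sup>2) + 4 * l))"
      by (simp add: power2_eq_square algebra_simps)
    have "(\<Sum>n\<in>{1..M}. r (real n)) = (psi1 N - X\<^sup>2 / 2) + X / 2"
      unfolding sum_r by (simp add: N_def X_def power2_eq_square field_simps)
    hence "\<bar>\<Sum>n\<in>{1..M}. r (real n)\<bar> \<le> x * (4 * S + C * (16 * (x * l\<^sup>2 / T\<^sup>2) + 4 * l)) + x * 1"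
      using P X by linarith
    also have "\<dots> = x * (4 * S + C * (16 * (x * l\<^sup>2 / T\<^sup>2) + 4 * l) + 1)" by (simp only: distrib_left)
    finally have "\<bar>rbar x\<bar> \<le> 4 * S + C * (16 * (x * l\<^sup>2 / T\<^sup>2) + 4 * l) + 1"
      using x by (simp add: rbar_def M_def abs_mult pos_divide_le_eq mult.commute)
    also have "\<dots> \<le> 4 * S + (16 * C + 1) * (x * l\<^sup>2 / T\<^sup>2 + l)"
    proof -
      have "C * (16 * Q + 4 * l) + 1 \<le> (16 * C + 1) * (Q + l)" if "0 \<le> Q" for Q
      proof -
        have "0 \<le> C * l" using l1 C(1) by simp
        thus ?thesis using l1 that by (simp add: algebra_simps)
      qed
      moreover have "0 \<le> x * l\<^sup>2 / T\<^sup>2" using x by simp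
      ultimately show ?thesis by (simp only: add.assoc add_left_mono)
    qed
    finally show ?thesis by (simp only: S_def l_def)
  qed
  show thesis by (rule that[OF _ main]) (use C in simp)
qed

text \<open>Finitely many zeros have |Im \<rho>| <= 1, none of them is 0, and all others have
  modulus at least 1. This bounds the factor |\<rho>|^(-1/2) for low zeros.\<close>

lemma nontrivial_zero_norm_bound:
  obtains d where "d > 0" "\<And>\<rho>. nontrivial_zero \<rho> \<Longrightarrow> d \<le> norm \<rho>"
proof
  let ?S = "insert 1 (norm ` zeros_upto 1)"
  have fin: "finite ?S" using finite_zeros_upto by simp
  show "Min ?S > 0"
  proof -
    have "\<forall>y\<in>?S. y > 0" by (auto simp: zeros_upto_def nontrivial_zero_def)
    thus ?thesis using fin by (subst Min_gr_iff) auto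
  qed
  fix \<rho> assume nz: "nontrivial_zero \<rho>"
  show "Min ?S \<le> norm \<rho>"
  proof (cases "\<bar>Im \<rho>\<bar> \<le> 1")
    case True
    thus ?thesis using nz fin by (intro Min_le) (auto simp: zeros_upto_def)
  next
    case False
    hence "1 \<le> norm \<rho>" using abs_Im_le_cmod[of \<rho>] by linarith
    moreover have "Min ?S \<le> 1" using fin by (intro Min_le) auto
    ultimately show ?thesis by linarith
  qed
qed

text \<open>Of |\<rho>|^(-2) the part with exponent -3/2 pays for convergence. The part with
  exponent -1/2 stays with x powr Re \<rho>: one final bound estimates it by a constant, the other
  plays it against the zero-free region.\<close>

lemma zeros_sum_le:
  assumes K: "(\<Sum>\<rho>\<in>zeros_upto T. real (zmult zeta_reg \<rho>) * norm \<rho> powr (- 3/2)) \<le> K"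
    and B: "B \<ge> 0" "\<And>\<rho>. \<rho> \<in> zeros_upto T \<Longrightarrow> x powr Re \<rho> * norm \<rho> powr (- 1/2) \<le> B"
  shows "(\<Sum>\<rho>\<in>zeros_upto T. real (zmult zeta_reg \<rho>) * x powr Re \<rho> * norm \<rho> powr (-2)) \<le> B * K"
proof -
  have "(\<Sum>\<rho>\<in>zeros_upto T. real (zmult zeta_reg \<rho>) * x powr Re \<rho> * norm \<rho> powr (-2))
     \<le> (\<Sum>\<rho>\<in>zeros_upto T. B * (real (zmult zeta_reg \<rho>) * norm \<rho> powr (- 3/2)))"
  proof (rule sum_mono)
    fix \<rho> assume \<rho>: "\<rho> \<in> zeros_upto T"
    have "norm \<rho> powr (-2) = norm \<rho> powr (- 1/2) * norm \<rho> powr (- 3/2)"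
      unfolding powr_add[symmetric] by simp
    hence "real (zmult zeta_reg \<rho>) * x powr Re \<rho> * norm \<rho> powr (-2)
      = (x powr Re \<rho> * norm \<rho> powr (- 1/2)) * (real (zmult zeta_reg \<rho>) * norm \<rho> powr (- 3/2))"
      by simp
    also have "\<dots> \<le> B * (real (zmult zeta_reg \<rho>) * norm \<rho> powr (- 3/2))"
      by (intro mult_right_mono B(2)[OF \<rho>]) auto
    finally show "real (zmult zeta_reg \<rho>) * x powr Re \<rho> * norm \<rho> powr (-2) \<le> B * (real (zmult zeta_reg \<rho>) * norm \<rho> powr (- 3/2))" .
  qed
  also have "\<dots> \<le> B * K" unfolding sum_distrib_left[symmetric] by (rule mult_left_mono[OF K B(1)])
  finally show ?thesis .
qed

section \<open>The bound in terms of the zeros up to a given height\<close>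

lemma le_eta:
  assumes "nontrivial_zero \<rho>" "\<bar>Im \<rho>\<bar> \<le> x powr (1/4) * ln x"
  shows "Re \<rho> \<le> eta x"
  unfolding eta_def
proof (rule cSup_upper)
  show "bdd_above {Re \<rho> |\<rho>. nontrivial_zero \<rho> \<and> \<bar>Im \<rho>\<bar> \<le> x powr (1/4) * ln x}"
    by (rule bdd_aboveI[of _ 1]) (auto simp: nontrivial_zero_def)
qed (use assms in blast)

lemma rbar_le_eta: "\<exists>C. \<forall>\<^sub>F x in at_top. \<bar>rbar x\<bar> \<le> C * x powr (eta x)"
proof -
  obtain C where C: "C > 0"
    "\<And>x T. x \<ge> 3 \<Longrightarrow> 3 \<le> T \<Longrightarrow> T \<le> sqrt x \<Longrightarrow>
      \<bar>rbar x\<bar> \<le> 4 * (\<Sum>\<rho>\<in>zeros_upto T. real (zmult zeta_reg \<rho>) * x powr Re \<rho> * norm \<rho> powr (-2))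
        + C * (x * (ln x)\<^sup>2 / T\<^sup>2 + ln x)"
    using rbar_bound by blast
  obtain K where K: "K > 0" "\<And>T. (\<Sum>\<rho>\<in>zeros_upto T. real (zmult zeta_reg \<rho>) * norm \<rho> powr (- 3/2)) \<le> K"
    using zeros_weighted_sum_bounded by blast
  obtain d where d: "d > 0" "\<And>\<rho>. nontrivial_zero \<rho> \<Longrightarrow> d \<le> norm \<rho>"
    using nontrivial_zero_norm_bound by blast
  obtain \<rho>0 where \<rho>0: "nontrivial_zero \<rho>0" "Re \<rho>0 \<ge> 1 / 2"
    using exists_nontrivial_zero_ge_half by blast
  define D where "D = d powr (- 1/2)"
  have "eventually (\<lambda>x::real. x powr (1/4) * ln x \<ge> 3) at_top" by real_asymp
  moreover have "eventually (\<lambda>x::real. x powr (1/4) * ln x \<le> sqrt x) at_top" by real_asymp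
  moreover have "eventually (\<lambda>x::real. ln x \<le> x powr (1/2)) at_top" by real_asymp
  \<comment> \<open>From here on \<rho>0 belongs to the set that defines \<open>eta\<close>, so eta
    x >= 1/2.\<close>
  moreover have "eventually (\<lambda>x::real. x powr (1/4) * ln x \<ge> \<bar>Im \<rho>0\<bar>) at_top" by real_asymp
  ultimately have "\<forall>\<^sub>F x in at_top. \<bar>rbar x\<bar> \<le> (4 * (D * K) + 2 * C) * x powr (eta x)"
    using eventually_ge_at_top[of 3]
  proof eventually_elim
    case (elim x)
    \<comment> \<open>The height in the definition of \<open>eta\<close>, so every zero that enters
      the sum has real part at most eta x.\<close>
    define T where "T = x powr (1/4) * ln x"
    have eta: "1 / 2 \<le> eta x" using le_eta[OF \<rho>0(1), of x] elim \<rho>0(2) by linarith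
    have B: "x powr Re \<rho> * norm \<rho> powr (- 1/2) \<le> x powr (eta x) * D" if \<rho>: "\<rho> \<in> zeros_upto T" for \<rho>
    proof (intro mult_mono)
      have "Re \<rho> \<le> eta x" using le_eta[of \<rho> x] \<rho> by (auto simp: zeros_upto_def T_def)
      thus "x powr Re \<rho> \<le> x powr (eta x)" using elim by (intro powr_mono) auto
      show "norm \<rho> powr (- 1/2) \<le> D"
        unfolding D_def using d \<rho> by (intro powr_mono2') (auto simp: zeros_upto_def)
    qed auto
    have s1: "(\<Sum>\<rho>\<in>zeros_upto T. real (zmult zeta_reg \<rho>) * x powr Re \<rho> * norm \<rho> powr (-2)) \<le> (x powr (eta x) * D) * K"
      by (rule zeros_sum_le[OF K(2) _ B]) (simp_all add: D_def)
    \<comment> \<open>The logarithm in T cancels ln^2 x exactly and leaves x / x^(1/2).\<close>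
    have s2: "x * (ln x)\<^sup>2 / T\<^sup>2 = x powr (1/2)"
    proof -
      have x0: "x > 0" "ln x \<noteq> 0" using elim by auto
      have "T\<^sup>2 = x powr (1/2) * (ln x)\<^sup>2"
        unfolding T_def power_mult_distrib using x0 by (simp add: power2_eq_square flip: powr_add)
      moreover have "x = x powr (1/2) * x powr (1/2)" using x0 by (simp flip: powr_add)
      ultimately show ?thesis using x0 by (simp add: field_simps)
    qed
    have s3: "\<bar>rbar x\<bar> \<le> 4 * (\<Sum>\<rho>\<in>zeros_upto T. real (zmult zeta_reg \<rho>) * x powr Re \<rho> * norm \<rho> powr (-2))
        + C * (x * (ln x)\<^sup>2 / T\<^sup>2 + ln x)"
      by (rule C(2)) (use elim in \<open>auto simp: T_def\<close>)
    note s3[unfolded s2]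
    moreover have "C * (x powr (1/2) + ln x) \<le> C * (2 * x powr (eta x))"
    proof (rule mult_left_mono)
      have "x powr (1/2) \<le> x powr (eta x)" using eta elim by (intro powr_mono) auto
      thus "x powr (1/2) + ln x \<le> 2 * x powr (eta x)" using elim by linarith
    qed (use C in simp)
    ultimately have "\<bar>rbar x\<bar> \<le> 4 * ((x powr (eta x) * D) * K) + C * (2 * x powr (eta x))"
      using s1 by linarith
    thus ?case by (simp add: algebra_simps)
  qed
  thus ?thesis by blast
qed

section \<open>The bound from a zero-free region\<close>

text \<open>\<open>theta_tail\<close> is real, so \<open>Xi\<close> commutes with conjugation. This
  is for zeros below the real axis, since the zero-free region is assumed only for t >= T0.\<close>

lemma nontrivial_zero_cnj:
  assumes "nontrivial_zero \<rho>"
  shows "nontrivial_zero (cnj \<rho>)"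
proof -
  have *: "indicator {0..} v *\<^sub>R xi_integrand (cnj s) v = cnj (indicator {0..} v *\<^sub>R xi_integrand s v)" for s v
    unfolding xi_integrand_def by (simp add: exp_cnj)
  have "xi_integral (cnj s) = cnj (xi_integral s)" for s
    unfolding xi_integral_def * by (rule Bochner_Integration.integral_cnj)
  hence "Xi (cnj s) = cnj (Xi s)" for s by (simp add: Xi_def)
  thus ?thesis using assms unfolding nontrivial_zero_iff by (auto simp: zeta_reg_zero_iff_Xi)
qed

text \<open>The case \<open>A < u\<close> is the arithmetic-geometric mean inequality for \<open>u / 2\<close> and \<open>2 A\<^sup>2 / u\<close>.\<close>

lemma exponent_balance:
  assumes A: "A > 0" and u: "u > (0::real)"
  shows "2 * A \<le> u / 2 + 2 * A powr (5/3) * u powr (- 2/3)"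
proof (cases "u \<le> A")
  case True
  have "A = A powr (5/3) * A powr (- 2/3)" using A by (simp flip: powr_add)
  also have "\<dots> \<le> A powr (5/3) * u powr (- 2/3)" using True u by (intro mult_left_mono powr_mono2') auto
  finally show ?thesis using u by simp
next
  case False
  have "A powr 2 * u powr (-1) = A powr (5/3) * A powr (1/3) * u powr (-1)" by (simp flip: powr_add)
  also have "\<dots> \<le> A powr (5/3) * u powr (1/3) * u powr (-1)"
    using False A by (intro mult_right_mono mult_left_mono powr_mono2) auto
  also have "\<dots> = A powr (5/3) * (u powr (1/3) * u powr (-1))" by simp
  also have "u powr (1/3) * u powr (-1) = u powr (- 2/3)" unfolding powr_add[symmetric] by simp
  also have "A powr 2 * u powr (-1) = A\<^sup>2 / u" using A u by (simp add: powr_minus_divide powr_numeral)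
  finally have 1: "A\<^sup>2 / u \<le> A powr (5/3) * u powr (- 2/3)" .
  have "0 \<le> (u - 2 * A)\<^sup>2 / (2 * u)" using u by simp
  also have "\<dots> = u / 2 + 2 * (A\<^sup>2 / u) - 2 * A" using u by (simp add: power2_eq_square field_simps)
  finally show ?thesis using 1 by linarith
qed

text \<open>With L = ln x and \<open>A = a * U x\<close>, the equation 2 A^(5/3) = c0 L (3/5 ln
  L)^(-1/3) holds, so \<open>exponent_balance\<close> applies to the zero-free width at every height
  exp u. The minimum there is about 2.25 A, so the saving 2 A is reached with some room. Zeros of
  bounded height are treated separately.\<close>

lemma rbar_le_zero_free_region:
  assumes c0: "c0 > (0::real)"
    and free: "\<And>\<sigma> t. t \<ge> T0 \<Longrightarrow> \<sigma> \<ge> 1 - c0 * (ln t ^ 2 * ln (ln t)) powr (-1/3) \<Longrightarrow> zeta (Complex \<sigma> t) \<noteq> 0"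
  defines "c1 \<equiv> c0 powr (3/5) * (3/5) powr (-1/5)"
  shows "\<exists>C. \<forall>\<^sub>F x in at_top. \<bar>rbar x\<bar> \<le>
     C * x * exp (- (2 powr (2/5)) * c1 * ln x powr (3/5) * ln (ln x) powr (-1/5))"
proof -
  obtain C where C: "C > 0"
    "\<And>x T. x \<ge> 3 \<Longrightarrow> 3 \<le> T \<Longrightarrow> T \<le> sqrt x \<Longrightarrow>
      \<bar>rbar x\<bar> \<le> 4 * (\<Sum>\<rho>\<in>zeros_upto T. real (zmult zeta_reg \<rho>) * x powr Re \<rho> * norm \<rho> powr (-2))
        + C * (x * (ln x)\<^sup>2 / T\<^sup>2 + ln x)"
    using rbar_bound by blast
  obtain K where K: "K > 0" "\<And>T. (\<Sum>\<rho>\<in>zeros_upto T. real (zmult zeta_reg \<rho>) * norm \<rho> powr (- 3/2)) \<le> K"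
    using zeros_weighted_sum_bounded by blast
  obtain d where d: "d > 0" "\<And>\<rho>. nontrivial_zero \<rho> \<Longrightarrow> d \<le> norm \<rho>"
    using nontrivial_zero_norm_bound by blast
  define D where "D = max 1 (d powr (- 1/2))"
  \<comment> \<open>The one scaling for which 2 a is the constant of the claim; together with the
    formula for \<open>c1\<close> it makes 2 a^(5/3) equal to c0 (3/5)^(-1/3).\<close>
  define a where "a = 2 powr (- 3/5) * c1"
  have c1: "c1 > 0" using c0 by (simp add: c1_def)
  have a: "a > 0" using c1 by (simp add: a_def)
  have a2: "2 * a = 2 powr (2/5) * c1"
  proof -
    have "2 * 2 powr (- 3/5) = (2::real) powr 1 * 2 powr (- 3/5)" by simp
    also have "\<dots> = 2 powr (2/5)" unfolding powr_add[symmetric] by simp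
    finally show ?thesis by (simp add: a_def)
  qed
  have a53: "2 * a powr (5/3) = c0 * (3/5) powr (- 1/3)"
  proof -
    have "a powr (5/3) = 2 powr (- 1) * (c0 powr 1 * (3/5) powr (- 1/3))"
      unfolding a_def c1_def using c0 by (simp add: powr_mult powr_powr)
    thus ?thesis using c0 by (simp add: powr_minus_divide)
  qed
  define U where "U = (\<lambda>x::real. ln x powr (3/5) * ln (ln x) powr (- 1/5))"
  \<comment> \<open>Above exp (exp 1) the iterated logarithm of the height is at least 1, so
    negative powers of it are monotone.\<close>
  define T1 where "T1 = max T0 (exp (exp 1))"
  \<comment> \<open>Only finitely many zeros lie below height T1, all with real part less than 1, so
    they stay a fixed distance from the line; the inserted 0 keeps the maximum defined. The saving
    x^\<delta> eventually exceeds exp (2 a U).\<close>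
  obtain \<delta> where \<delta>: "\<delta> > 0" "\<And>\<rho>. \<rho> \<in> zeros_upto T1 \<Longrightarrow> Re \<rho> \<le> 1 - \<delta>"
  proof
    let ?S = "insert 0 (Re ` zeros_upto T1)"
    have fin: "finite ?S" using finite_zeros_upto by simp
    have "Max ?S < 1" using fin by (subst Max_less_iff) (auto simp: zeros_upto_def nontrivial_zero_def)
    thus "1 - Max ?S > 0" by simp
    show "Re \<rho> \<le> 1 - (1 - Max ?S)" if "\<rho> \<in> zeros_upto T1" for \<rho> using fin that by simp
  qed
  have "eventually (\<lambda>x. exp (2 * a * U x) \<ge> 3) at_top" unfolding U_def using a by real_asymp
  moreover have "eventually (\<lambda>x. exp (2 * a * U x) \<le> sqrt x) at_top"
    unfolding U_def using a by real_asymp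
  moreover have "eventually (\<lambda>x. (ln x)\<^sup>2 \<le> exp (2 * a * U x)) at_top"
    unfolding U_def using a by real_asymp
  moreover have "eventually (\<lambda>x. ln x \<le> x * exp (- (2 * a * U x))) at_top"
    unfolding U_def using a by real_asymp
  moreover have "eventually (\<lambda>x. x powr (1 - \<delta>) \<le> x * exp (- (2 * a * U x))) at_top"
    unfolding U_def using a \<delta>(1) by real_asymp
  \<comment> \<open>Heights up to T therefore satisfy u <= L^(3/5), hence ln u <= 3/5 ln L, which is
    the origin of the number 3/5 in c1.\<close>
  moreover have "eventually (\<lambda>x. 2 * a * U x \<le> ln x powr (3/5)) at_top"
    unfolding U_def using a by real_asymp
  moreover have "eventually (\<lambda>x::real. ln (ln x) > 0) at_top" by real_asymp
  moreover have "eventually (\<lambda>x::real. ln x > 0) at_top" by real_asymp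
  ultimately have "\<forall>\<^sub>F x in at_top. \<bar>rbar x\<bar> \<le> (4 * (D * K) + 2 * C) * x * exp (- (2 * a * U x))"
    using eventually_ge_at_top[of 3]
  proof eventually_elim
    case (elim x)
    define T where "T = exp (2 * a * U x)"
    define A where "A = a * U x"
    define L where "L = ln x"
    have L: "L > 0" "ln L > 0" using elim by (auto simp: L_def)
    have x0: "x > 0" using elim by simp
    have U0: "U x > 0" using L by (simp add: U_def L_def)
    have A0: "A > 0" using a U0 by (simp add: A_def)
    have A53: "2 * A powr (5/3) = c0 * L * (3/5 * ln L) powr (- 1/3)"
    proof -
      have "U x powr (5/3) = L powr 1 * ln L powr (- 1/3)"
        unfolding U_def L_def[symmetric] using L by (simp add: powr_mult powr_powr)
      hence "2 * A powr (5/3) = (2 * a powr (5/3)) * (L * ln L powr (- 1/3))"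
        using a U0 L by (simp add: A_def powr_mult)
      also have "\<dots> = c0 * L * ((3/5) powr (- 1/3) * ln L powr (- 1/3))" unfolding a53 by simp
      also have "(3/5) powr (- 1/3) * ln L powr (- 1/3) = (3/5 * ln L) powr (- 1/3)"
        by (subst powr_mult) (use L in auto)
      finally show ?thesis .
    qed
    have B: "x powr Re \<rho> * norm \<rho> powr (- 1/2) \<le> x * exp (- (2 * A)) * D" if \<rho>: "\<rho> \<in> zeros_upto T" for \<rho>
    proof (cases "\<bar>Im \<rho>\<bar> \<le> T1")
      case True
      have nz: "nontrivial_zero \<rho>" using \<rho> by (simp add: zeros_upto_def)
      have "Re \<rho> \<le> 1 - \<delta>" by (rule \<delta>(2)) (use True nz in \<open>simp add: zeros_upto_def\<close>)
      hence "x powr Re \<rho> \<le> x powr (1 - \<delta>)" using elim by (intro powr_mono) auto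
      also have "\<dots> \<le> x * exp (- (2 * A))" using elim by (simp add: A_def mult.assoc)
      finally have 1: "x powr Re \<rho> \<le> x * exp (- (2 * A))" .
      have "norm \<rho> powr (- 1/2) \<le> d powr (- 1/2)" using d nz by (intro powr_mono2') auto
      hence "norm \<rho> powr (- 1/2) \<le> D" by (simp add: D_def)
      thus ?thesis using 1 x0 by (intro mult_mono) auto
    next
      case False
      define t where "t = \<bar>Im \<rho>\<bar>"
      define u where "u = ln t"
      have nz: "nontrivial_zero \<rho>" "t \<le> T" using \<rho> by (auto simp: zeros_upto_def t_def)
      have t: "t \<ge> T0" "t \<ge> exp (exp 1)" using False by (simp_all add: T1_def t_def)
      have t0: "t > 0" using less_le_trans[OF exp_gt_zero t(2)] .
      note t = t t0
      have u: "u \<ge> exp 1" unfolding u_def using t by (subst ln_ge_iff) auto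
      have u0: "u > 0" using u exp_gt_zero[of "1::real"] by linarith
      have lu: "ln u \<ge> 1" using u u0 by (subst ln_ge_iff) auto
      have "u \<le> ln T" unfolding u_def using nz(2) t by simp
      hence "u \<le> 2 * a * U x" by (simp add: T_def)
      hence "u \<le> L powr (3/5)" using elim by (simp add: L_def)
      hence "ln u \<le> ln (L powr (3/5))" using u0 by (intro ln_mono)
      also have "\<dots> = 3/5 * ln L" using L by (simp add: ln_powr)
      finally have lnu: "ln u \<le> 3/5 * ln L" .
      obtain \<rho>' where \<rho>': "nontrivial_zero \<rho>'" "Re \<rho>' = Re \<rho>" "Im \<rho>' = t"
      proof (cases "Im \<rho> \<ge> 0")
        case True
        thus ?thesis using that[of \<rho>] nz(1) by (simp add: t_def)
      next
        case False
        thus ?thesis using that[of "cnj \<rho>"] nontrivial_zero_cnj[OF nz(1)] by (simp add: t_def)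
      qed
      have "\<rho>' = Complex (Re \<rho>) t" using \<rho>' by (simp add: complex_eq_iff)
      hence "zeta (Complex (Re \<rho>) t) = 0" using \<rho>'(1) by (simp add: nontrivial_zero_def)
      hence Re1: "Re \<rho> \<le> 1 - c0 * (u\<^sup>2 * ln u) powr (- 1/3)"
        using free[OF t(1), of "Re \<rho>"] unfolding u_def by linarith
      \<comment> \<open>The exponent is negative, so replacing ln u by its upper bound only narrows
        the zero-free region that is used.\<close>
      have "u powr (- 2/3) * (3/5 * ln L) powr (- 1/3) \<le> (u\<^sup>2 * ln u) powr (- 1/3)"
      proof -
        have "(u\<^sup>2 * ln u) powr (- 1/3) = (u powr 2) powr (- 1/3) * ln u powr (- 1/3)"
          using u0 lu by (simp add: powr_mult powr_numeral)
        also have "(u powr 2) powr (- 1/3) = u powr (- 2/3)" by (simp add: powr_powr)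
        finally have "(u\<^sup>2 * ln u) powr (- 1/3) = u powr (- 2/3) * ln u powr (- 1/3)" .
        moreover have "(3/5 * ln L) powr (- 1/3) \<le> ln u powr (- 1/3)"
          using lnu lu by (intro powr_mono2') auto
        ultimately show ?thesis by (simp add: mult_left_mono)
      qed
      hence "c0 * (u powr (- 2/3) * (3/5 * ln L) powr (- 1/3)) \<le> c0 * (u\<^sup>2 * ln u) powr (- 1/3)"
        using c0 by (intro mult_left_mono) auto
      hence "Re \<rho> \<le> 1 - c0 * (u powr (- 2/3) * (3/5 * ln L) powr (- 1/3))" using Re1 by linarith
      hence "Re \<rho> * L \<le> (1 - c0 * (u powr (- 2/3) * (3/5 * ln L) powr (- 1/3))) * L"
        using L by (intro mult_right_mono) auto
      also have "\<dots> = L - (c0 * L * (3/5 * ln L) powr (- 1/3)) * u powr (- 2/3)"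
        by (simp add: algebra_simps)
      also have "\<dots> = L - 2 * A powr (5/3) * u powr (- 2/3)" unfolding A53 ..
      finally have "Re \<rho> * L - u / 2 \<le> L - 2 * A" using exponent_balance[OF A0 u0] by linarith
      hence e: "exp (Re \<rho> * L - u / 2) \<le> exp (L - 2 * A)" by simp
      have "norm \<rho> powr (- 1/2) \<le> t powr (- 1/2)"
        using t abs_Im_le_cmod[of \<rho>] by (intro powr_mono2') (auto simp: t_def)
      hence "x powr Re \<rho> * norm \<rho> powr (- 1/2) \<le> x powr Re \<rho> * t powr (- 1/2)"
        by (intro mult_left_mono) auto
      also have "\<dots> = exp (Re \<rho> * L - u / 2)" using x0 t by (simp add: powr_def L_def u_def flip: exp_add)
      also have "\<dots> \<le> exp (L - 2 * A)" by (rule e)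
      also have "\<dots> = x * exp (- (2 * A)) * 1"
        using x0 by (simp add: exp_diff exp_minus L_def divide_inverse)
      also have "\<dots> \<le> x * exp (- (2 * A)) * D" using x0 by (intro mult_left_mono) (auto simp: D_def)
      finally show ?thesis .
    qed
    have "(\<Sum>\<rho>\<in>zeros_upto T. real (zmult zeta_reg \<rho>) * x powr Re \<rho> * norm \<rho> powr (-2)) \<le> (x * exp (- (2 * A)) * D) * K"
      by (rule zeros_sum_le[OF K(2) _ B]) (use x0 in \<open>simp_all add: D_def\<close>)
    \<comment> \<open>T equals the saving exp (2 A), while the truncation error has T^2 in its
      denominator; the spare factor T absorbs ln^2 x.\<close>
    moreover have "x * (ln x)\<^sup>2 / T\<^sup>2 \<le> x * exp (- (2 * A))"
    proof -
      have T0: "T > 0" by (simp add: T_def)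
      have "x * (ln x)\<^sup>2 / T\<^sup>2 \<le> x * T / T\<^sup>2"
        using elim x0 by (intro divide_right_mono mult_left_mono) (auto simp: T_def)
      also have "\<dots> = x * (1 / T)" using T0 by (simp add: power2_eq_square)
      also have "1 / T = exp (- (2 * A))" by (simp add: T_def A_def exp_minus divide_inverse mult.assoc)
      finally show ?thesis .
    qed
    moreover have "ln x \<le> x * exp (- (2 * A))" using elim by (simp add: A_def mult.assoc)
    moreover have "\<bar>rbar x\<bar> \<le> 4 * (\<Sum>\<rho>\<in>zeros_upto T. real (zmult zeta_reg \<rho>) * x powr Re \<rho> * norm \<rho> powr (-2))
        + C * (x * (ln x)\<^sup>2 / T\<^sup>2 + ln x)"
      by (rule C(2)) (use elim in \<open>auto simp: T_def\<close>)
    ultimately have "\<bar>rbar x\<bar> \<le> 4 * ((x * exp (- (2 * A)) * D) * K) + C * (x * exp (- (2 * A)) + x * exp (- (2 * A)))"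
      using C(1) by (smt (verit) mult_left_mono)
    also have "\<dots> = (4 * (D * K) + 2 * C) * x * exp (- (2 * A))" by (simp add: algebra_simps)
    also have "2 * A = 2 * a * U x" by (simp add: A_def)
    finally show ?case .
  qed
  moreover have "- (2 * a * U x) = - (2 powr (2/5)) * c1 * ln x powr (3/5) * ln (ln x) powr (-1/5)" for x
    unfolding a2 U_def by simp
  ultimately show ?thesis by (intro exI[of _ "4 * (D * K) + 2 * C"]) simp
qed

theorem theorem1:
  shows "(\<exists>C. \<forall>\<^sub>F x in at_top. \<bar>rbar x\<bar> \<le> C * x powr (eta x))
       \<and> (\<forall>c0::real. c0 > 0 \<longrightarrow>
            (\<exists>T0. \<forall>\<sigma> t. t \<ge> T0 \<and> \<sigma> \<ge> 1 - c0 * (ln t ^ 2 * ln (ln t)) powr (-1/3)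
                      \<longrightarrow> zeta (Complex \<sigma> t) \<noteq> 0) \<longrightarrow>
          (let c1 = c0 powr (3/5) * (3/5) powr (-1/5) in
            \<exists>C. \<forall>\<^sub>F x in at_top. \<bar>rbar x\<bar> \<le>
             C * x * exp (- (2 powr (2/5)) * c1 * ln x powr (3/5) * ln (ln x) powr (-1/5))))"
  unfolding Let_def using rbar_le_eta rbar_le_zero_free_region by blast

end
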